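(* Let $\mathcal H=\bigoplus_{n\ge0}\mathcal H_n$ be a graded connected Hopf algebra over $\mathbb R$ with each $\mathcal H_n$ finite-dimensional, and $\tau:\mathcal H\to\mathcal H$ a linear graded involution that is a Hopf ambimorphism. Let $D$ be a signed or tilde-signed weak-composition of $n$. (i) The eigenvalues of $m\circ\Delta_{D(\tau)}:\mathcal H_n\to\mathcal H_n$ are the numbers $\beta^D_{\lambda,\bar\lambda}$, as $(\lambda,\bar\lambda)$ ranges over all double-partitions of $n$. (ii) The multiplicity of the eigenvalue $\beta^D_{\lambda,\bar\lambda}$ is the coefficient of $x_{\lambda_1}\cdots x_{\lambda_{l(\lambda)}}\bar x_{\bar\lambda_1}\cdots\bar x_{\bar\lambda_{l(\bar\lambda)}}$ in $\prod_i(1-x_i)^{-b_i}\prod_i(1-\bar x_i)^{-\bar b_i}$, where the nonnegative integers $b_i,\bar b_i$ satisfy $$\sum_n\dim\mathcal H_n\,x^n=\prod_i(1-x^i)^{-b_i-\bar b_i},\qquad \sum_n(\dim\mathcal H_n^{\tau}-\dim\mathcal H_n^{-\tau})x^n=\prod_i(1-x^i)^{-b_i}\prod_i(1+x^i)^{-\bar b_i}.$$ (iii) If $D_1,\dots,D_r$ are all signed weak-compositions of $n$, or all tilde-signed weak-compositions of $n$, and $a_1,\dots,a_r\in\mathbb R$, then the eigenvalues of $\sum_{i=1}^r a_i\,m\circ\Delta_{D_i(\tau)}:\mathcal H_n\to\mathcal H_n$ are $\sum_{i=1}^ra_i\beta^{D_i}_{\lambda,\bar\lambda}$, with multiplicities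 as in (ii).
   Context: Graded connected Hopf algebra over $\mathbb R$: $\mathcal H=\bigoplus_{n\ge0}\mathcal H_n$, $\mathcal H_0=\mathbb R\cdot1$, graded product $m$ (also for iterated products) and coproduct $\Delta$; $\Delta^{[l]}$ is the iterated coproduct and for a weak-composition $E=(e_1,\dots,e_l)$ of $n$ (nonnegative integers summing to $n$), $\Delta_E$ is $\Delta^{[l]}$ restricted to $\mathcal H_n$ followed by projection to $\mathcal H_{e_1}\otimes\cdots\otimes\mathcal H_{e_l}$. A Hopf ambimorphism is a linear map that is an algebra morphism ($f(wz)=f(w)f(z)$) or algebra antimorphism ($f(wz)=f(z)f(w)$), and also a coalgebra morphism ($\Delta f=(f\otimes f)\Delta$) or coalgebra antimorphism ($\Delta f=(f\otimes f)\circ\mathrm{swap}\circ\Delta$). $V^{\tau}$ and $V^{-\tau}$ denote the eigenspaces of $\tau$ for eigenvalues $1$ and $-1$. A signed (resp. tilde-signed) weak-composition is a weak-composition some of whose parts are decorated with a bar (resp. tilde-bar); $D^+$ forgets decorations. $m\circ\Delta_{D(\tau)}$ is: apply $\Delta_{D^+}$, then $\tau$ on the tensor factors corresponding to decorated parts, then multiply. A double-partition of $n$ is a pair of partitions $\lambda,\bar\lambda$ (viewed as multisets of positive integers) with $\sum\lambda_i+\sum\bar\lambda_i=n$. For a weak-composition $E=(e_1,\dots,e_l)$, a set-composition $B_1|\cdots|B_l$ (sequence of possibly empty disjoint blocks with union) of $\{1,\dots,l(\lambda)\}\cup\{\bar1,\dots,\overline{l(\bar\lambda)}\}$ is compatible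 with $\lambda,\bar\lambda,E$ if $\sum_{j\in B_i}\lambda_j+\sum_{\bar j\in B_i}\bar\lambda_j=e_i$ for every $i$. For decorated $D$, $\beta^D_{\lambda,\bar\lambda}$ is the sum over set-compositions $B$ compatible with $\lambda,\bar\lambda,D^+$ of $(-1)^{s(B)}$, where $s(B)$ is the number of barred elements $\bar j$ lying in blocks $B_i$ for which $d_i$ is decorated. *)

theory Defs
  imports
    "Jordan_Normal_Form.Char_Poly"
    "HOL-Analysis.Infinite_Products"
    "HOL-Analysis.Finite_Function_Topology"
    "HOL-Computational_Algebra.Formal_Power_Series"
    "HOL-Library.Multiset"
begin

section \<open>Tensor powers\<close>

text \<open>
  All tensor powers of a real vector space \<open>V\<close> live in one type, the direct sum
  \<open>T(V) = \<Oplus>\<^sub>l V\<^sup>\<otimes>\<^sup>l\<close>, built as the free vector space on lists of vectors modulo multilinearity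
  in every list position.  A map on \<open>V\<^sup>\<otimes>\<^sup>l\<close> is extended by \<open>0\<close> to the other powers.
\<close>

definition multilinear_rels :: "('a::real_vector list \<Rightarrow>\<^sub>0 real) set" where
  "multilinear_rels =
     {Poly_Mapping.single (xs @ (a + b) # ys) 1 - Poly_Mapping.single (xs @ a # ys) 1
        - Poly_Mapping.single (xs @ b # ys) 1 | xs a b ys. True}
   \<union> {Poly_Mapping.single (xs @ (c *\<^sub>R a) # ys) 1 - c *\<^sub>R Poly_Mapping.single (xs @ a # ys) 1
        | xs c a ys. True}"

definition tensor_eq :: "('a::real_vector list \<Rightarrow>\<^sub>0 real) \<Rightarrow> ('a list \<Rightarrow>\<^sub>0 real) \<Rightarrow> bool" where
  "tensor_eq p q \<longleftrightarrow> p - q \<in> span multilinear_rels"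

quotient_type (overloaded) 'a tensor_alg = "'a::real_vector list \<Rightarrow>\<^sub>0 real" / tensor_eq
proof (rule equivpI)
  show "reflp tensor_eq"
    by (simp add: reflp_def tensor_eq_def span_zero)
  show "symp tensor_eq"
    unfolding symp_def tensor_eq_def
    by (metis minus_diff_eq span_neg)
  show "transp tensor_eq"
    unfolding transp_def tensor_eq_def
    by (metis (no_types) diff_add_cancel add_diff_eq span_add)
qed

instantiation tensor_alg :: (real_vector) real_vector
begin

lift_definition zero_tensor_alg :: "'a tensor_alg" is 0 .

lift_definition plus_tensor_alg :: "'a tensor_alg \<Rightarrow> 'a tensor_alg \<Rightarrow> 'a tensor_alg" is "(+)"
  unfolding tensor_eq_def by (metis add_diff_add span_add)

lift_definition uminus_tensor_alg :: "'a tensor_alg \<Rightarrow> 'a tensor_alg" is uminus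
  unfolding tensor_eq_def by (metis minus_diff_minus span_neg)

lift_definition minus_tensor_alg :: "'a tensor_alg \<Rightarrow> 'a tensor_alg \<Rightarrow> 'a tensor_alg" is "(-)"
  unfolding tensor_eq_def
proof -
  fix p q r s :: "'a list \<Rightarrow>\<^sub>0 real"
  assume "p - q \<in> span multilinear_rels" "r - s \<in> span multilinear_rels"
  then have "(p - q) - (r - s) \<in> span multilinear_rels" by (rule span_diff)
  moreover have "(p - q) - (r - s) = (p - r) - (q - s)" by (simp add: algebra_simps)
  ultimately show "p - r - (q - s) \<in> span multilinear_rels" by simp
qed

lift_definition scaleR_tensor_alg :: "real \<Rightarrow> 'a tensor_alg \<Rightarrow> 'a tensor_alg" is "(*\<^sub>R)"
  unfolding tensor_eq_def by (metis scaleR_diff_right span_scale)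

instance
proof
  fix x y z :: "'a tensor_alg" and a b :: real
  have eqI: "tensor_eq p q" if "p = q" for p q :: "'a list \<Rightarrow>\<^sub>0 real"
    using that by (simp add: tensor_eq_def span_zero)
  show "x + y + z = x + (y + z)" by transfer (rule eqI, simp add: algebra_simps)
  show "x + y = y + x" by transfer (rule eqI, simp add: algebra_simps)
  show "0 + x = x" by transfer (rule eqI, simp)
  show "- x + x = 0" by transfer (rule eqI, simp)
  show "x - y = x + - y" by transfer (rule eqI, simp)
  show "a *\<^sub>R (x + y) = a *\<^sub>R x + a *\<^sub>R y" by transfer (rule eqI, simp add: scaleR_add_right)
  show "(a + b) *\<^sub>R x = a *\<^sub>R x + b *\<^sub>R x" by transfer (rule eqI, simp add: scaleR_add_left)
  show "a *\<^sub>R b *\<^sub>R x = (a * b) *\<^sub>R x" by transfer (rule eqI, simp)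
  show "1 *\<^sub>R x = x" by transfer (rule eqI, simp)
qed

end

text \<open>\<open>tensor [v\<^sub>1, \<dots>, v\<^sub>l]\<close> is the pure tensor \<open>v\<^sub>1 \<otimes> \<dots> \<otimes> v\<^sub>l\<close>.\<close>

lift_definition tensor :: "'a::real_vector list \<Rightarrow> 'a tensor_alg" is
  "\<lambda>xs. Poly_Mapping.single xs (1::real)" .

definition multilinear :: "('a::real_vector list \<Rightarrow> 'b::real_vector) \<Rightarrow> bool" where
  "multilinear g \<longleftrightarrow>
     (\<forall>xs a b ys. g (xs @ (a + b) # ys) = g (xs @ a # ys) + g (xs @ b # ys)) \<and>
     (\<forall>xs c a ys. g (xs @ (c *\<^sub>R a) # ys) = c *\<^sub>R g (xs @ a # ys))"

definition free_extend :: "('k \<Rightarrow> 'b::real_vector) \<Rightarrow> ('k \<Rightarrow>\<^sub>0 real) \<Rightarrow> 'b" where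
  "free_extend g p = (\<Sum>k\<in>Poly_Mapping.keys p. Poly_Mapping.lookup p k *\<^sub>R g k)"

text \<open>
  The linear map on \<open>T(V)\<close> induced by \<open>g\<close>; meaningful for multilinear \<open>g\<close> only, where it does not
  depend on the representative (\<open>tensor_lift_tensor\<close>, \<open>linear_tensor_lift\<close> below).
\<close>

definition tensor_lift ::
  "('a::real_vector list \<Rightarrow> 'b::real_vector) \<Rightarrow> 'a tensor_alg \<Rightarrow> 'b" where
  "tensor_lift g t = free_extend g (rep_tensor_alg t)"

lemma lookup_scaleR_pm [simp]:
  "Poly_Mapping.lookup (c *\<^sub>R p) k = c *\<^sub>R Poly_Mapping.lookup (p :: 'k \<Rightarrow>\<^sub>0 'b::real_vector) k"
proof -
  have "finite {i. c *\<^sub>R Poly_Mapping.lookup p i \<noteq> 0}"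
    by (rule finite_subset[OF _ finite_lookup[of p]]) auto
  then show ?thesis
    by (simp add: scaleR_poly_mapping_def Abs_poly_mapping_inverse)
qed

lemma free_extend_superset:
  assumes "finite S" "Poly_Mapping.keys p \<subseteq> S"
  shows "free_extend g p = (\<Sum>k\<in>S. Poly_Mapping.lookup p k *\<^sub>R g k)"
  unfolding free_extend_def
  by (rule sum.mono_neutral_left[OF assms]) (auto simp: in_keys_iff)

lemma linear_free_extend: "linear (free_extend g)"
proof (rule linearI)
  fix p q :: "'a \<Rightarrow>\<^sub>0 real"
  let ?S = "Poly_Mapping.keys p \<union> Poly_Mapping.keys q"
  have "Poly_Mapping.keys (p + q) \<subseteq> ?S" by (rule Poly_Mapping.keys_add)
  then show "free_extend g (p + q) = free_extend g p + free_extend g q"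
    by (simp add: free_extend_superset[of ?S] lookup_add scaleR_add_left sum.distrib)
next
  fix c :: real and p :: "'a \<Rightarrow>\<^sub>0 real"
  have "Poly_Mapping.keys (c *\<^sub>R p) \<subseteq> Poly_Mapping.keys p"
    by (auto simp: in_keys_iff)
  then have "free_extend g (c *\<^sub>R p)
      = (\<Sum>k\<in>Poly_Mapping.keys p. Poly_Mapping.lookup (c *\<^sub>R p) k *\<^sub>R g k)"
    by (intro free_extend_superset) auto
  then show "free_extend g (c *\<^sub>R p) = c *\<^sub>R free_extend g p"
    by (simp add: free_extend_def scaleR_sum_right)
qed

lemma free_extend_single [simp]: "free_extend g (Poly_Mapping.single k c) = c *\<^sub>R g k"
  by (simp add: free_extend_superset[of "{k}"])

lemma free_extend_tensor_eq:
  assumes "multilinear g" "tensor_eq p q"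
  shows "free_extend g p = free_extend g q"
proof -
  interpret linear "free_extend g" by (rule linear_free_extend)
  have "free_extend g r = 0" if "r \<in> span multilinear_rels" for r
    using that
  proof (induction rule: span_induct_alt)
    case base
    show ?case by (rule zero)
  next
    case (step c x y)
    then have "free_extend g x = 0"
      using assms(1) by (auto simp: multilinear_rels_def multilinear_def diff scale)
    then show ?case using step by (simp add: add scale)
  qed
  then have "free_extend g (p - q) = 0"
    using assms(2) by (simp add: tensor_eq_def)
  then show ?thesis by (simp add: diff)
qed

lemma tensor_lift_abs:
  assumes "multilinear g"
  shows "tensor_lift g (abs_tensor_alg p) = free_extend g p"
proof -
  have "tensor_eq (rep_tensor_alg (abs_tensor_alg p)) p"
    using Quotient3_abs_rep[OF Quotient3_tensor_alg] by (simp add: tensor_alg.abs_eq_iff[symmetric])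
  then show ?thesis
    unfolding tensor_lift_def by (rule free_extend_tensor_eq[OF assms])
qed

lemma tensor_lift_tensor:
  assumes "multilinear g"
  shows "tensor_lift g (tensor xs) = g xs"
  by (simp add: tensor.abs_eq tensor_lift_abs[OF assms])

lemma linear_tensor_lift:
  assumes "multilinear g"
  shows "linear (tensor_lift g)"
proof -
  interpret linear "free_extend g" by (rule linear_free_extend)
  have ex: "\<exists>p. t = abs_tensor_alg p" for t :: "'a tensor_alg"
    using Quotient_abs_rep[OF Quotient_tensor_alg] by metis
  show ?thesis
  proof (rule linearI)
    fix s t :: "'a tensor_alg"
    obtain p q where "s = abs_tensor_alg p" "t = abs_tensor_alg q" using ex by blast
    then show "tensor_lift g (s + t) = tensor_lift g s + tensor_lift g t"
      by (simp add: plus_tensor_alg.abs_eq tensor_lift_abs[OF assms] add)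
  next
    fix c :: real and s :: "'a tensor_alg"
    obtain p where "s = abs_tensor_alg p" using ex by blast
    then show "tensor_lift g (c *\<^sub>R s) = c *\<^sub>R tensor_lift g s"
      by (simp add: scaleR_tensor_alg.abs_eq tensor_lift_abs[OF assms] scale)
  qed
qed

definition tensor_append ::
  "'a::real_vector tensor_alg \<Rightarrow> 'a tensor_alg \<Rightarrow> 'a tensor_alg" (infixr \<open>\<otimes>\<^sub>T\<close> 70) where
  "s \<otimes>\<^sub>T t = tensor_lift (\<lambda>xs. tensor_lift (\<lambda>ys. tensor (xs @ ys)) t) s"

text \<open>The identification of \<open>V\<close> with the first tensor power.\<close>

definition tensor1 :: "'a::real_vector \<Rightarrow> 'a tensor_alg" where
  "tensor1 x = tensor [x]"

text \<open>
  \<open>tensor_maps [f\<^sub>1, \<dots>, f\<^sub>l]\<close> is \<open>f\<^sub>1 \<otimes> \<dots> \<otimes> f\<^sub>l\<close> on the \<open>l\<close>-th tensor power, where the linear maps \<open>f\<^sub>i\<close>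
  may take values in tensor powers; an endomorphism \<open>f\<close> of \<open>V\<close> enters as \<open>tensor1 \<circ> f\<close>.
\<close>

definition tensor_maps ::
  "('a::real_vector \<Rightarrow> 'b::real_vector tensor_alg) list \<Rightarrow> 'a tensor_alg \<Rightarrow> 'b tensor_alg" where
  "tensor_maps fs = tensor_lift (\<lambda>xs.
     if length xs = length fs then foldr (\<otimes>\<^sub>T) (map2 (\<lambda>f x. f x) fs xs) (tensor []) else 0)"

definition tensor_swap :: "'a::real_vector tensor_alg \<Rightarrow> 'a tensor_alg" where
  "tensor_swap = tensor_lift (\<lambda>xs. if length xs = 2 then tensor (rev xs) else 0)"

text \<open>Componentwise product, \<open>(a \<otimes> b)(c \<otimes> d) = ac \<otimes> bd\<close> on the second tensor power.\<close>

definition tensor_times ::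
  "'a::real_algebra_1 tensor_alg \<Rightarrow> 'a tensor_alg \<Rightarrow> 'a tensor_alg" where
  "tensor_times s t = tensor_lift (\<lambda>xs. tensor_lift
     (\<lambda>ys. if length xs = length ys then tensor (map2 (*) xs ys) else 0) t) s"

definition tensor_multiply :: "'a::real_algebra_1 tensor_alg \<Rightarrow> 'a" where
  "tensor_multiply = tensor_lift prod_list"


section \<open>Graded connected Hopf algebras and Hopf ambimorphisms\<close>

text \<open>\<open>c\<close> lists the homogeneous components of \<open>x\<close>.\<close>

definition is_decomposition ::
  "(nat \<Rightarrow> 'a::real_vector set) \<Rightarrow> 'a \<Rightarrow> (nat \<Rightarrow> 'a) \<Rightarrow> bool" where
  "is_decomposition H x c \<longleftrightarrow>
     finite {n. c n \<noteq> 0} \<and> (\<forall>n. c n \<in> H n) \<and> x = (\<Sum>n | c n \<noteq> 0. c n)"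

definition homogeneous_component ::
  "(nat \<Rightarrow> 'a::real_vector set) \<Rightarrow> nat \<Rightarrow> 'a \<Rightarrow> 'a" where
  "homogeneous_component H n x = (THE c. is_decomposition H x c) n"

text \<open>
  The underlying unital associative algebra is the type \<open>'a\<close>; \<open>H n\<close> is its degree \<open>n\<close> part.
\<close>

locale graded_connected_hopf_algebra =
  fixes H :: "nat \<Rightarrow> 'a::real_algebra_1 set"
    and \<Delta> :: "'a \<Rightarrow> 'a tensor_alg"
    and \<epsilon> :: "'a \<Rightarrow> real"
  assumes subspace_H: "subspace (H n)"
    and direct_sum: "\<exists>!c. is_decomposition H x c"
    and connected: "H 0 = span {1}"
    and mult_graded: "x \<in> H i \<Longrightarrow> y \<in> H j \<Longrightarrow> x * y \<in> H (i + j)"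
    and linear_coproduct: "linear \<Delta>"
    and coproduct_graded:
      "x \<in> H n \<Longrightarrow> \<Delta> x \<in> span {tensor [y, z] | y z i j. y \<in> H i \<and> z \<in> H j \<and> i + j = n}"
    and linear_counit: "linear \<epsilon>"
    and counit_graded: "x \<in> H n \<Longrightarrow> n > 0 \<Longrightarrow> \<epsilon> x = 0"
    and coassoc: "tensor_maps [\<Delta>, tensor1] (\<Delta> x) = tensor_maps [tensor1, \<Delta>] (\<Delta> x)"
    and counit_left: "tensor_maps [\<lambda>y. \<epsilon> y *\<^sub>R tensor [], tensor1] (\<Delta> x) = tensor1 x"
    and counit_right: "tensor_maps [tensor1, \<lambda>y. \<epsilon> y *\<^sub>R tensor []] (\<Delta> x) = tensor1 x"
    and coproduct_mult: "\<Delta> (x * y) = tensor_times (\<Delta> x) (\<Delta> y)"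
    and coproduct_one: "\<Delta> 1 = tensor [1, 1]"
    and counit_mult: "\<epsilon> (x * y) = \<epsilon> x * \<epsilon> y"
    and counit_one: "\<epsilon> 1 = 1"
    and antipode: "\<exists>S. linear S \<and> (\<forall>x.
        tensor_multiply (tensor_maps [tensor1 \<circ> S, tensor1] (\<Delta> x)) = \<epsilon> x *\<^sub>R 1 \<and>
        tensor_multiply (tensor_maps [tensor1, tensor1 \<circ> S] (\<Delta> x)) = \<epsilon> x *\<^sub>R 1)"

definition hopf_ambimorphism ::
  "('a::real_algebra_1 \<Rightarrow> 'a tensor_alg) \<Rightarrow> ('a \<Rightarrow> 'a) \<Rightarrow> bool" where
  "hopf_ambimorphism \<Delta> f \<longleftrightarrow> linear f \<and>
     ((\<forall>w z. f (w * z) = f w * f z) \<or> (\<forall>w z. f (w * z) = f z * f w)) \<and>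
     ((\<forall>x. \<Delta> (f x) = tensor_maps [tensor1 \<circ> f, tensor1 \<circ> f] (\<Delta> x)) \<or>
      (\<forall>x. \<Delta> (f x) = tensor_maps [tensor1 \<circ> f, tensor1 \<circ> f] (tensor_swap (\<Delta> x))))"

definition finite_dimensional_set :: "'a::real_vector set \<Rightarrow> bool" where
  "finite_dimensional_set V \<longleftrightarrow> (\<exists>B. finite B \<and> V \<subseteq> span B)"


section \<open>Descent operators with decorations\<close>

datatype decoration = Plain | Bar | Tilde_Bar

text \<open>A decorated weak-composition is the list of its parts with their decorations.\<close>

type_synonym decorated_composition = "(nat \<times> decoration) list"

definition undecorate :: "decorated_composition \<Rightarrow> nat list" where
  "undecorate D = map fst D"

definition weak_composition :: "nat \<Rightarrow> nat list \<Rightarrow> bool" where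
  "weak_composition n E \<longleftrightarrow> sum_list E = n"

definition signed_weak_composition :: "nat \<Rightarrow> decorated_composition \<Rightarrow> bool" where
  "signed_weak_composition n D \<longleftrightarrow>
     weak_composition n (undecorate D) \<and> snd ` set D \<subseteq> {Plain, Bar}"

definition tilde_signed_weak_composition :: "nat \<Rightarrow> decorated_composition \<Rightarrow> bool" where
  "tilde_signed_weak_composition n D \<longleftrightarrow>
     weak_composition n (undecorate D) \<and> snd ` set D \<subseteq> {Plain, Tilde_Bar}"

text \<open>\<open>\<Delta>\<^sup>[\<^sup>l\<^sup>]\<close> takes values in the \<open>l\<close>-th tensor power, so \<open>\<Delta>\<^sup>[\<^sup>1\<^sup>]\<close> is the identity, \<open>\<Delta>\<^sup>[\<^sup>2\<^sup>] = \<Delta>\<close>, and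
  \<open>\<Delta>\<^sup>[\<^sup>0\<^sup>]\<close> (needed for the empty composition of \<open>0\<close>) is the counit.\<close>

fun iterated_coproduct ::
  "('a::real_vector \<Rightarrow> 'a tensor_alg) \<Rightarrow> ('a \<Rightarrow> real) \<Rightarrow> nat \<Rightarrow> 'a \<Rightarrow> 'a tensor_alg" where
  "iterated_coproduct \<Delta> \<epsilon> 0 x = \<epsilon> x *\<^sub>R tensor []"
| "iterated_coproduct \<Delta> \<epsilon> (Suc 0) x = tensor1 x"
| "iterated_coproduct \<Delta> \<epsilon> (Suc (Suc l)) x =
     tensor_maps (\<Delta> # replicate l tensor1) (iterated_coproduct \<Delta> \<epsilon> (Suc l) x)"

definition coproduct_component ::
  "(nat \<Rightarrow> 'a::real_vector set) \<Rightarrow> ('a \<Rightarrow> 'a tensor_alg) \<Rightarrow> ('a \<Rightarrow> real) \<Rightarrow> nat list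
     \<Rightarrow> 'a \<Rightarrow> 'a tensor_alg" where
  "coproduct_component H \<Delta> \<epsilon> E x =
     tensor_maps (map (\<lambda>e. tensor1 \<circ> homogeneous_component H e) E)
       (iterated_coproduct \<Delta> \<epsilon> (length E) x)"

text \<open>The operator \<open>m \<circ> \<Delta>\<^bsub>D(\<tau>)\<^esub>\<close>.\<close>

definition descent_op ::
  "(nat \<Rightarrow> 'a::real_algebra_1 set) \<Rightarrow> ('a \<Rightarrow> 'a tensor_alg) \<Rightarrow> ('a \<Rightarrow> real) \<Rightarrow> ('a \<Rightarrow> 'a)
     \<Rightarrow> decorated_composition \<Rightarrow> 'a \<Rightarrow> 'a" where
  "descent_op H \<Delta> \<epsilon> \<tau> D x =
     tensor_multiply
       (tensor_maps (map (\<lambda>(e, d). if d = Plain then tensor1 else tensor1 \<circ> \<tau>) D)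
         (coproduct_component H \<Delta> \<epsilon> (undecorate D) x))"


section \<open>Double-partitions and the numbers \<open>\<beta>\<close>\<close>

definition double_partitions :: "nat \<Rightarrow> (nat multiset \<times> nat multiset) set" where
  "double_partitions n =
     {(l, l'). 0 \<notin># l \<and> 0 \<notin># l' \<and> sum_mset l + sum_mset l' = n}"

text \<open>\<open>part l j\<close> is \<open>\<lambda>\<^sub>j\<close>, where the parts \<open>\<lambda>\<^sub>1 \<ge> \<lambda>\<^sub>2 \<ge> \<dots>\<close> are numbered from 1.\<close>

definition part :: "nat multiset \<Rightarrow> nat \<Rightarrow> nat" where
  "part l j = rev (sorted_list_of_multiset l) ! (j - 1)"

text \<open>\<open>Inl j\<close> stands for \<open>j\<close> and \<open>Inr j\<close> for the barred element.\<close>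

definition compatible_set_compositions ::
  "nat multiset \<Rightarrow> nat multiset \<Rightarrow> nat list \<Rightarrow> (nat + nat) set list set" where
  "compatible_set_compositions l l' E =
     {B. length B = length E \<and>
         \<Union>(set B) = Inl ` {1..size l} \<union> Inr ` {1..size l'} \<and>
         (\<forall>i<length B. \<forall>k<length B. i \<noteq> k \<longrightarrow> B ! i \<inter> B ! k = {}) \<and>
         (\<forall>i<length E. (\<Sum>j | Inl j \<in> B ! i. part l j) + (\<Sum>j | Inr j \<in> B ! i. part l' j) = E ! i)}"

definition decorated_bars :: "decorated_composition \<Rightarrow> (nat + nat) set list \<Rightarrow> nat" where
  "decorated_bars D B = card {j. \<exists>i<length D. snd (D ! i) \<noteq> Plain \<and> Inr j \<in> B ! i}"

definition beta :: "decorated_composition \<Rightarrow> nat multiset \<Rightarrow> nat multiset \<Rightarrow> real" where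
  "beta D l l' =
     (\<Sum>B\<in>compatible_set_compositions l l' (undecorate D). (- 1) ^ decorated_bars D B)"


section \<open>Formal power series in arbitrarily many variables\<close>

text \<open>A monomial is the multiset of its variables.\<close>

typedef ('v, 'c) mfps = "UNIV :: ('v multiset \<Rightarrow> 'c) set"
  morphisms mfps_coeff Abs_mfps ..

setup_lifting type_definition_mfps

lemma mfps_eqI: "(\<And>M. mfps_coeff F M = mfps_coeff G M) \<Longrightarrow> F = G"
  by (simp add: mfps_coeff_inject[symmetric] ext)

lemma finite_mset_splittings: "finite {(A, B). A + B = (M :: 'v multiset)}"
proof -
  have "finite {A. A \<subseteq># M}"
  proof (induction M)
    case (add x M)
    have "{A. A \<subseteq># add_mset x M} \<subseteq> {A. A \<subseteq># M} \<union> add_mset x ` {A. A \<subseteq># M}"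
    proof
      fix A assume A: "A \<in> {A. A \<subseteq># add_mset x M}"
      show "A \<in> {A. A \<subseteq># M} \<union> add_mset x ` {A. A \<subseteq># M}"
      proof (cases "x \<in># A")
        case True
        then obtain A' where "A = add_mset x A'" by (metis mset_add)
        with A show ?thesis by auto
      next
        case False
        with A have "A \<subseteq># M"
          by (auto simp: subseteq_mset_def not_in_iff) (metis le_zero_eq zero_le)
        then show ?thesis by simp
      qed
    qed
    with add show ?case by (meson finite_UnI finite_imageI finite_subset)
  qed auto
  then have "finite ({A. A \<subseteq># M} \<times> {A. A \<subseteq># M})" by blast
  then show ?thesis by (rule rev_finite_subset) auto
qed

instantiation mfps :: (type, comm_ring_1) comm_ring_1
begin

lift_definition zero_mfps :: "('a, 'b) mfps" is "\<lambda>_. 0" .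
lift_definition one_mfps :: "('a, 'b) mfps" is "\<lambda>M. if M = {#} then 1 else 0" .
lift_definition plus_mfps :: "('a, 'b) mfps \<Rightarrow> ('a, 'b) mfps \<Rightarrow> ('a, 'b) mfps"
  is "\<lambda>F G M. F M + G M" .
lift_definition uminus_mfps :: "('a, 'b) mfps \<Rightarrow> ('a, 'b) mfps" is "\<lambda>F M. - F M" .
lift_definition minus_mfps :: "('a, 'b) mfps \<Rightarrow> ('a, 'b) mfps \<Rightarrow> ('a, 'b) mfps"
  is "\<lambda>F G M. F M - G M" .
lift_definition times_mfps :: "('a, 'b) mfps \<Rightarrow> ('a, 'b) mfps \<Rightarrow> ('a, 'b) mfps"
  is "\<lambda>F G M. \<Sum>(A, B) | A + B = M. F A * G B" .

instance
proof
  fix F G K :: "('a, 'b) mfps"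
  show "F * G * K = F * (G * K)"
  proof (transfer, rule ext)
    fix f g k :: "'a multiset \<Rightarrow> 'b" and M :: "'a multiset"
    have "(\<Sum>(P, C) | P + C = M. (\<Sum>(A, B) | A + B = P. f A * g B) * k C)
        = (\<Sum>p\<in>{(P, C). P + C = M}. \<Sum>q\<in>{(A, B). A + B = fst p}.
             f (fst q) * g (snd q) * k (snd p))"
      by (simp add: sum_distrib_right case_prod_unfold)
    also have "\<dots> = (\<Sum>(p, q)\<in>(SIGMA p:{(P, C). P + C = M}. {(A, B). A + B = fst p}).
             f (fst q) * g (snd q) * k (snd p))"
      by (rule sum.Sigma) (auto intro: finite_mset_splittings)
    also have "\<dots> = (\<Sum>(p, q)\<in>(SIGMA p:{(A, Q). A + Q = M}. {(B, C). B + C = snd p}).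
             f (fst p) * (g (fst q) * k (snd q)))"
      by (rule sum.reindex_bij_witness[
            where i = "\<lambda>((A, Q), (B, C)). ((A + B, C), (A, B))"
              and j = "\<lambda>((P, C), (A, B)). ((A, B + C), (B, C))"])
        (auto simp: mult.assoc add.assoc)
    also have "\<dots> = (\<Sum>p\<in>{(A, Q). A + Q = M}. \<Sum>q\<in>{(B, C). B + C = snd p}.
             f (fst p) * (g (fst q) * k (snd q)))"
      by (rule sum.Sigma[symmetric]) (auto intro: finite_mset_splittings)
    also have "\<dots> = (\<Sum>(A, Q) | A + Q = M. f A * (\<Sum>(B, C) | B + C = Q. g B * k C))"
      by (simp add: sum_distrib_left case_prod_unfold)
    finally show "(\<Sum>(P, C) | P + C = M. (\<Sum>(A, B) | A + B = P. f A * g B) * k C)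
        = (\<Sum>(A, Q) | A + Q = M. f A * (\<Sum>(B, C) | B + C = Q. g B * k C))" .
  qed
  show "F * G = G * F"
  proof (transfer, rule ext)
    fix f g :: "'a multiset \<Rightarrow> 'b" and M :: "'a multiset"
    show "(\<Sum>(A, B) | A + B = M. f A * g B) = (\<Sum>(A, B) | A + B = M. g A * f B)"
      by (rule sum.reindex_bij_witness[where i = prod.swap and j = prod.swap])
        (auto simp: mult.commute add.commute)
  qed
  show "1 * F = F"
  proof (transfer, rule ext)
    fix f :: "'a multiset \<Rightarrow> 'b" and M :: "'a multiset"
    have "(\<Sum>(A, B) | A + B = M. (if A = {#} then 1 else 0) * f B)
        = (\<Sum>(A, B)\<in>{({#} :: 'a multiset, M)}. (if A = {#} then 1 else 0) * f B)"
      by (rule sum.mono_neutral_right) (auto intro: finite_mset_splittings split: if_splits)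
    then show "(\<Sum>(A, B) | A + B = M. (if A = {#} then 1 else 0) * f B) = f M"
      by simp
  qed
  show "(F + G) * K = F * K + G * K"
    by transfer (simp add: fun_eq_iff case_prod_unfold distrib_right sum.distrib)
  show "F + G + K = F + (G + K)" by transfer (simp add: add.assoc)
  show "F + G = G + F" by transfer (simp add: add.commute)
  show "0 + F = F" by transfer simp
  show "- F + F = 0" by transfer simp
  show "F - G = F + - G" by transfer simp
  show "(0 :: ('a, 'b) mfps) \<noteq> 1" by transfer (metis zero_neq_one)
qed

end

lift_definition mfps_var :: "'v \<Rightarrow> ('v, 'c::comm_ring_1) mfps" is
  "\<lambda>v M. if M = {#v#} then 1 else 0" .

definition mfps_inverse :: "('v, 'c::comm_ring_1) mfps \<Rightarrow> ('v, 'c) mfps" where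
  "mfps_inverse F = (THE G. F * G = 1)"

text \<open>The limit of the partial products, taken coefficientwise.\<close>

definition mfps_prodinf ::
  "(nat \<Rightarrow> ('v, 'c::{comm_ring_1, t2_space}) mfps) \<Rightarrow> ('v, 'c) mfps" where
  "mfps_prodinf f = Abs_mfps (\<lambda>M. lim (\<lambda>N. mfps_coeff (\<Prod>i<N. f i) M))"


section \<open>Eigenvalues and multiplicities\<close>

definition eigenspace :: "'a::real_vector set \<Rightarrow> ('a \<Rightarrow> 'a) \<Rightarrow> real \<Rightarrow> 'a set" where
  "eigenspace V f c = {v \<in> V. f v = c *\<^sub>R v}"

definition eigenvalues :: "'a::real_vector set \<Rightarrow> ('a \<Rightarrow> 'a) \<Rightarrow> real set" where
  "eigenvalues V f = {c. \<exists>v\<in>eigenspace V f c. v \<noteq> 0}"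

definition ordered_basis :: "'a::real_vector set \<Rightarrow> 'a list \<Rightarrow> bool" where
  "ordered_basis V bs \<longleftrightarrow> distinct bs \<and> independent (set bs) \<and> span (set bs) = V"

definition matrix_wrt :: "'a::real_vector list \<Rightarrow> ('a \<Rightarrow> 'a) \<Rightarrow> real mat" where
  "matrix_wrt bs f =
     Matrix.mat (length bs) (length bs)
       (\<lambda>(i, j). representation (set bs) (f (bs ! j)) (bs ! i))"

text \<open>\<open>p\<close> is the characteristic polynomial of the endomorphism \<open>f\<close> of the finite-dimensional
  space \<open>V\<close>, computed in any ordered basis.\<close>

definition has_char_poly :: "'a::real_vector set \<Rightarrow> ('a \<Rightarrow> 'a) \<Rightarrow> real poly \<Rightarrow> bool" where
  "has_char_poly V f p \<longleftrightarrow> (\<forall>bs. ordered_basis V bs \<longrightarrow> char_poly (matrix_wrt bs f) = p)"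

text \<open>The infinite products over \<open>i \<ge> 1\<close> run over \<open>Suc i\<close>; the values \<open>b 0\<close>, \<open>b' 0\<close> play no role.\<close>

definition dimension_data ::
  "(nat \<Rightarrow> 'a::real_vector set) \<Rightarrow> ('a \<Rightarrow> 'a) \<Rightarrow> (nat \<Rightarrow> nat) \<Rightarrow> (nat \<Rightarrow> nat) \<Rightarrow> bool" where
  "dimension_data H \<tau> b b' \<longleftrightarrow>
     Abs_fps (\<lambda>n. real (dim (H n))) =
       prodinf (\<lambda>i. inverse ((1 - fps_X ^ Suc i) ^ (b (Suc i) + b' (Suc i)))) \<and>
     Abs_fps (\<lambda>n. real (dim (eigenspace (H n) \<tau> 1)) - real (dim (eigenspace (H n) \<tau> (- 1)))) =
       prodinf (\<lambda>i. inverse ((1 - fps_X ^ Suc i) ^ b (Suc i))) *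
       prodinf (\<lambda>i. inverse ((1 + fps_X ^ Suc i) ^ b' (Suc i)))"

text \<open>\<open>Inl i\<close> is the variable \<open>x\<^sub>i\<close> and \<open>Inr i\<close> the variable with a bar.\<close>

definition multiplicity_series :: "(nat \<Rightarrow> nat) \<Rightarrow> (nat \<Rightarrow> nat) \<Rightarrow> (nat + nat, int) mfps" where
  "multiplicity_series b b' =
     mfps_prodinf (\<lambda>i. mfps_inverse (1 - mfps_var (Inl (Suc i))) ^ b (Suc i)) *
     mfps_prodinf (\<lambda>i. mfps_inverse (1 - mfps_var (Inr (Suc i))) ^ b' (Suc i))"

text \<open>The coefficients of \<open>multiplicity_series\<close> are nonnegative, so \<open>nat\<close> does not truncate.\<close>

definition mult_coeff ::
  "(nat \<Rightarrow> nat) \<Rightarrow> (nat \<Rightarrow> nat) \<Rightarrow> nat multiset \<times> nat multiset \<Rightarrow> nat" where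
  "mult_coeff b b' = (\<lambda>(l, l').
     nat (mfps_coeff (multiplicity_series b b') (image_mset Inl l + image_mset Inr l')))"

end

theory Submission
  imports Defs
begin

text \<open>
  Let \<open>I\<close> be the augmentation ideal of \<open>\<H>\<close>.  Elements of \<open>I\<^sup>k\<close> that are primitive modulo higher powers
  of \<open>I\<close> (in the tensor square) span the primitive part of the associated graded Hopf algebra of the
  \<open>I\<close>-adic filtration, which is generated in degree one, hence by primitive elements.  Choose
  homogeneous \<open>\<tau>\<close>-eigenvectors lifting a basis of this primitive part.  A commutator of two primitive
  elements is again primitive, so, ordering monomials in the chosen generators by the power of \<open>I\<close>
  they lie in and then by their length, every rearrangement of a monomial agrees with it up to lower
  terms, and one monomial for each multiset of generators gives a basis of \<open>\<H>\<^sub>n\<close>: independence is seen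
  by applying \<open>\<xi>\<^sub>1 \<otimes> \<dots> \<otimes> \<xi>\<^sub>m\<close> to \<open>\<Delta>\<^sup>[\<^sup>m\<^sup>]\<close>, for functionals \<open>\<xi>\<^sub>i\<close> dual to the generators.

  Up to lower terms, \<open>\<Delta>\<^sup>[\<^sup>l\<^sup>]\<close> distributes the factors of a monomial over the \<open>l\<close> tensor slots, and applying
  \<open>\<tau>\<close> and multiplying only permutes the factors and introduces signs.  So all the descent operators are
  triangular in the monomial basis, simultaneously, and the diagonal entry counts, with signs, the
  ways of distributing the factors over the parts of \<open>D\<close>, which is \<open>\<beta>\<close> for the degrees of the factors
  of sign \<open>1\<close> and of sign \<open>-1\<close>.  With \<open>b\<^sub>i\<close> and \<open>b'\<^sub>i\<close> the numbers of generators of degree \<open>i\<close> with sign \<open>1\<close>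
  and \<open>-1\<close>, counting monomials yields the multiplicities; the first dimension series counts monomials, and
  the second is the trace of \<open>\<tau>\<close>, also triangular in this basis.  The two series determine \<open>b\<close> and \<open>b'\<close>.
\<close>

section \<open>Triangular endomorphisms\<close>

text \<open>The algebra may be neither commutative nor cocommutative, so no Poincare-Birkhoff-Witt
  basis is at hand. Passing to the I-adic graded object restores cocommutativity, because the
  coproduct of an element of positive degree is symmetric modulo deeper terms. The graded object
  itself is never built: an identity in it is expressed as a difference lying in the next power
  \<open>aug (Suc k)\<close>, or \<open>taug l (Suc k)\<close> in tensor powers, so that all
  operators stay on \<open>H n\<close>. The grading makes the filtration finite in each degree,
  which is why the rewriting of words stops. Characteristic zero enters twice: the eigenvectors of
  \<open>\<tau>\<close> are split off by halving, and the pairing that proves independence is a sum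
  of terms 0 and 1, hence positive as soon as one term is 1. That \<open>\<tau>\<close> may reverse
  products or coproducts is absorbed by the set-up: reversing a word changes it by lower terms only,
  and primitivity is symmetric under swapping the two tensor factors.\<close>

definition matrix_between ::
  "'a::real_vector list \<Rightarrow> 'a list \<Rightarrow> ('a \<Rightarrow> 'a) \<Rightarrow> real mat" where
  "matrix_between bs cs f = Matrix.mat (length bs) (length cs)
     (\<lambda>(i, j). representation (set bs) (f (cs ! j)) (bs ! i))"

lemma matrix_between_carrier [simp]:
  "matrix_between bs cs f \<in> carrier_mat (length bs) (length cs)"
  by (simp add: matrix_between_def)

lemma ordered_basis_expand:
  assumes "ordered_basis V bs" "x \<in> V"
  shows "x = (\<Sum>i<length bs. representation (set bs) x (bs ! i) *\<^sub>R bs ! i)"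
proof -
  have d: "distinct bs" "independent (set bs)" "span (set bs) = V"
    using assms(1) by (auto simp: ordered_basis_def)
  have "x = (\<Sum>b\<in>set bs. representation (set bs) x b *\<^sub>R b)"
    using sum_representation_eq[OF d(2), of x "set bs"] assms(2) d(3) by auto
  also have "\<dots> = (\<Sum>i<length bs. representation (set bs) x (bs ! i) *\<^sub>R bs ! i)"
    using sum.reindex_bij_betw[OF bij_betw_nth[OF d(1) refl refl],
        of "\<lambda>b. representation (set bs) x b *\<^sub>R b"] by simp
  finally show ?thesis .
qed

lemma representation_linear_image:
  assumes b: "ordered_basis V bs" and c: "ordered_basis V cs"
    and f: "linear f" "f ` V \<subseteq> V" and x: "x \<in> V"
  shows "representation (set bs) (f x) b
    = (\<Sum>i<length cs. representation (set cs) x (cs ! i) * representation (set bs) (f (cs ! i)) b)"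
proof -
  interpret linear f by fact
  have ib: "independent (set bs)" "span (set bs) = V" using b by (auto simp: ordered_basis_def)
  have cV: "cs ! i \<in> V" if "i < length cs" for i
    using c that by (auto simp: ordered_basis_def intro: span_base)
  have inV: "f (cs ! i) \<in> span (set bs)" if "i < length cs" for i
    using cV[OF that] f(2) ib(2) by auto
  have "f x = (\<Sum>i<length cs. representation (set cs) x (cs ! i) *\<^sub>R f (cs ! i))"
    by (subst ordered_basis_expand[OF c x]) (simp add: sum scale)
  also have "representation (set bs) \<dots> b
    = (\<Sum>i<length cs. representation (set bs) (representation (set cs) x (cs ! i) *\<^sub>R f (cs ! i)) b)"
    by (subst representation_sum[OF ib(1)]) (auto intro: span_scale inV)
  also have "\<dots> = (\<Sum>i<length cs. representation (set cs) x (cs ! i) * representation (set bs) (f (cs ! i)) b)"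
    by (rule sum.cong) (auto simp: representation_scale[OF ib(1) inV])
  finally show ?thesis .
qed

lemma matrix_between_comp:
  assumes b: "ordered_basis V bs" and c: "ordered_basis V cs" and d: "ordered_basis V ds"
    and f: "linear f" "f ` V \<subseteq> V" and g: "g ` V \<subseteq> V"
  shows "matrix_between bs cs f * matrix_between cs ds g = matrix_between bs ds (f \<circ> g)"
proof (rule eq_matI, goal_cases)
  case (1 i j)
  then have ij: "i < length bs" "j < length ds" by (auto simp: matrix_between_def)
  have "g (ds ! j) \<in> V"
    using d g ij span_base[of "ds ! j" "set ds"] by (auto simp: ordered_basis_def)
  from representation_linear_image[OF b c f this, of "bs ! i"] ij
  show ?case
    by (simp add: matrix_between_def scalar_prod_def atLeast0LessThan mult.commute)
qed (simp_all add: matrix_between_def)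

lemma matrix_between_id:
  assumes "ordered_basis V bs"
  shows "matrix_between bs bs id = 1\<^sub>m (length bs)"
  using assms
  by (intro eq_matI)
    (auto simp: matrix_between_def ordered_basis_def representation_basis nth_eq_iff_index_eq)

lemma ordered_basis_length:
  assumes "ordered_basis V bs" "ordered_basis V cs"
  shows "length bs = length cs"
  using assms dim_span_eq_card_independent[of "set bs"] dim_span_eq_card_independent[of "set cs"]
  by (simp add: ordered_basis_def distinct_card)

text \<open>\<open>has_char_poly\<close> quantifies over all ordered bases. The matrices of the
  identity between two bases are mutually inverse and conjugate one matrix of \<open>f\<close> into
  the other.\<close>

lemma char_poly_basis_change:
  assumes b: "ordered_basis V bs" and c: "ordered_basis V cs"
    and f: "linear f" "f ` V \<subseteq> V"
  shows "char_poly (matrix_wrt bs f) = char_poly (matrix_wrt cs f)"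
proof (rule char_poly_similar)
  have id: "linear (id :: 'a \<Rightarrow> 'a)" by (simp add: linear_id)
  have l: "length cs = length bs" using ordered_basis_length[OF c b] .
  have w: "matrix_wrt as f = matrix_between as as f" for as
    by (simp add: matrix_wrt_def matrix_between_def)
  let ?P = "matrix_between bs cs id" and ?Q = "matrix_between cs bs id"
  have "?P * ?Q = 1\<^sub>m (length bs)"
    using matrix_between_comp[OF b c b id] matrix_between_id[OF b] by simp
  moreover have "?Q * ?P = 1\<^sub>m (length bs)"
    using matrix_between_comp[OF c b c id] matrix_between_id[OF c] l by simp
  moreover have "matrix_wrt bs f = ?P * matrix_wrt cs f * ?Q"
    using matrix_between_comp[OF b c c id, of f] matrix_between_comp[OF b c b f, of id] f(2)
    by (simp add: w)
  ultimately have "similar_mat_wit (matrix_wrt bs f) (matrix_wrt cs f) ?P ?Q"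
    using l matrix_between_carrier[of bs cs id] matrix_between_carrier[of cs bs id]
      matrix_between_carrier[of bs bs f] matrix_between_carrier[of cs cs f]
    by (intro similar_mat_witI[of _ _ "length bs"]) (simp_all add: w)
  then show "similar_mat (matrix_wrt bs f) (matrix_wrt cs f)"
    unfolding similar_mat_def by blast
qed

text \<open>The coordinate map \<open>crd\<close> is a linear bijection of \<open>V\<close> onto the
  column vectors that turns \<open>f\<close> into its matrix, so it carries eigenvectors to
  eigenvectors in both directions.\<close>

lemma eigenvalue_matrix_wrt:
  assumes b: "ordered_basis V bs" and f: "linear f" "f ` V \<subseteq> V"
  shows "eigenvalue (matrix_wrt bs f) k \<longleftrightarrow> k \<in> eigenvalues V f"
proof -
  let ?n = "length bs" and ?A = "matrix_wrt bs f"
  interpret linear f by fact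
  have db: "distinct bs" "independent (set bs)" "span (set bs) = V"
    using b by (auto simp: ordered_basis_def)
  define crd where "crd x = Matrix.vec ?n (\<lambda>i. representation (set bs) x (bs ! i))" for x
  have A: "?A *\<^sub>v crd x = crd (f x)" if "x \<in> V" for x
    using that by (intro eq_vecI)
      (auto simp: matrix_wrt_def crd_def scalar_prod_def atLeast0LessThan
        representation_linear_image[OF b b f] mult.commute)
  have scl: "crd (c *\<^sub>R x) = c \<cdot>\<^sub>v crd x" if "x \<in> V" for c x
    using that db by (intro eq_vecI) (auto simp: crd_def representation_scale)
  have inj: "x = y" if "x \<in> V" "y \<in> V" "crd x = crd y" for x y
  proof -
    have "representation (set bs) x (bs ! i) = representation (set bs) y (bs ! i)" if "i < ?n" for i
      using arg_cong[OF \<open>crd x = crd y\<close>, of "\<lambda>v. vec_index v i"] that by (simp add: crd_def)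
    then show ?thesis
      by (subst ordered_basis_expand[OF b \<open>x \<in> V\<close>], subst ordered_basis_expand[OF b \<open>y \<in> V\<close>]) simp
  qed
  have fV: "f x \<in> V" if "x \<in> V" for x using that f(2) by auto
  have V0: "0 \<in> V" and Vs: "c *\<^sub>R x \<in> V" if "x \<in> V" for c x
    using that db(3) span_zero span_scale by auto
  have surj: "\<exists>x\<in>V. crd x = v" if v: "v \<in> carrier_vec ?n" for v
  proof -
    let ?x = "\<Sum>i<?n. vec_index v i *\<^sub>R bs ! i"
    have bsV: "bs ! i \<in> span (set bs)" if "i < ?n" for i using that by (simp add: span_base)
    have "?x \<in> V" using bsV db(3) by (auto intro: span_sum span_scale)
    moreover have "crd ?x = v"
    proof (rule eq_vecI)
      fix i assume "i < dim_vec v"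
      then have i: "i < ?n" using v by simp
      have "representation (set bs) ?x (bs ! i)
        = (\<Sum>k<?n. vec_index v k * representation (set bs) (bs ! k) (bs ! i))"
        using db bsV by (subst representation_sum)
          (auto simp: representation_scale intro!: span_scale sum.cong)
      also have "\<dots> = (\<Sum>k<?n. if k = i then vec_index v i else 0)"
        using db i by (intro sum.cong) (auto simp: representation_basis nth_eq_iff_index_eq)
      also have "\<dots> = vec_index v i" using i by simp
      finally show "vec_index (crd ?x) i = vec_index v i" using i by (simp add: crd_def)
    qed (use v in \<open>simp add: crd_def\<close>)
    ultimately show ?thesis by blast
  qed
  have c0: "crd 0 = 0\<^sub>v ?n" by (intro eq_vecI) (auto simp: crd_def representation_zero)
  have dr: "dim_row ?A = ?n" by (simp add: matrix_wrt_def)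
  have cr: "crd x \<in> carrier_vec ?n" for x by (simp add: crd_def)
  show ?thesis
  proof
    assume "eigenvalue ?A k"
    then obtain v where v: "v \<in> carrier_vec ?n" "v \<noteq> 0\<^sub>v ?n" "?A *\<^sub>v v = k \<cdot>\<^sub>v v"
      by (auto simp: eigenvalue_def eigenvector_def dr)
    then obtain x where x: "x \<in> V" "crd x = v" using surj by blast
    then have "f x = k *\<^sub>R x"
      using v A[OF x(1)] scl[OF x(1)] by (intro inj fV Vs) auto
    moreover have "x \<noteq> 0" using x v c0 by auto
    ultimately show "k \<in> eigenvalues V f"
      using x by (auto simp: eigenvalues_def eigenspace_def)
  next
    assume "k \<in> eigenvalues V f"
    then obtain x where x: "x \<in> V" "f x = k *\<^sub>R x" "x \<noteq> 0"
      by (auto simp: eigenvalues_def eigenspace_def)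
    then have "crd x \<noteq> 0\<^sub>v ?n" using inj[OF x(1) V0] c0 by auto
    then show "eigenvalue ?A k"
      using A[OF x(1)] scl[OF x(1)] x(2) cr
      by (auto simp: eigenvalue_def eigenvector_def dr intro!: exI[of _ "crd x"])
  qed
qed

text \<open>The coefficients are indexed by \<open>S\<close> rather than by vectors, so the
  hypothesis also rules out repetitions: two equal values would satisfy the relation with
  coefficients 1 and -1.\<close>

lemma independent_family:
  fixes val :: "'i \<Rightarrow> 'a::real_vector"
  assumes fin: "finite S"
    and indep: "\<And>c. (\<Sum>i\<in>S. c i *\<^sub>R val i) = 0 \<Longrightarrow> \<forall>i\<in>S. c i = 0"
  shows "inj_on val S" "independent (val ` S)"
proof -
  show inj: "inj_on val S"
  proof (rule inj_onI, rule ccontr)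
    fix i j assume ij: "i \<in> S" "j \<in> S" "val i = val j" "i \<noteq> j"
    let ?c = "\<lambda>k. if k = i then 1 else if k = j then -1 else (0::real)"
    have "(\<Sum>k\<in>S. ?c k *\<^sub>R val k) = (\<Sum>k\<in>{i,j}. ?c k *\<^sub>R val k)"
      using ij fin by (intro sum.mono_neutral_right) auto
    also have "\<dots> = 0" using ij by simp
    finally have "\<forall>k\<in>S. ?c k = 0" by (rule indep)
    then show False using ij by auto
  qed
  show "independent (val ` S)"
  proof (rule independent_if_scalars_zero)
    fix g x assume g: "(\<Sum>x\<in>val ` S. g x *\<^sub>R x) = 0" and x: "x \<in> val ` S"
    have "(\<Sum>i\<in>S. g (val i) *\<^sub>R val i) = 0" using g inj by (simp add: sum.reindex)
    from indep[OF this] x show "g x = 0" by auto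
  qed (use fin in simp)
qed

text \<open>Listing the basis by increasing key makes the matrix upper triangular with diagonal
  \<open>d\<close>. Indices of equal key may come in any order, since the remainder involves
  strictly smaller keys only.\<close>

lemma eigenvalues_triangular:
  fixes val :: "'i \<Rightarrow> 'a::real_vector" and key :: "'i \<Rightarrow> nat"
  assumes fin: "finite S"
    and indep: "\<And>c. (\<Sum>i\<in>S. c i *\<^sub>R val i) = 0 \<Longrightarrow> \<forall>i\<in>S. c i = 0"
    and span: "span (val ` S) = V"
    and lin: "linear f"
    and tri: "\<And>i. i \<in> S \<Longrightarrow> f (val i) - d i *\<^sub>R val i \<in> span (val ` {j\<in>S. key j < key i})"
  shows "has_char_poly V f (\<Prod>i\<in>S. [:- d i, 1:])" "eigenvalues V f = d ` S"
proof -
  interpret linear f by fact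
  have inj: "inj_on val S" and ind: "independent (val ` S)"
    by (rule independent_family; fact fin indep)+
  define js where "js = sort_key key (SOME xs. set xs = S \<and> distinct xs)"
  have "\<exists>xs. set xs = S \<and> distinct xs" using finite_distinct_list[OF fin] .
  then have js0: "set (SOME xs. set xs = S \<and> distinct xs) = S \<and> distinct (SOME xs. set xs = S \<and> distinct xs)"
    by (rule someI_ex)
  have js: "set js = S" "distinct js" "sorted (map key js)"
    using js0 by (auto simp: js_def)
  define bs where "bs = map val js"
  have ob: "ordered_basis V bs"
    using inj ind span js by (simp add: ordered_basis_def bs_def distinct_map)
  have sb: "set bs = val ` S" using js by (simp add: bs_def)
  have fV: "f ` V \<subseteq> V"
  proof -
    have "f (val i) \<in> V" if i: "i \<in> S" for i
    proof -
      have "f (val i) - d i *\<^sub>R val i \<in> span (val ` S)"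
        using tri[OF i] span_mono[of "val ` {j\<in>S. key j < key i}" "val ` S"] by auto
      then have "f (val i) - d i *\<^sub>R val i + d i *\<^sub>R val i \<in> span (val ` S)"
        using i by (intro span_add span_scale) (auto intro: span_base)
      then show ?thesis using span by simp
    qed
    then have "f ` val ` S \<subseteq> span (val ` S)" using span by auto
    then show ?thesis using span span_minimal[of "f ` val ` S" "span (val ` S)"]
      by (metis linear_axioms linear_span_image subspace_span)
  qed
  \<comment> \<open>On and below the diagonal the row index has at least the key of the column
    index, so its vector is not among those that span the remainder.\<close>
  have nth: "matrix_wrt bs f $$ (i, j) = (if i = j then d (js ! j) else 0)"
    if ij: "j \<le> i" "i < length bs" for i j
  proof -
    let ?L = "{k\<in>S. key k < key (js ! j)}"
    have lt: "i < length js" "j < length js" using ij by (auto simp: bs_def)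
    then have inS: "js ! j \<in> S" "js ! i \<in> S" using js by auto
    let ?r = "f (val (js ! j)) - d (js ! j) *\<^sub>R val (js ! j)"
    have r: "?r \<in> span (val ` ?L)" using tri[OF inS(1)] .
    have kk: "key (js ! j) \<le> key (js ! i)"
      using js(3) ij lt by (auto simp: sorted_iff_nth_mono)
    have notin: "val (js ! i) \<notin> val ` ?L"
    proof
      assume "val (js ! i) \<in> val ` ?L"
      then obtain k where "k \<in> ?L" "val (js ! i) = val k" by blast
      then show False using kk inj_onD[OF inj, of "js ! i" k] inS by auto
    qed
    have "representation (val ` S) ?r (val (js ! i)) = representation (val ` ?L) ?r (val (js ! i))"
      by (rule fun_cong[OF representation_extend[OF ind r]]) auto
    also have "\<dots> = 0" using notin representation_ne_zero by blast
    finally have r0: "representation (val ` S) ?r (val (js ! i)) = 0" .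
    have rS: "?r \<in> span (val ` S)" using r span_mono[of "val ` ?L" "val ` S"] by auto
    have sp: "val (js ! j) \<in> span (val ` S)" using inS by (simp add: span_base)
    have "representation (val ` S) (f (val (js ! j))) (val (js ! i))
      = representation (val ` S) (?r + d (js ! j) *\<^sub>R val (js ! j)) (val (js ! i))" by simp
    also have "\<dots> = d (js ! j) * representation (val ` S) (val (js ! j)) (val (js ! i))"
      unfolding representation_add[OF ind span_scale[OF sp] rS] representation_scale[OF ind sp] r0
      by simp
    also have "\<dots> = (if i = j then d (js ! j) else 0)"
      using inS inj js(2) lt by (auto simp: representation_basis[OF ind] inj_on_eq_iff nth_eq_iff_index_eq)
    finally show ?thesis
      using ij lt by (auto simp: matrix_wrt_def sb) (auto simp: bs_def split: if_splits)
  qed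
  have car: "matrix_wrt bs f \<in> carrier_mat (length bs) (length bs)" by (simp add: matrix_wrt_def)
  have "upper_triangular (matrix_wrt bs f)"
    using nth car by (intro upper_triangularI) auto
  then have "char_poly (matrix_wrt bs f) = (\<Prod>a\<leftarrow>diag_mat (matrix_wrt bs f). [:- a, 1:])"
    by (rule char_poly_upper_triangular[OF car])
  also have "diag_mat (matrix_wrt bs f) = map d js"
    using car nth by (intro nth_equalityI) (auto simp: diag_mat_def bs_def)
  also have "(\<Prod>a\<leftarrow>map d js. [:- a, 1:]) = (\<Prod>i\<in>S. [:- d i, 1:])"
    using prod.distinct_set_conv_list[OF js(2), of "\<lambda>i. [:- d i, 1:]"] js(1) by (simp add: o_def)
  finally have cp: "char_poly (matrix_wrt bs f) = (\<Prod>i\<in>S. [:- d i, 1:])" .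
  then show "has_char_poly V f (\<Prod>i\<in>S. [:- d i, 1:])"
    using char_poly_basis_change[OF _ ob lin fV] by (auto simp: has_char_poly_def)
  show "eigenvalues V f = d ` S"
  proof (rule Set.set_eqI)
    fix k
    have "k \<in> eigenvalues V f \<longleftrightarrow> poly (\<Prod>i\<in>S. [:- d i, 1:]) k = 0"
      using eigenvalue_matrix_wrt[OF ob lin fV] eigenvalue_root_char_poly[OF car] cp by metis
    also have "\<dots> \<longleftrightarrow> k \<in> d ` S" using fin by (auto simp: poly_prod image_iff)
    finally show "k \<in> eigenvalues V f \<longleftrightarrow> k \<in> d ` S" .
  qed
qed

section \<open>Generating functions of multisets\<close>

lemma finite_bounded_multisets:
  assumes "finite S"
  shows "finite {A. set_mset A \<subseteq> S \<and> size A \<le> n}"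
proof -
  have "{A. set_mset A \<subseteq> S \<and> size A \<le> n} \<subseteq> mset ` {xs. set xs \<subseteq> S \<and> length xs \<le> n}"
  proof
    fix A assume "A \<in> {A. set_mset A \<subseteq> S \<and> size A \<le> n}"
    moreover obtain xs where "mset xs = A" using ex_mset by blast
    ultimately show "A \<in> mset ` {xs. set xs \<subseteq> S \<and> length xs \<le> n}" by auto
  qed
  then show ?thesis by (rule finite_subset) (intro finite_imageI finite_lists_length_le assms)
qed

definition weighted_msets :: "'s set \<Rightarrow> ('s \<Rightarrow> nat) \<Rightarrow> nat \<Rightarrow> 's multiset set" where
  "weighted_msets S v n = {A. set_mset A \<subseteq> S \<and> sum_mset (image_mset v A) = n}"

definition coloured_msets :: "'s set \<Rightarrow> ('s \<Rightarrow> 'v) \<Rightarrow> 'v multiset \<Rightarrow> 's multiset set" where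
  "coloured_msets S v M = {A. set_mset A \<subseteq> S \<and> image_mset v A = M}"

lemma finite_weighted_msets:
  assumes "finite S" "\<And>s. s \<in> S \<Longrightarrow> 0 < v s"
  shows "finite (weighted_msets S v n)"
proof -
  have "size A \<le> sum_mset (image_mset v A)" if "set_mset A \<subseteq> S" for A
    using that
  proof (induction A)
    case (add x A)
    then show ?case using assms(2)[of x] by auto
  qed simp
  then have "weighted_msets S v n \<subseteq> {A. set_mset A \<subseteq> S \<and> size A \<le> n}"
    by (auto simp: weighted_msets_def)
  then show ?thesis using finite_bounded_multisets[OF assms(1)] by (rule finite_subset)
qed

lemma finite_coloured_msets: "finite S \<Longrightarrow> finite (coloured_msets S v M)"
  by (rule finite_subset[OF _ finite_bounded_multisets[of S "size M"]]) (auto simp: coloured_msets_def)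

text \<open>Both generating functions below rest on this recursion: either \<open>s\<close> is
  absent, or one copy of it can be removed.\<close>

lemma insert_msets_split:
  "{A. set_mset A \<subseteq> insert s S \<and> P A}
    = {A. set_mset A \<subseteq> S - {s} \<and> P A} \<union> add_mset s ` {A. set_mset A \<subseteq> insert s S \<and> P (add_mset s A)}"
proof (intro equalityI subsetI)
  fix A assume A: "A \<in> {A. set_mset A \<subseteq> insert s S \<and> P A}"
  show "A \<in> {A. set_mset A \<subseteq> S - {s} \<and> P A} \<union> add_mset s ` {A. set_mset A \<subseteq> insert s S \<and> P (add_mset s A)}"
  proof (cases "s \<in># A")
    case True
    then obtain B where "A = add_mset s B" by (metis mset_add)
    then show ?thesis using A by auto
  qed (use A in auto)
qed auto

text \<open>Expanding every factor as a geometric series chooses a multiplicity for each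
  \<open>s\<close>. The induction avoids the expansion: removing one copy of \<open>s\<close> shows
  that the counting series times the new denominator is the previous counting series. The weights
  \<open>\<sigma>\<close> will be constantly 1 for the dimensions and the signs of the generators
  for the trace of the involution.\<close>

lemma fps_nth_prod_weighted_msets:
  fixes \<sigma> :: "'s \<Rightarrow> real"
  assumes "finite S" "\<And>s. s \<in> S \<Longrightarrow> 0 < v s"
  shows "fps_nth (\<Prod>s\<in>S. inverse (1 - fps_const (\<sigma> s) * fps_X ^ v s)) n
    = (\<Sum>A\<in>weighted_msets S v n. prod_mset (image_mset \<sigma> A))"
proof -
  define P where "P S = Abs_fps (\<lambda>n. \<Sum>A\<in>weighted_msets S v n. prod_mset (image_mset \<sigma> A))" for S
  have "(\<Prod>s\<in>S. inverse (1 - fps_const (\<sigma> s) * fps_X ^ v s)) = P S"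
    using assms
  proof (induction S rule: finite_induct)
    case empty
    show ?case
    proof (rule fps_ext)
      fix n
      have "weighted_msets ({} :: 's set) v n = (if n = 0 then {{#}} else {})" by (auto simp: weighted_msets_def)
      then show "fps_nth (\<Prod>s\<in>{}. inverse (1 - fps_const (\<sigma> s) * fps_X ^ v s)) n = fps_nth (P {}) n"
        by (simp add: P_def)
    qed
  next
    case (insert s S)
    let ?f = "1 - fps_const (\<sigma> s) * fps_X ^ v s"
    have vs: "0 < v s" using insert by simp
    have f0: "fps_nth ?f 0 = 1" using vs by simp
    have "P (insert s S) * ?f = P S"
    proof (rule fps_ext)
      fix n
      let ?W = "weighted_msets (insert s S) v"
      have fin: "finite (weighted_msets (insert s S) v m)" for m
        using insert by (intro finite_weighted_msets) auto
      have split: "?W n = weighted_msets S v n \<union> (if v s \<le> n then add_mset s ` ?W (n - v s) else {})"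
      proof -
        have "?W n = weighted_msets S v n \<union> add_mset s ` {A. set_mset A \<subseteq> insert s S \<and> v s + sum_mset (image_mset v A) = n}"
          unfolding weighted_msets_def
          using insert_msets_split[of s S "\<lambda>A. sum_mset (image_mset v A) = n"] insert.hyps(2) by simp
        moreover have "{A. set_mset A \<subseteq> insert s S \<and> v s + sum_mset (image_mset v A) = n}
          = (if v s \<le> n then ?W (n - v s) else {})"
          by (auto simp: weighted_msets_def)
        ultimately show ?thesis by simp
      qed
      have disj: "weighted_msets S v n \<inter> add_mset s ` X = {}" for X
        using insert.hyps(2) by (auto simp: weighted_msets_def)
      have fS: "finite (weighted_msets S v n)" using insert by (intro finite_weighted_msets) auto
      have rec: "(\<Sum>A\<in>?W n. prod_mset (image_mset \<sigma> A)) = (\<Sum>A\<in>weighted_msets S v n. prod_mset (image_mset \<sigma> A))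
        + (if v s \<le> n then \<sigma> s * (\<Sum>A\<in>?W (n - v s). prod_mset (image_mset \<sigma> A)) else 0)"
      proof (cases "v s \<le> n")
        case True
        have "(\<Sum>A\<in>?W n. prod_mset (image_mset \<sigma> A)) = (\<Sum>A\<in>weighted_msets S v n. prod_mset (image_mset \<sigma> A))
          + (\<Sum>A\<in>add_mset s ` ?W (n - v s). prod_mset (image_mset \<sigma> A))"
          unfolding split if_P[OF True] by (rule sum.union_disjoint[OF fS _ disj]) (use fin in auto)
        also have "(\<Sum>A\<in>add_mset s ` ?W (n - v s). prod_mset (image_mset \<sigma> A))
          = \<sigma> s * (\<Sum>A\<in>?W (n - v s). prod_mset (image_mset \<sigma> A))"
          by (subst sum.reindex) (auto simp: sum_distrib_left inj_on_def)
        finally show ?thesis using True by simp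
      next
        case False
        then show ?thesis unfolding split by simp
      qed
      have "P (insert s S) * ?f = P (insert s S) - fps_const (\<sigma> s) * (P (insert s S) * fps_X ^ v s)"
        by (simp add: algebra_simps)
      then have "fps_nth (P (insert s S) * ?f) n = fps_nth (P (insert s S)) n
        - \<sigma> s * (if n < v s then 0 else fps_nth (P (insert s S)) (n - v s))"
        by (simp add: fps_X_power_mult_right_nth)
      then show "fps_nth (P (insert s S) * ?f) n = fps_nth (P S) n"
        by (simp add: P_def rec not_less split: if_splits)
    qed
    then have "P S * inverse ?f = P (insert s S) * (?f * inverse ?f)" by (simp add: mult.assoc)
    also have "?f * inverse ?f = 1" by (rule inverse_mult_eq_1') (use f0 in \<open>metis zero_neq_one\<close>)
    finally show ?case using insert by (simp add: mult.commute)
  qed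
  then show ?thesis by (simp add: P_def)
qed

lemma mfps_coeff_var_mult:
  "mfps_coeff (F * mfps_var w) M = (if w \<in># M then mfps_coeff F (M - {#w#}) else 0)"
proof -
  have "mfps_coeff (F * mfps_var w) M = (\<Sum>(A, B) | A + B = M. mfps_coeff F A * (if B = {#w#} then 1 else 0))"
    by transfer simp
  also have "\<dots> = (\<Sum>(A, B)\<in>(if w \<in># M then {(M - {#w#}, {#w#})} else {}). mfps_coeff F A * (if B = {#w#} then 1 else 0))"
    by (rule sum.mono_neutral_right) (auto intro: finite_mset_splittings split: if_splits)
  finally show ?thesis by simp
qed

lemma mfps_inverse_eq:
  assumes "F * G = 1"
  shows "mfps_inverse F = G"
  unfolding mfps_inverse_def
proof (rule the_equality)
  show "F * G = 1" by (rule assms)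
  fix G' assume "F * G' = 1"
  then have "G' = (F * G) * G'" using assms by simp
  also have "\<dots> = G * (F * G')" by (simp only: mult.assoc mult.left_commute)
  finally show "G' = G" using \<open>F * G' = 1\<close> by simp
qed

lemma mfps_prod_coloured_msets:
  fixes v :: "'s \<Rightarrow> 'v"
  assumes "finite S"
  shows "(\<Prod>s\<in>S. mfps_inverse (1 - mfps_var (v s)))
    = Abs_mfps (\<lambda>M. int (card (coloured_msets S v M)))"
proof -
  define P where "P S = Abs_mfps (\<lambda>M. int (card (coloured_msets S v M)))" for S
  have P: "mfps_coeff (P S) M = int (card (coloured_msets S v M))" for S M
    by (simp add: P_def Abs_mfps_inverse)
  have P_empty: "P {} = 1"
    by (rule mfps_eqI, unfold P) (auto simp: coloured_msets_def one_mfps.rep_eq)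
  have step: "P (insert s S) * (1 - mfps_var (v s)) = P S" if S: "finite S" "s \<notin> S" for s S
  proof (rule mfps_eqI)
    fix M
    let ?C = "coloured_msets (insert s S) v"
    have split: "?C M = coloured_msets S v M \<union> (if v s \<in># M then add_mset s ` ?C (M - {#v s#}) else {})"
    proof -
      have "?C M = coloured_msets S v M \<union> add_mset s ` {A. set_mset A \<subseteq> insert s S \<and> add_mset (v s) (image_mset v A) = M}"
        unfolding coloured_msets_def
        using insert_msets_split[of s S "\<lambda>A. image_mset v A = M"] S(2) by simp
      moreover have "{A. set_mset A \<subseteq> insert s S \<and> add_mset (v s) (image_mset v A) = M}
        = (if v s \<in># M then ?C (M - {#v s#}) else {})"
        by (auto simp: coloured_msets_def)
      ultimately show ?thesis by simp
    qed
    have disj: "coloured_msets S v M \<inter> add_mset s ` X = {}" for X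
      using S(2) by (auto simp: coloured_msets_def)
    have "card (?C M) = card (coloured_msets S v M) + (if v s \<in># M then card (?C (M - {#v s#})) else 0)"
    proof (cases "v s \<in># M")
      case True
      have "card (?C M) = card (coloured_msets S v M) + card (add_mset s ` ?C (M - {#v s#}))"
        unfolding split if_P[OF True]
        by (rule card_Un_disjoint[OF _ _ disj]) (use S(1) in \<open>auto intro: finite_coloured_msets\<close>)
      then show ?thesis using True by (simp add: card_image inj_on_def)
    next
      case False
      then show ?thesis unfolding split by simp
    qed
    then show "mfps_coeff (P (insert s S) * (1 - mfps_var (v s))) M = mfps_coeff (P S) M"
      by (simp add: right_diff_distrib minus_mfps.rep_eq mfps_coeff_var_mult P)
  qed
  \<comment> \<open>The one-element case of the recursion exhibits the inverse as a counting
    series.\<close>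
  have inv: "(1 - mfps_var (v s)) * P {s} = 1" for s
    using step[of "{}" s] by (simp add: P_empty mult.commute)
  show ?thesis
    unfolding P_def[symmetric] using assms
  proof (induction S rule: finite_induct)
    case empty
    show ?case by (simp add: P_empty)
  next
    case (insert s S)
    have "P S * P {s} = P (insert s S) * ((1 - mfps_var (v s)) * P {s})"
      unfolding step[OF insert.hyps, symmetric] by (simp only: mult.assoc)
    then have "P S * P {s} = P (insert s S)" by (simp only: inv mult_1_right)
    then have "P {s} * P S = P (insert s S)" by (simp only: mult.commute)
    then show ?case using insert by (simp add: mfps_inverse_eq[OF inv])
  qed
qed

text \<open>Replaces a factor per degree, raised to the number of elements of that degree, by a
  factor per element. Positivity of \<open>v\<close> matches the products, which start at degree
  \<open>Suc 0\<close>.\<close>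

lemma prod_group_power:
  fixes h :: "nat \<Rightarrow> 'b::comm_monoid_mult"
  assumes "finite {x\<in>X. v x \<le> N}" "\<And>x. x \<in> X \<Longrightarrow> 0 < v x"
  shows "(\<Prod>i<N. h (Suc i) ^ card {x\<in>X. v x = Suc i}) = (\<Prod>x | x \<in> X \<and> v x \<le> N. h (v x))"
proof -
  have "(\<Prod>x | x \<in> X \<and> v x \<le> N. h (v x))
    = (\<Prod>d\<in>Suc ` {..<N}. \<Prod>x | x \<in> {x\<in>X. v x \<le> N} \<and> v x = d. h (v x))"
  proof (rule prod.group[symmetric])
    show "v ` {x \<in> X. v x \<le> N} \<subseteq> Suc ` {..<N}"
    proof
      fix y assume "y \<in> v ` {x \<in> X. v x \<le> N}"
      then have "0 < y" "y \<le> N" using assms(2) by auto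
      then show "y \<in> Suc ` {..<N}" by (intro image_eqI[of _ _ "y - 1"]) auto
    qed
  qed (use assms in auto)
  also have "\<dots> = (\<Prod>i<N. \<Prod>x | x \<in> {x\<in>X. v x \<le> N} \<and> v x = Suc i. h (v x))"
    by (simp add: prod.reindex)
  also have "\<dots> = (\<Prod>i<N. h (Suc i) ^ card {x\<in>X. v x = Suc i})"
  proof (rule prod.cong[OF refl])
    fix i assume "i \<in> {..<N}"
    then have "{x. x \<in> {x\<in>X. v x \<le> N} \<and> v x = Suc i} = {x\<in>X. v x = Suc i}" by auto
    then show "(\<Prod>x | x \<in> {x\<in>X. v x \<le> N} \<and> v x = Suc i. h (v x)) = h (Suc i) ^ card {x\<in>X. v x = Suc i}"
      by (simp only:) simp
  qed
  finally show ?thesis by simp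
qed

text \<open>The coefficient of \<open>M\<close> only involves elements whose variable occurs in
  \<open>M\<close>. As \<open>c\<close> is injective these have bounded degree, so the coefficients
  of the partial products are eventually constant.\<close>

lemma mfps_coeff_prodinf:
  fixes c :: "nat \<Rightarrow> 'v"
  assumes fin: "\<And>N. finite {x\<in>X. v x \<le> N}" and pos: "\<And>x. x \<in> X \<Longrightarrow> 0 < v x" and c: "inj c"
  shows "mfps_coeff (mfps_prodinf (\<lambda>i. mfps_inverse (1 - mfps_var (c (Suc i))) ^ card {x\<in>X. v x = Suc i})) M
    = int (card (coloured_msets X (c \<circ> v) M))"
proof -
  let ?f = "\<lambda>i. mfps_inverse (1 - mfps_var (c (Suc i))) ^ card {x\<in>X. v x = Suc i} :: ('v, int) mfps"
  have part: "(\<Prod>i<N. ?f i) = Abs_mfps (\<lambda>M. int (card (coloured_msets {x\<in>X. v x \<le> N} (c \<circ> v) M)))" for N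
  proof -
    have "(\<Prod>i<N. ?f i) = (\<Prod>x | x \<in> X \<and> v x \<le> N. mfps_inverse (1 - mfps_var (c (v x))))"
      by (rule prod_group_power[of X v N "\<lambda>k. mfps_inverse (1 - mfps_var (c k))", OF fin pos])
    then show ?thesis using mfps_prod_coloured_msets[OF fin[of N], of "c \<circ> v"] by simp
  qed
  obtain N0 where N0: "\<And>x. x \<in> X \<Longrightarrow> c (v x) \<in># M \<Longrightarrow> v x \<le> N0"
  proof
    have f: "finite (c -` set_mset M)" using c by (intro finite_vimageI) auto
    show "v x \<le> Max (c -` set_mset M)" if "x \<in> X" "c (v x) \<in># M" for x
      using that f by (intro Max_ge) auto
  qed
  have "coloured_msets {x\<in>X. v x \<le> N} (c \<circ> v) M = coloured_msets X (c \<circ> v) M" if "N0 \<le> N" for N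
  proof -
    have "v x \<le> N" if x: "x \<in># A" "set_mset A \<subseteq> X" "image_mset (c \<circ> v) A = M" for A x
    proof -
      have "c (v x) \<in># image_mset (c \<circ> v) A" using x(1) by (auto simp: image_iff)
      then show ?thesis using N0[of x] x \<open>N0 \<le> N\<close> by auto
    qed
    then show ?thesis by (auto simp: coloured_msets_def)
  qed
  then have "\<forall>\<^sub>F N in sequentially. mfps_coeff (\<Prod>i<N. ?f i) M = int (card (coloured_msets X (c \<circ> v) M))"
    unfolding part Abs_mfps_inverse[OF UNIV_I] by (intro eventually_sequentiallyI[of N0]) simp
  then have "(\<lambda>N. mfps_coeff (\<Prod>i<N. ?f i) M) \<longlonglongrightarrow> int (card (coloured_msets X (c \<circ> v) M))"
    by (rule tendsto_eventually)
  then show ?thesis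
    unfolding mfps_prodinf_def Abs_mfps_inverse[OF UNIV_I] by (rule limI)
qed

section \<open>Infinite products of formal power series\<close>

text \<open>For positive \<open>k\<close> this says that \<open>f\<close> is congruent to 1 modulo
  the \<open>k\<close>-th power of the variable; the \<open>i\<close>-th factor of each infinite
  product satisfies it with \<open>k = Suc i\<close>.\<close>

definition one_below :: "nat \<Rightarrow> real fps \<Rightarrow> bool" where
  "one_below k f \<longleftrightarrow> fps_nth f 0 = 1 \<and> (\<forall>j. 0 < j \<and> j < k \<longrightarrow> fps_nth f j = 0)"

lemma one_below_mult_nth:
  assumes "one_below k g" "n < k"
  shows "fps_nth (f * g) n = fps_nth f n"
proof -
  have "fps_nth (f * g) n = (\<Sum>i=0..n. if i = n then fps_nth f n else 0)"
    unfolding fps_mult_nth by (rule sum.cong) (use assms in \<open>auto simp: one_below_def\<close>)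
  then show ?thesis by simp
qed

text \<open>Only the two extreme terms of the convolution survive. Additivity in degree
  \<open>k\<close> is what lets the exponents be read off from the series one degree at a
  time.\<close>

lemma one_below_mult_nth_eq:
  assumes "one_below k g" "fps_nth f 0 = 1" "0 < k"
  shows "fps_nth (f * g) k = fps_nth f k + fps_nth g k"
proof -
  have "fps_nth (f * g) k = (\<Sum>i=0..k. (if i = k then fps_nth f k else 0) + (if i = 0 then fps_nth g k else 0))"
    unfolding fps_mult_nth by (rule sum.cong) (use assms in \<open>auto simp: one_below_def\<close>)
  then show ?thesis by (simp add: sum.distrib)
qed

lemma one_below_mult: "one_below k f \<Longrightarrow> one_below k g \<Longrightarrow> one_below k (f * g)"
  using one_below_mult_nth[of k g _ f] unfolding one_below_def by simp

lemma one_below_inverse: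
  assumes "one_below k f" "0 < k"
  shows "one_below k (inverse f)" "fps_nth (inverse f) k = - fps_nth f k"
proof -
  have f0: "fps_nth f 0 = 1" using assms by (simp add: one_below_def)
  then have i: "inverse f * f = 1" by (intro inverse_mult_eq_1) simp
  have "fps_nth (inverse f) n = fps_nth 1 n" if "n < k" for n
    using one_below_mult_nth[OF assms(1) that, of "inverse f"] by (simp only: i)
  then show "one_below k (inverse f)" using assms(2) f0 unfolding one_below_def by simp
  then show "fps_nth (inverse f) k = - fps_nth f k"
    using one_below_mult_nth_eq[OF assms(1), of "inverse f"] assms(2) by (simp add: i one_below_def)
qed

lemma one_below_power:
  assumes "one_below k f" "0 < k"
  shows "one_below k (f ^ m)" "fps_nth (f ^ m) k = real m * fps_nth f k"
proof -
  have "one_below k (f ^ m) \<and> fps_nth (f ^ m) k = real m * fps_nth f k"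
  proof (induction m)
    case 0
    then show ?case using assms(2) by (simp add: one_below_def)
  next
    case (Suc m)
    have f0: "fps_nth f 0 = 1" using assms by (simp add: one_below_def)
    show ?case
      using Suc one_below_mult[OF assms(1), of "f ^ m"] one_below_mult_nth_eq[OF assms(1), of "f ^ m"] f0 assms(2)
      by (simp add: algebra_simps fps_power_zeroth)
  qed
  then show "one_below k (f ^ m)" "fps_nth (f ^ m) k = real m * fps_nth f k" by blast+
qed

lemma one_below_factor:
  assumes "0 < k"
  shows "one_below k (inverse ((1 - fps_const a * fps_X ^ k) ^ m))"
    "fps_nth (inverse ((1 - fps_const a * fps_X ^ k) ^ m)) k = real m * a"
proof -
  have f: "one_below k (1 - fps_const a * fps_X ^ k)" using assms by (simp add: one_below_def)
  show "one_below k (inverse ((1 - fps_const a * fps_X ^ k) ^ m))"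
    by (intro one_below_inverse one_below_power f assms)
  show "fps_nth (inverse ((1 - fps_const a * fps_X ^ k) ^ m)) k = real m * a"
    using one_below_inverse(2)[OF one_below_power(1)[OF f assms] assms] one_below_power(2)[OF f assms] assms by simp
qed

text \<open>The factors from index \<open>n\<close> on have no terms in the degrees from 1 to
  \<open>n\<close>, so the \<open>n\<close>-th coefficient of the partial products no longer
  changes.\<close>

lemma fps_nth_prodinf:
  assumes f: "\<And>i. one_below (Suc i) (f i)" and n: "n \<le> N"
  shows "fps_nth (prodinf f) n = fps_nth (\<Prod>i<N. f i) n"
proof -
  define P where "P = Abs_fps (\<lambda>n. fps_nth (\<Prod>i<n. f i) n)"
  have stable: "fps_nth (\<Prod>i<N. f i) n = fps_nth P n" if "n \<le> N" for n N
    using that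
  proof (induction N)
    case (Suc N)
    show ?case
    proof (cases "n = Suc N")
      case False
      then have "n < Suc N" "n \<le> N" using Suc.prems by auto
      then show ?thesis using Suc.IH one_below_mult_nth[OF f] by simp
    qed (simp add: P_def)
  qed (simp add: P_def)
  have "(\<lambda>n. \<Prod>i\<le>n. f i) \<longlonglongrightarrow> P"
  proof (rule tendsto_fpsI)
    fix n
    show "\<forall>\<^sub>F N in sequentially. fps_nth (\<Prod>i\<le>N. f i) n = fps_nth P n"
      using stable[of n "Suc _"] by (intro eventually_sequentiallyI[of n]) (simp add: lessThan_Suc_atMost)
  qed
  \<comment> \<open>Convergence in the sense of \<open>raw_has_prod\<close> demands a nonzero
    limit.\<close>
  moreover have "fps_nth P 0 = 1" by (simp add: P_def)
  then have "P \<noteq> 0" by auto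
  ultimately have "f has_prod P" by (simp add: has_prod_def raw_has_prod_def)
  then have "prodinf f = P" by (rule has_prod_unique[symmetric])
  then show ?thesis using stable[OF n] by simp
qed

section \<open>Tensor powers\<close>

lemma abs_tensor_alg_eq_sum:
  "abs_tensor_alg p = (\<Sum>k\<in>Poly_Mapping.keys p. Poly_Mapping.lookup p k *\<^sub>R tensor k)"
proof -
  have lin: "linear abs_tensor_alg"
    by (rule linearI) (simp_all add: plus_tensor_alg.abs_eq scaleR_tensor_alg.abs_eq)
  have p: "p = (\<Sum>k\<in>Poly_Mapping.keys p. Poly_Mapping.lookup p k *\<^sub>R Poly_Mapping.single k 1)"
  proof (rule poly_mapping_eqI)
    fix k
    have "Poly_Mapping.lookup p k
      = (\<Sum>j\<in>Poly_Mapping.keys p. if j = k then Poly_Mapping.lookup p j else 0)"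
      by (simp add: in_keys_iff)
    also have "\<dots> = Poly_Mapping.lookup
      (\<Sum>k\<in>Poly_Mapping.keys p. Poly_Mapping.lookup p k *\<^sub>R Poly_Mapping.single k 1) k"
      by (simp add: lookup_sum lookup_single when_def if_distrib cong: if_cong)
    finally show "Poly_Mapping.lookup p k = \<dots>" .
  qed
  show ?thesis
    by (subst p, simp only: linear_sum[OF lin] linear_scale[OF lin] tensor.abs_eq)
qed

lemma span_tensor: "span (range tensor) = UNIV"
proof -
  have "t \<in> span (range tensor)" for t :: "'a tensor_alg"
  proof -
    obtain p where "t = abs_tensor_alg p"
      using Quotient_abs_rep[OF Quotient_tensor_alg] by metis
    then show ?thesis
      by (auto simp: abs_tensor_alg_eq_sum intro!: span_sum span_scale intro: span_base)
  qed
  then show ?thesis by blast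
qed

lemma tensor_linear_eq:
  assumes "linear f" "linear g" "\<And>xs. f (tensor xs) = g (tensor xs)"
  shows "f t = g t"
  by (rule linear_eq_on_span[of f g "range tensor"]) (use assms span_tensor in auto)

lemma linear_image_subset_span:
  assumes "linear f" "\<And>x. x \<in> S \<Longrightarrow> f x \<in> span T" "x \<in> span S"
  shows "f x \<in> span T"
proof -
  have "f ` span S = span (f ` S)" using linear_span_image[OF assms(1)] by blast
  also have "\<dots> \<subseteq> span T" using assms(2) by (intro span_minimal) auto
  finally show ?thesis using assms(3) by blast
qed

lemma bilinear_left: "bilinear h \<Longrightarrow> linear (\<lambda>x. h x y)"
  and bilinear_right: "bilinear h \<Longrightarrow> linear (h x)"
  by (simp_all add: bilinear_def)

lemma linear_compose2: "linear g \<Longrightarrow> linear f \<Longrightarrow> linear (\<lambda>x. g (f x))"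
  using linear_compose[of f g] by (simp add: o_def)

lemma bilinear_span:
  assumes "bilinear h" "\<And>x y. x \<in> S \<Longrightarrow> y \<in> T \<Longrightarrow> h x y \<in> span U" "x \<in> span S" "y \<in> span T"
  shows "h x y \<in> span U"
proof (rule linear_image_subset_span[OF _ _ assms(3)])
  show "linear (\<lambda>x. h x y)" using assms(1) by (simp add: bilinear_def)
next
  fix x assume "x \<in> S"
  then show "h x y \<in> span U"
    using assms(1) by (intro linear_image_subset_span[OF _ assms(2) assms(4)]) (auto simp: bilinear_def)
qed

lemma multilinear_tensor: "multilinear tensor"
proof -
  have 1: "tensor_eq (Poly_Mapping.single (xs @ (a + b) # ys) 1)
      (Poly_Mapping.single (xs @ a # ys) 1 + Poly_Mapping.single (xs @ b # ys) 1)"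
    for xs ys :: "'a list" and a b
  proof -
    have "Poly_Mapping.single (xs @ (a + b) # ys) (1::real)
      - Poly_Mapping.single (xs @ a # ys) 1 - Poly_Mapping.single (xs @ b # ys) 1 \<in> multilinear_rels"
      unfolding multilinear_rels_def by blast
    then show ?thesis unfolding tensor_eq_def by (simp add: span_base diff_diff_eq)
  qed
  have 2: "tensor_eq (Poly_Mapping.single (xs @ (c *\<^sub>R a) # ys) 1)
      (c *\<^sub>R Poly_Mapping.single (xs @ a # ys) 1)" for xs ys :: "'a list" and a c
    unfolding tensor_eq_def multilinear_rels_def by (rule span_base) blast
  show ?thesis
    unfolding multilinear_def
    by (auto simp: tensor.abs_eq plus_tensor_alg.abs_eq scaleR_tensor_alg.abs_eq
        tensor_alg.abs_eq_iff 1 2)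
qed

lemma multilinear_compose:
  "linear f \<Longrightarrow> multilinear g \<Longrightarrow> multilinear (\<lambda>xs. f (g xs))"
  by (simp add: multilinear_def linear_add linear_scale)

lemma multilinear_if_length:
  "multilinear g \<Longrightarrow> multilinear (\<lambda>xs. if length xs = n then g xs else 0)"
  by (auto simp: multilinear_def)

text \<open>The universal property in two arguments, shared by \<open>tensor_append\<close> and
  \<open>tensor_times\<close>. The outer lift requires the inner one to be multilinear in
  \<open>xs\<close> for every \<open>t\<close>; this holds for pure \<open>t\<close>, hence for all
  \<open>t\<close> by linearity.\<close>

lemma bilinear_tensor_lift2:
  fixes G :: "'a::real_vector list \<Rightarrow> 'b::real_vector list \<Rightarrow> 'c::real_vector"
  assumes "\<And>xs. multilinear (G xs)" "\<And>ys. multilinear (\<lambda>xs. G xs ys)"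
  defines "h \<equiv> \<lambda>s t. tensor_lift (\<lambda>xs. tensor_lift (G xs) t) s"
  shows "bilinear h" "h (tensor xs) (tensor ys) = G xs ys"
proof -
  have lin: "linear (tensor_lift (G xs))" for xs by (rule linear_tensor_lift[OF assms(1)])
  have G: "G (xs @ (a + b) # ys) zs = G (xs @ a # ys) zs + G (xs @ b # ys) zs"
    "G (xs @ (c *\<^sub>R a) # ys) zs = c *\<^sub>R G (xs @ a # ys) zs" for xs a b c ys zs
    using assms(2)[of zs] unfolding multilinear_def by blast+
  have ml: "multilinear (\<lambda>xs. tensor_lift (G xs) t)" for t
    unfolding multilinear_def
  proof (intro conjI allI)
    fix xs a b ys
    show "tensor_lift (G (xs @ (a + b) # ys)) t
      = tensor_lift (G (xs @ a # ys)) t + tensor_lift (G (xs @ b # ys)) t"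
      by (rule tensor_linear_eq[OF lin linear_compose_add[OF lin lin]])
        (simp only: tensor_lift_tensor[OF assms(1)] G)
  next
    fix xs c a ys
    show "tensor_lift (G (xs @ (c *\<^sub>R a) # ys)) t = c *\<^sub>R tensor_lift (G (xs @ a # ys)) t"
      by (rule tensor_linear_eq[OF lin linear_compose_scale_right[OF lin]])
        (simp only: tensor_lift_tensor[OF assms(1)] G)
  qed
  have pure: "h (tensor xs) t = tensor_lift (G xs) t" for xs t
    by (simp add: h_def tensor_lift_tensor[OF ml])
  have l1: "linear (\<lambda>s. h s t)" for t unfolding h_def by (rule linear_tensor_lift[OF ml])
  have "linear (h s)" for s
  proof (rule linearI)
    fix t u
    show "h s (t + u) = h s t + h s u"
      by (rule tensor_linear_eq[OF l1 linear_compose_add[OF l1 l1]]) (simp add: pure linear_add[OF lin])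
  next
    fix c t
    show "h s (c *\<^sub>R t) = c *\<^sub>R h s t"
      by (rule tensor_linear_eq[OF l1 linear_compose_scale_right[OF l1]]) (simp add: pure linear_scale[OF lin])
  qed
  then show "bilinear h" using l1 by (simp add: bilinear_def)
  show "h (tensor xs) (tensor ys) = G xs ys" by (simp add: pure tensor_lift_tensor[OF assms(1)])
qed

lemma multilinear_tensor_app:
  "multilinear (\<lambda>ys. tensor (xs @ ys))" "multilinear (\<lambda>xs. tensor (xs @ ys))"
proof -
  show "multilinear (\<lambda>ys. tensor (xs @ ys))"
    using multilinear_tensor unfolding multilinear_def by (metis append_assoc)
  show "multilinear (\<lambda>xs. tensor (xs @ ys))"
    using multilinear_tensor unfolding multilinear_def by (metis append.assoc append_Cons)
qed

lemma bilinear_tensor_append: "bilinear (\<otimes>\<^sub>T)"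
  using bilinear_tensor_lift2(1)[OF multilinear_tensor_app] unfolding tensor_append_def .

lemma tensor_append_tensor [simp]: "tensor xs \<otimes>\<^sub>T tensor ys = tensor (xs @ ys)"
  unfolding tensor_append_def by (rule bilinear_tensor_lift2(2)[OF multilinear_tensor_app])

text \<open>Stated for any bilinear \<open>h\<close>: \<open>tensor_append\<close> gives
  \<open>tensor_maps\<close>, and multiplication of reals gives the pairing with a list of
  functionals.\<close>

lemma multilinear_foldr:
  assumes h: "bilinear h" and f: "\<And>f. f \<in> set fs \<Longrightarrow> linear f"
  shows "multilinear (\<lambda>xs. if length xs = length fs then foldr h (map2 (\<lambda>f x. f x) fs xs) e else 0)"
  using f
proof (induction fs)
  case Nil
  then show ?case by (auto simp: multilinear_def)
next
  case (Cons f fs)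
  let ?g = "\<lambda>xs. if length xs = length fs then foldr h (map2 (\<lambda>f x. f x) fs xs) e else 0"
  have IH: "multilinear ?g" using Cons by auto
  have f: "linear f" using Cons by auto
  have step: "(if length xs = length (f # fs) then foldr h (map2 (\<lambda>f x. f x) (f # fs) xs) e else 0)
     = (case xs of [] \<Rightarrow> 0 | x # xs' \<Rightarrow> h (f x) (?g xs'))" for xs
    using h by (cases xs) (auto simp: bilinear_rzero)
  show ?case
    unfolding step
    unfolding multilinear_def
  proof (intro conjI allI, goal_cases)
    case (1 xs a b ys)
    show ?case
    proof (cases xs)
      case Nil
      then show ?thesis by (simp add: linear_add[OF f] bilinear_ladd[OF h] bilinear_rzero[OF h])
    next
      case (Cons x xs')
      then show ?thesis using IH unfolding multilinear_def
        by (simp only: list.case append_Cons bilinear_radd[OF h])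
    qed
  next
    case (2 xs c a ys)
    show ?case
    proof (cases xs)
      case Nil
      then show ?thesis by (simp add: linear_scale[OF f] bilinear_lmul[OF h] bilinear_rzero[OF h])
    next
      case (Cons x xs')
      then show ?thesis using IH unfolding multilinear_def
        by (simp only: list.case append_Cons bilinear_rmul[OF h])
    qed
  qed
qed

lemma linear_tensor_maps:
  assumes "\<And>f. f \<in> set fs \<Longrightarrow> linear f"
  shows "linear (tensor_maps fs)"
  unfolding tensor_maps_def
  by (rule linear_tensor_lift[OF multilinear_foldr[OF bilinear_tensor_append assms]])

lemma tensor_maps_tensor:
  assumes "\<And>f. f \<in> set fs \<Longrightarrow> linear f"
  shows "tensor_maps fs (tensor xs)
    = (if length xs = length fs then foldr (\<otimes>\<^sub>T) (map2 (\<lambda>f x. f x) fs xs) (tensor []) else 0)"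
  unfolding tensor_maps_def
  by (rule tensor_lift_tensor[OF multilinear_foldr[OF bilinear_tensor_append assms]])

lemma linear_tensor1: "linear tensor1"
proof (rule linearI)
  fix x y :: 'a and c :: real
  have "tensor ([] @ (x + y) # []) = tensor ([] @ x # []) + tensor ([] @ y # [])"
    using multilinear_tensor unfolding multilinear_def by blast
  then show "tensor1 (x + y) = tensor1 x + tensor1 y" by (simp add: tensor1_def)
  have "tensor ([] @ (c *\<^sub>R x) # []) = c *\<^sub>R tensor ([] @ x # [])"
    using multilinear_tensor unfolding multilinear_def by blast
  then show "tensor1 (c *\<^sub>R x) = c *\<^sub>R tensor1 x" by (simp add: tensor1_def)
qed

lemma tensor_maps_endo:
  assumes "\<And>f. f \<in> set fs \<Longrightarrow> linear f" "length xs = length fs"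
  shows "tensor_maps (map (\<lambda>f. tensor1 \<circ> f) fs) (tensor xs) = tensor (map2 (\<lambda>f x. f x) fs xs)"
proof -
  have lin: "\<And>g. g \<in> set (map (\<lambda>f. tensor1 \<circ> f) fs) \<Longrightarrow> linear g"
    using assms(1) linear_compose[OF _ linear_tensor1] by auto
  have "foldr (\<otimes>\<^sub>T) (map2 (\<lambda>f x. f x) (map (\<lambda>f. tensor1 \<circ> f) fs) xs) (tensor [])
    = tensor (map2 (\<lambda>f x. f x) fs xs)"
    using assms(2)[symmetric] by (induction fs xs rule: list_induct2) (simp_all add: tensor1_def)
  then show ?thesis by (subst tensor_maps_tensor[OF lin]) (use assms(2) in auto)
qed

lemma tensor_append_Nil [simp]: "t \<otimes>\<^sub>T tensor [] = t"
proof (rule tensor_linear_eq[of "\<lambda>t. t \<otimes>\<^sub>T tensor []" "\<lambda>t. t"])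
  show "linear (\<lambda>t. t \<otimes>\<^sub>T tensor [])"
    by (rule bilinear_left[OF bilinear_tensor_append])
qed (simp_all add: linear_ident)

lemma multilinear_prod_list: "multilinear (prod_list :: 'a::real_algebra_1 list \<Rightarrow> 'a)"
  by (simp add: multilinear_def algebra_simps)

lemma linear_tensor_multiply: "linear tensor_multiply"
  unfolding tensor_multiply_def by (rule linear_tensor_lift[OF multilinear_prod_list])

lemma tensor_multiply_tensor [simp]: "tensor_multiply (tensor xs) = prod_list xs"
  unfolding tensor_multiply_def by (rule tensor_lift_tensor[OF multilinear_prod_list])

lemma multilinear_tensor_map2:
  fixes ys :: "'a::real_algebra_1 list"
  shows "multilinear (\<lambda>xs. if length xs = length ys then tensor (map2 (*) xs ys) else 0)"
    and "multilinear (\<lambda>xs. if length ys = length xs then tensor (map2 (*) ys xs) else 0)"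
proof -
  have l: "linear (\<lambda>x. tensor1 (x * y))" "linear (\<lambda>x. tensor1 (y * x))" for y :: 'a
    by (rule linear_compose2[OF linear_tensor1], rule linearI, simp_all add: algebra_simps)+
  have e: "foldr (\<otimes>\<^sub>T) (map2 (\<lambda>f x. f x) (map (\<lambda>y x. tensor1 (x * y)) ys) xs) (tensor []) = tensor (map2 (*) xs ys)"
    "foldr (\<otimes>\<^sub>T) (map2 (\<lambda>f x. f x) (map (\<lambda>y x. tensor1 (y * x)) ys) xs) (tensor []) = tensor (map2 (*) ys xs)"
    if "length xs = length ys" for xs :: "'a list"
    using that by (induction xs ys rule: list_induct2) (simp_all add: tensor1_def)
  show "multilinear (\<lambda>xs. if length xs = length ys then tensor (map2 (*) xs ys) else 0)"
    using multilinear_foldr[OF bilinear_tensor_append, of "map (\<lambda>y x. tensor1 (x * y)) ys" "tensor []"] l(1)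
    by (auto simp: e cong: if_cong)
  show "multilinear (\<lambda>xs. if length ys = length xs then tensor (map2 (*) ys xs) else 0)"
    using multilinear_foldr[OF bilinear_tensor_append, of "map (\<lambda>y x. tensor1 (y * x)) ys" "tensor []"] l(2)
    by (auto simp: e eq_commute[of "length ys"] cong: if_cong)
qed

lemma bilinear_tensor_times: "bilinear tensor_times"
  using bilinear_tensor_lift2(1)[OF multilinear_tensor_map2(2) multilinear_tensor_map2(1)]
  unfolding tensor_times_def .

lemma tensor_times_tensor [simp]: "tensor_times (tensor xs) (tensor ys)
    = (if length xs = length ys then tensor (map2 (*) xs ys) else 0)"
  unfolding tensor_times_def
  by (rule bilinear_tensor_lift2(2)[OF multilinear_tensor_map2(2) multilinear_tensor_map2(1)])

text \<open>Fixing the length \<open>k\<close> of both left parts matters: without it two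
  concatenations could have equal lengths while their pieces do not, and the left side would not
  factor.\<close>

lemma tensor_times_append:
  assumes "s \<in> span {tensor xs |xs. length xs = k}" "s' \<in> span {tensor xs |xs. length xs = k}"
  shows "tensor_times (s \<otimes>\<^sub>T tensor ys) (s' \<otimes>\<^sub>T tensor ys')
    = tensor_times s s' \<otimes>\<^sub>T (if length ys = length ys' then tensor (map2 (*) ys ys') else 0)"
proof -
  let ?S = "{tensor xs |xs. length xs = k} :: 'a tensor_alg set"
  let ?u = "if length ys = length ys' then tensor (map2 (*) ys ys') else 0"
  note bt = bilinear_tensor_times and ba = bilinear_tensor_append
  note la = bilinear_left[OF ba]
  note l1 = linear_compose2[OF bilinear_left[OF bt] la]
    and l2 = linear_compose2[OF bilinear_right[OF bt] la]
    and r1 = linear_compose2[OF la bilinear_left[OF bt]]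
    and r2 = linear_compose2[OF la bilinear_right[OF bt]]
  have "tensor_times (s \<otimes>\<^sub>T tensor ys) (tensor xs' \<otimes>\<^sub>T tensor ys') = tensor_times s (tensor xs') \<otimes>\<^sub>T ?u"
    if "length xs' = k" for xs'
    by (rule linear_eq_on_span[OF l1 r1 _ assms(1)])
      (use that bilinear_rzero[OF bilinear_tensor_append] in auto)
  then show ?thesis
    by (intro linear_eq_on_span[OF l2 r2 _ assms(2)]) auto
qed

section \<open>The augmentation filtration\<close>

context graded_connected_hopf_algebra
begin

abbreviation hcomp :: "nat \<Rightarrow> 'a \<Rightarrow> 'a" where
  "hcomp \<equiv> homogeneous_component H"

abbreviation cop :: "nat \<Rightarrow> 'a \<Rightarrow> 'a tensor_alg" where
  "cop \<equiv> iterated_coproduct \<Delta> \<epsilon>"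

abbreviation split_first :: "nat \<Rightarrow> 'a tensor_alg \<Rightarrow> 'a tensor_alg" where
  "split_first l \<equiv> tensor_maps (\<Delta> # replicate l tensor1)"

abbreviation red :: "'a \<Rightarrow> 'a tensor_alg" where
  "red y \<equiv> \<Delta> y - tensor [y, 1] - tensor [1, y]"

section \<open>Homogeneous components as linear projections\<close>

lemma is_decomposition_superset:
  "finite S \<Longrightarrow> {n. c n \<noteq> 0} \<subseteq> S \<Longrightarrow> (\<And>n. c n \<in> H n) \<Longrightarrow> x = (\<Sum>n\<in>S. c n) \<Longrightarrow> is_decomposition H x c"
  unfolding is_decomposition_def
  by (intro conjI allI) (auto intro: finite_subset sum.mono_neutral_right)

lemma homogeneous_component_eq:
  assumes "is_decomposition H x c"
  shows "hcomp n x = c n"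
  unfolding homogeneous_component_def using direct_sum assms by (metis the1_equality)

lemma is_decomposition_components: "is_decomposition H x (\<lambda>n. hcomp n x)"
  unfolding homogeneous_component_def using theI'[OF direct_sum[of x]] by simp

lemma component_in: "hcomp n x \<in> H n"
  and finite_components: "finite {n. hcomp n x \<noteq> 0}"
  and sum_components: "(\<Sum>n | hcomp n x \<noteq> 0. hcomp n x) = x"
  using is_decomposition_components[of x] by (auto simp: is_decomposition_def)

lemma linear_homogeneous_component: "linear (hcomp n)"
proof (rule linearI)
  fix x y and c :: real
  let ?c = "\<lambda>x n. hcomp n x"
  let ?S = "{n. ?c x n \<noteq> 0} \<union> {n. ?c y n \<noteq> 0}"
  have S: "finite ?S" using finite_components by auto
  have "(\<Sum>n\<in>?S. ?c x n) = (\<Sum>n | ?c x n \<noteq> 0. ?c x n)"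
    by (rule sum.mono_neutral_right[OF S]) auto
  then have sx: "(\<Sum>n\<in>?S. ?c x n) = x" by (simp only: sum_components)
  have "(\<Sum>n\<in>?S. ?c y n) = (\<Sum>n | ?c y n \<noteq> 0. ?c y n)"
    by (rule sum.mono_neutral_right[OF S]) auto
  then have sy: "(\<Sum>n\<in>?S. ?c y n) = y" by (simp only: sum_components)
  have "is_decomposition H (x + y) (\<lambda>n. ?c x n + ?c y n)"
    by (rule is_decomposition_superset[OF S])
      (auto simp: sum.distrib sx sy intro!: subspace_add subspace_H component_in)
  from homogeneous_component_eq[OF this]
  show "hcomp n (x + y) = ?c x n + ?c y n" .
  have "is_decomposition H (c *\<^sub>R x) (\<lambda>n. c *\<^sub>R ?c x n)"
    by (rule is_decomposition_superset[OF S])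
      (auto simp: scaleR_sum_right[symmetric] sx intro!: subspace_scale subspace_H component_in)
  from homogeneous_component_eq[OF this]
  show "hcomp n (c *\<^sub>R x) = c *\<^sub>R ?c x n" .
qed

lemma component_homogeneous:
  assumes "x \<in> H m"
  shows "hcomp n x = (if n = m then x else 0)"
  by (rule homogeneous_component_eq, rule is_decomposition_superset[of "{m}"])
    (use assms subspace_0[OF subspace_H] in auto)

lemma one_in_H0: "1 \<in> H 0"
  by (simp add: connected span_base)

lemma homogeneous_unique: "x \<in> H m \<Longrightarrow> x \<in> H n \<Longrightarrow> x \<noteq> 0 \<Longrightarrow> m = n"
  using component_homogeneous by metis

text \<open>Every letter carries its degree, since 0 lies in every \<open>H d\<close> and has no
  degree of its own; the degree of a word is then a plain sum even where the product
  vanishes.\<close>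

definition hword :: "('a \<times> nat) list \<Rightarrow> bool" where
  "hword w \<longleftrightarrow> (\<forall>(z, d)\<in>set w. 0 < d \<and> z \<in> H d)"

abbreviation eval_word :: "('a \<times> 'k) list \<Rightarrow> 'a" where
  "eval_word w \<equiv> prod_list (map fst w)"

text \<open>
  \<open>aug k\<close> is the \<open>k\<close>-th power of the augmentation ideal, and \<open>taug l\<close> is the induced filtration of the
  \<open>l\<close>-th tensor power; empty words account for factors \<open>1\<close>.
\<close>

definition aug :: "nat \<Rightarrow> 'a set" where
  "aug k = span {eval_word w | w. hword w \<and> k \<le> length w}"

definition taug :: "nat \<Rightarrow> nat \<Rightarrow> 'a tensor_alg set" where
  "taug l k = span {tensor (map eval_word ws) | ws.
     length ws = l \<and> (\<forall>w\<in>set ws. hword w) \<and> k \<le> length (concat ws)}"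

lemma hword_simps [simp]:
  "hword []" "hword ((z, d) # w) \<longleftrightarrow> 0 < d \<and> z \<in> H d \<and> hword w"
  "hword (v @ w) \<longleftrightarrow> hword v \<and> hword w"
  by (auto simp: hword_def)

lemma hword_degree: "hword w \<Longrightarrow> eval_word w \<in> H (sum_list (map snd w))"
  by (induction w) (auto simp: one_in_H0 intro: mult_graded)

lemma hword_length: "hword w \<Longrightarrow> length w \<le> sum_list (map snd w)"
  by (induction w) auto

lemma subspace_aug: "subspace (aug k)" and subspace_taug: "subspace (taug l k)"
  by (simp_all add: aug_def taug_def)

lemma aug_antimono: "k \<le> k' \<Longrightarrow> aug k' \<subseteq> aug k"
  unfolding aug_def by (rule span_mono) auto

lemma taug_antimono: "k \<le> k' \<Longrightarrow> taug l k' \<subseteq> taug l k"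
  unfolding taug_def by (rule span_mono) auto

lemma hword_in_aug: "hword w \<Longrightarrow> k \<le> length w \<Longrightarrow> eval_word w \<in> aug k"
  unfolding aug_def by (rule span_base) blast

lemma hwords_in_taug:
  "length ws = l \<Longrightarrow> \<forall>w\<in>set ws. hword w \<Longrightarrow> k \<le> length (concat ws) \<Longrightarrow>
    tensor (map eval_word ws) \<in> taug l k"
  unfolding taug_def by (rule span_base) blast

lemma bilinear_times: "bilinear ((*) :: 'a \<Rightarrow> 'a \<Rightarrow> 'a)"
  by (auto simp: bilinear_def algebra_simps intro!: linearI)

lemma aug_mult:
  assumes "x \<in> aug j" "y \<in> aug k"
  shows "x * y \<in> aug (j + k)"
  unfolding aug_def
proof (rule bilinear_span[OF bilinear_times _ assms[unfolded aug_def]])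
  fix x y assume "x \<in> {eval_word w |w. hword w \<and> j \<le> length w}" "y \<in> {eval_word w |w. hword w \<and> k \<le> length w}"
  then obtain v w where "x = eval_word v" "y = eval_word w" "hword v" "hword w" "j \<le> length v" "k \<le> length w"
    by blast
  then show "x * y \<in> span {eval_word w |w. hword w \<and> j + k \<le> length w}"
    by (intro span_base CollectI exI[of _ "v @ w"]) auto
qed

lemma taug_times:
  assumes "s \<in> taug l j" "t \<in> taug l k"
  shows "tensor_times s t \<in> taug l (j + k)"
  unfolding taug_def
proof (rule bilinear_span[OF bilinear_tensor_times _ assms[unfolded taug_def]], safe, goal_cases)
  case (1 _ _ vs ws)
  have l: "length ws = length vs" using 1 by simp
  then have "map2 (*) (map eval_word vs) (map eval_word ws) = map eval_word (map2 (@) vs ws)"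
    by (induction ws vs rule: list_induct2) auto
  moreover have "length (concat (map2 (@) vs ws)) = length (concat vs) + length (concat ws)"
    using l by (induction ws vs rule: list_induct2) auto
  moreover have "\<forall>w\<in>set (map2 (@) vs ws). hword w"
    using 1 by (auto simp: set_zip)
  ultimately show ?case
    using 1 by (intro span_base CollectI exI[of _ "map2 (@) vs ws"]) auto
qed

lemma taug_append:
  assumes "s \<in> taug l j" "t \<in> taug l' k"
  shows "s \<otimes>\<^sub>T t \<in> taug (l + l') (j + k)"
  unfolding taug_def
proof (rule bilinear_span[OF bilinear_tensor_append _ assms[unfolded taug_def]], safe, goal_cases)
  case (1 _ _ vs ws)
  then show ?case by (intro span_base CollectI exI[of _ "vs @ ws"]) auto
qed

lemma tensor_ones_in_taug: "tensor (replicate l 1) \<in> taug l 0"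
  using hwords_in_taug[of "replicate l []" l 0] by simp

text \<open>Every word is homogeneous, so projecting to degree \<open>n\<close> just selects words:
  the powers of the augmentation ideal are graded.\<close>

lemma aug_component:
  assumes "x \<in> aug k"
  shows "hcomp n x
    \<in> span {eval_word w | w. hword w \<and> k \<le> length w \<and> sum_list (map snd w) = n}"
proof (rule linear_image_subset_span[OF linear_homogeneous_component _ assms[unfolded aug_def]], safe)
  fix w assume w: "hword w" "k \<le> length w"
  show "hcomp n (eval_word w)
    \<in> span {eval_word w | w. hword w \<and> k \<le> length w \<and> sum_list (map snd w) = n}"
    unfolding component_homogeneous[OF hword_degree[OF w(1)]]
  proof (cases "n = sum_list (map snd w)")
    case True
    have "eval_word w \<in> span {eval_word w | w. hword w \<and> k \<le> length w \<and> sum_list (map snd w) = n}"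
      using w True by (intro span_base) blast
    then show "(if n = sum_list (map snd w) then eval_word w else 0)
      \<in> span {eval_word w | w. hword w \<and> k \<le> length w \<and> sum_list (map snd w) = n}"
      by (subst if_P[OF True])
  qed (simp add: span_zero)
qed

lemma aug_component_in: "x \<in> aug k \<Longrightarrow> hcomp n x \<in> aug k \<inter> H n"
  using aug_component[of x k n] component_in[of n x]
    span_mono[of "{eval_word w | w. hword w \<and> k \<le> length w \<and> sum_list (map snd w) = n}"
      "{eval_word w | w. hword w \<and> k \<le> length w}"]
  unfolding aug_def by blast

lemma aug_homogeneous:
  assumes "x \<in> aug k" "x \<in> H n"
  shows "x \<in> span {eval_word w | w. hword w \<and> k \<le> length w \<and> sum_list (map snd w) = n}"
  using aug_component[OF assms(1), of n] component_homogeneous[OF assms(2)] by simp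

text \<open>A product of at least \<open>k\<close> letters of positive degree has degree at least
  \<open>k\<close>. Hence the filtration is finite in each degree, which is what ends the rewriting
  of words.\<close>

lemma aug_eq_0: "x \<in> aug k \<Longrightarrow> x \<in> H n \<Longrightarrow> n < k \<Longrightarrow> x = 0"
proof -
  assume x: "x \<in> aug k" "x \<in> H n" and "n < k"
  have "{eval_word w | w. hword w \<and> k \<le> length w \<and> sum_list (map snd w) = n} = {}"
    using \<open>n < k\<close> hword_length by fastforce
  then show "x = 0" using aug_homogeneous[OF x] by (metis span_empty singletonD)
qed

lemma H_subset_aug_1: "0 < n \<Longrightarrow> x \<in> H n \<Longrightarrow> x \<in> aug 1"
  using hword_in_aug[of "[(x, n)]" 1] by simp

lemma linear_tensor_slot: "linear (\<lambda>y. tensor (xs @ y # ys))"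
  using multilinear_tensor unfolding multilinear_def by (intro linearI) blast+

lemma linear_tensor_pair: "linear (\<lambda>z. tensor [a, z])" "linear (\<lambda>z. tensor [z, a])"
  using linear_tensor_slot[of "[a]" "[]"] linear_tensor_slot[of "[]" "[a]"] by simp_all

lemma aug_tensor_slot:
  assumes "y \<in> aug k"
  shows "tensor (replicate i 1 @ y # replicate j 1) \<in> taug (Suc (i + j)) k"
proof -
  have "tensor (replicate i 1 @ y # replicate j 1)
    \<in> span {tensor (map eval_word ws) | ws. length ws = Suc (i + j) \<and> (\<forall>w\<in>set ws. hword w) \<and> k \<le> length (concat ws)}"
  proof (rule linear_image_subset_span[OF linear_tensor_slot _ assms[unfolded aug_def]], safe)
    fix w assume "hword w" "k \<le> length w"
    then show "tensor (replicate i 1 @ eval_word w # replicate j 1)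
      \<in> span {tensor (map eval_word ws) | ws. length ws = Suc (i + j) \<and> (\<forall>w\<in>set ws. hword w) \<and> k \<le> length (concat ws)}"
      by (intro span_base CollectI exI[of _ "replicate i [] @ w # replicate j []"]) auto
  qed
  then show ?thesis by (simp add: taug_def)
qed

lemma coproduct_positive_degree:
  assumes y: "y \<in> H d" and d: "0 < d"
  shows "red y \<in> taug 2 2"
proof -
  let ?l = "tensor_maps [\<lambda>y. \<epsilon> y *\<^sub>R tensor [], tensor1]" and ?r = "tensor_maps [tensor1, \<lambda>y. \<epsilon> y *\<^sub>R tensor []]"
  let ?p = "\<lambda>t. t - ?r t \<otimes>\<^sub>T tensor [1] - tensor [1] \<otimes>\<^sub>T ?l t"
  \<comment> \<open>\<open>?p\<close> sends \<open>\<Delta> y\<close> to \<open>red y\<close>, kills tensors with one factor in \<open>H 0\<close> and fixes the others.\<close>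
  note ba = bilinear_tensor_append
  have le: "linear (\<lambda>y. \<epsilon> y *\<^sub>R tensor [])"
    by (intro linearI) (simp_all add: linear_add[OF linear_counit] linear_scale[OF linear_counit] scaleR_add_left)
  have lin: "linear ?l" "linear ?r"
    by (rule linear_tensor_maps; use le linear_tensor1 in auto)+
  have pure: "?l (tensor [a, b]) = \<epsilon> a *\<^sub>R tensor [b]" "?r (tensor [a, b]) = \<epsilon> b *\<^sub>R tensor [a]" for a b
    using le linear_tensor1
    by (subst tensor_maps_tensor; auto simp: bilinear_lmul[OF ba] bilinear_rmul[OF ba] tensor1_def)+
  have p: "linear ?p"
    by (intro linear_compose_sub linear_ident linear_compose2[OF bilinear_left[OF ba] lin(2)]
        linear_compose2[OF bilinear_right[OF ba] lin(1)])
  have p_pure: "?p (tensor [u, v]) = tensor [u, v] - \<epsilon> v *\<^sub>R tensor [u, 1] - \<epsilon> u *\<^sub>R tensor [1, v]" for u v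
    by (simp add: pure bilinear_lmul[OF ba] bilinear_rmul[OF ba])
  have "?p (\<Delta> y) \<in> span (taug 2 2)"
  proof (rule linear_image_subset_span[OF p _ coproduct_graded[OF y]], safe)
    fix u v i j assume uv: "u \<in> H i" "v \<in> H j" "d = i + j"
    note scale = linear_scale[OF linear_tensor_pair(1)] linear_scale[OF linear_tensor_pair(2)]
    consider "i = 0" | "j = 0" | "0 < i" "0 < j" by auto
    then have "?p (tensor [u, v]) \<in> taug 2 2"
    proof cases
      case 1
      then obtain a where "u = a *\<^sub>R 1" using uv connected by (auto simp: span_singleton)
      then have "?p (tensor [u, v]) = 0"
        using uv d 1 unfolding p_pure
        by (simp add: counit_graded counit_one linear_scale[OF linear_counit] scale)
      then show ?thesis by (simp add: subspace_0[OF subspace_taug])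
    next
      case 2
      then obtain a where "v = a *\<^sub>R 1" using uv connected by (auto simp: span_singleton)
      then have "?p (tensor [u, v]) = 0"
        using uv d 2 unfolding p_pure
        by (simp add: counit_graded counit_one linear_scale[OF linear_counit] scale)
      then show ?thesis by (simp add: subspace_0[OF subspace_taug])
    next
      case 3
      then show ?thesis
        using hwords_in_taug[of "[[(u, i)], [(v, j)]]" 2 2] uv unfolding p_pure by (simp add: counit_graded)
    qed
    then show "?p (tensor [u, v]) \<in> span (taug 2 2)" by (rule span_base)
  qed
  moreover have "?p (\<Delta> y) = red y" by (simp add: counit_left counit_right tensor1_def)
  ultimately show ?thesis by (simp add: span_eq_iff[THEN iffD2, OF subspace_taug])
qed

text \<open>The lifts of the primitive elements of the associated graded Hopf algebra.\<close>

definition prim :: "nat \<Rightarrow> nat \<Rightarrow> 'a set" where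
  "prim k d = {y \<in> H d. 0 < d \<and> y \<in> aug k \<and> red y \<in> taug 2 (Suc k)}"

text \<open>At level 1 every homogeneous element of positive degree is a primitive letter.
  Connectedness enters here, through \<open>coproduct_positive_degree\<close>: apart from the two
  end terms, both factors of the coproduct have positive degree.\<close>

lemma prim_1: "0 < d \<Longrightarrow> prim 1 d = H d"
  using coproduct_positive_degree H_subset_aug_1
  by (auto simp: prim_def numeral_2_eq_2)

text \<open>\<open>x \<otimes> 1\<close> commutes with \<open>1 \<otimes> y\<close>, so the leading
  parts \<open>X\<close> and \<open>Y\<close> of the two coproducts have the commutator of
  \<open>x\<close> and \<open>y\<close> in either slot as their own commutator. Every other product
  involves \<open>dx\<close> or \<open>dy\<close> and lies one step deeper.\<close>

lemma prim_commutator: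
  assumes "x \<in> prim j d" "y \<in> prim k e"
  shows "x * y - y * x \<in> prim (j + k) (d + e)"
proof -
  have x: "x \<in> H d" "0 < d" "x \<in> aug j" "red x \<in> taug 2 (Suc j)"
    and y: "y \<in> H e" "0 < e" "y \<in> aug k" "red y \<in> taug 2 (Suc k)"
    using assms by (auto simp: prim_def)
  define dx where "dx = red x"
  define dy where "dy = red y"
  define X where "X = tensor [x, 1] + tensor [1, x]"
  define Y where "Y = tensor [y, 1] + tensor [1, y]"
  have X: "X \<in> taug 2 j" and Y: "Y \<in> taug 2 k"
    using aug_tensor_slot[OF x(3), of 0 1] aug_tensor_slot[OF x(3), of 1 0]
      aug_tensor_slot[OF y(3), of 0 1] aug_tensor_slot[OF y(3), of 1 0]
    by (auto simp: X_def Y_def numeral_2_eq_2 intro!: subspace_add[OF subspace_taug])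
  have Dx: "\<Delta> x = X + dx" and Dy: "\<Delta> y = Y + dy" by (simp_all add: X_def Y_def dx_def dy_def)
  have dxy: "dx \<in> taug 2 (Suc j)" "dy \<in> taug 2 (Suc k)" using x y by (simp_all add: dx_def dy_def)
  note b = bilinear_ladd[OF bilinear_tensor_times] bilinear_radd[OF bilinear_tensor_times]
  have 1: "tensor_times X dy \<in> taug 2 (Suc (j + k))" "tensor_times dy X \<in> taug 2 (Suc (j + k))"
    "tensor_times dx Y \<in> taug 2 (Suc (j + k))" "tensor_times Y dx \<in> taug 2 (Suc (j + k))"
    using taug_times[OF X dxy(2)] taug_times[OF dxy(2) X] taug_times[OF dxy(1) Y] taug_times[OF Y dxy(1)]
    by (simp_all add: add.commute)
  have 2: "tensor_times dx dy \<in> taug 2 (Suc (j + k))" "tensor_times dy dx \<in> taug 2 (Suc (j + k))"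
    using taug_times[OF dxy(1) dxy(2)] taug_times[OF dxy(2) dxy(1)] taug_antimono[of "Suc (j + k)" "Suc (Suc (j + k))" 2]
    by (auto simp: add.commute)
  note lr = linear_tensor_pair(1)[of 1] and ll = linear_tensor_pair(2)[of 1]
  have XY: "tensor_times X Y - tensor_times Y X = tensor [x * y - y * x, 1] + tensor [1, x * y - y * x]"
    by (simp add: X_def Y_def b linear_diff[OF lr] linear_diff[OF ll])
  have "red (x * y - y * x)
    = tensor_times X dy + tensor_times dx Y + tensor_times dx dy
      - (tensor_times dy X + tensor_times Y dx + tensor_times dy dx)"
    unfolding linear_diff[OF linear_coproduct] coproduct_mult Dx Dy b
    using XY by (simp add: algebra_simps)
  also have "\<dots> \<in> taug 2 (Suc (j + k))"
    by (intro subspace_diff[OF subspace_taug] subspace_add[OF subspace_taug] 1 2)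
  finally have "red (x * y - y * x) \<in> taug 2 (Suc (j + k))" .
  moreover have "x * y - y * x \<in> aug (j + k)"
    using aug_mult[OF x(3) y(3)] aug_mult[OF y(3) x(3)]
    by (auto simp: add.commute intro: subspace_diff[OF subspace_aug])
  moreover have "x * y - y * x \<in> H (d + e)"
    using mult_graded[OF x(1) y(1)] mult_graded[OF y(1) x(1)]
    by (auto simp: add.commute intro: subspace_diff[OF subspace_H])
  ultimately show ?thesis using x(2) by (simp add: prim_def)
qed

lemma subspace_prim: "0 < d \<Longrightarrow> subspace (prim k d)"
proof -
  assume d: "0 < d"
  let ?f = "\<lambda>y. red y"
  note lr = linear_tensor_pair(1)[of 1] and ll = linear_tensor_pair(2)[of 1]
  have lin: "linear ?f" by (intro linear_compose_sub linear_coproduct lr ll)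
  have "subspace (?f -` taug 2 (Suc k))"
    using linear_subspace_vimage[OF lin subspace_taug] by (simp add: vimage_def)
  moreover have "prim k d = H d \<inter> aug k \<inter> (?f -` taug 2 (Suc k))"
    using d by (auto simp: prim_def)
  ultimately show ?thesis by (simp add: subspace_inter subspace_H subspace_aug)
qed

text \<open>The coproduct of a letter of positive degree lies in \<open>taug 2 1\<close>, and
  products add up the filtration indices.\<close>

lemma coproduct_hword: "hword w \<Longrightarrow> \<Delta> (eval_word w) \<in> taug 2 (length w)"
proof (induction w)
  case Nil
  show ?case using tensor_ones_in_taug[of 2] by (simp add: coproduct_one numeral_2_eq_2)
next
  case (Cons zd w)
  obtain z d where zd: "zd = (z, d)" by (cases zd)
  have z: "z \<in> H d" "0 < d" and w: "hword w" using Cons by (auto simp: zd)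
  have za: "z \<in> aug 1" using z H_subset_aug_1 by blast
  have "tensor [z, 1] \<in> taug 2 1" "tensor [1, z] \<in> taug 2 1"
    using aug_tensor_slot[OF za, of 0 1] aug_tensor_slot[OF za, of 1 0] by (simp_all add: numeral_2_eq_2)
  moreover have "red z \<in> taug 2 1"
    using coproduct_positive_degree[OF z] taug_antimono[of 1 2 2] by auto
  ultimately have "(red z) + tensor [z, 1] + tensor [1, z] \<in> taug 2 1"
    by (intro subspace_add[OF subspace_taug])
  then have "\<Delta> z \<in> taug 2 1" by simp
  from taug_times[OF this Cons.IH[OF w]] show ?case
    by (simp add: zd coproduct_mult)
qed

text \<open>Elements of the next power represent 0 in the graded piece, so they count as primitive.
  The generators are later chosen in a complement of them inside \<open>prim k d\<close>.\<close>

lemma aug_subset_prim: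
  assumes "y \<in> H d" "0 < d" "y \<in> aug (Suc k)"
  shows "y \<in> prim k d"
proof -
  have "\<Delta> y \<in> taug 2 (Suc k)"
    unfolding taug_def
  proof (rule linear_image_subset_span[OF linear_coproduct _ assms(3)[unfolded aug_def]], safe)
    fix w assume "hword w" "Suc k \<le> length w"
    then show "\<Delta> (eval_word w) \<in> span {tensor (map eval_word ws) | ws.
       length ws = 2 \<and> (\<forall>w\<in>set ws. hword w) \<and> Suc k \<le> length (concat ws)}"
      using coproduct_hword taug_antimono[of "Suc k" "length w" 2] unfolding taug_def by blast
  qed
  then have "red y \<in> taug 2 (Suc k)"
    using aug_tensor_slot[OF assms(3), of 0 1] aug_tensor_slot[OF assms(3), of 1 0]
    by (intro subspace_diff[OF subspace_taug]) (simp_all add: numeral_2_eq_2)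
  then show ?thesis using assms aug_antimono[of k "Suc k"] by (auto simp: prim_def)
qed

end

section \<open>Labellings\<close>

text \<open>A labelling sends the \<open>j\<close>-th letter of a word to the tensor slot
  \<open>cs ! j\<close>, and \<open>block i cs\<close> is the subword arriving in slot
  \<open>i\<close>, in its original order. Labellings index the leading terms of the iterated
  coproduct of a product.\<close>

definition labellings :: "nat \<Rightarrow> nat \<Rightarrow> nat list set" where
  "labellings l m = {cs. set cs \<subseteq> {..<l} \<and> length cs = m}"

definition block :: "nat \<Rightarrow> nat list \<Rightarrow> 'b list \<Rightarrow> 'b list" where
  "block i cs ys = map snd (filter (\<lambda>(c, y). c = i) (zip cs ys))"

lemma finite_labellings: "finite (labellings l m)"
  unfolding labellings_def by (rule finite_lists_length_eq) simp

lemma labellings_0 [simp]: "labellings l 0 = {[]}"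
  by (auto simp: labellings_def)

lemma sum_labellings_Suc:
  "(\<Sum>cs\<in>labellings l (Suc m). f cs) = (\<Sum>i<l. \<Sum>cs\<in>labellings l m. f (i # cs))"
proof -
  have "labellings l (Suc m) = (\<lambda>(i, cs). i # cs) ` ({..<l} \<times> labellings l m)"
    by (auto simp: labellings_def length_Suc_conv image_def)
  moreover have "inj_on (\<lambda>(i, cs). i # cs) ({..<l} \<times> labellings l m)"
    by (auto simp: inj_on_def)
  ultimately show ?thesis
    by (simp add: sum.reindex sum.cartesian_product case_prod_unfold)
qed

lemma block_Nil [simp]: "block i [] ys = []" "block i cs [] = []"
  by (auto simp: block_def)

lemma block_Cons [simp]: "block i (c # cs) (y # ys) = (if c = i then y # block i cs ys else block i cs ys)"
  by (simp add: block_def)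

lemma block_map: "block i cs (map f ys) = map f (block i cs ys)"
proof (induction cs arbitrary: ys)
  case (Cons c cs)
  then show ?case by (cases ys) auto
qed simp

lemma mset_concat_blocks:
  assumes "cs \<in> labellings l (length ys)"
  shows "mset (concat (map (\<lambda>i. block i cs ys) [0..<l])) = mset ys"
  using assms
proof (induction ys arbitrary: cs)
  case Nil
  then show ?case by (induction l) auto
next
  case (Cons y ys)
  then obtain c cs' where cs: "cs = c # cs'" "c < l" "cs' \<in> labellings l (length ys)"
    by (auto simp: labellings_def length_Suc_conv)
  have "mset (concat (map (\<lambda>i. block i cs (y # ys)) [0..<l]))
    = (\<Sum>i<l. mset (block i cs (y # ys)))" for cs and ys :: "'a list"
    by (simp add: mset_concat sum_list_sum_nth comp_def atLeast0LessThan)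
  note e = this
  have e': "mset (concat (map (\<lambda>i. block i cs ys) [0..<l])) = (\<Sum>i<l. mset (block i cs ys))" for cs
    by (simp add: mset_concat sum_list_sum_nth comp_def atLeast0LessThan)
  have "(\<Sum>i<l. mset (block i cs (y # ys))) = (\<Sum>i<l. (if i = c then {#y#} else {#}) + mset (block i cs' ys))"
    by (intro sum.cong) (auto simp: cs)
  also have "\<dots> = add_mset y (\<Sum>i<l. mset (block i cs' ys))"
    using cs(2) by (simp add: sum.distrib sum.delta)
  finally show ?case using Cons.IH[OF cs(3)] by (simp only: e e' mset.simps)
qed

section \<open>Iterated coproducts of products of primitive elements\<close>

context graded_connected_hopf_algebra
begin

text \<open>The level is recorded with the letter because it is not determined by it: an element of
  \<open>prim k d\<close> that lies in the next power may be a letter of level \<open>Suc k\<close>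
  as well.\<close>

definition pword :: "('a \<times> nat \<times> nat) list \<Rightarrow> bool" where
  "pword w \<longleftrightarrow> (\<forall>(z, k, d)\<in>set w. z \<in> prim k d)"

abbreviation level :: "('a \<times> nat \<times> nat) list \<Rightarrow> nat" where
  "level w \<equiv> sum_list (map (\<lambda>p. fst (snd p)) w)"

abbreviation degr :: "('a \<times> nat \<times> nat) list \<Rightarrow> nat" where
  "degr w \<equiv> sum_list (map (\<lambda>p. snd (snd p)) w)"

lemma pword_simps [simp]:
  "pword []" "pword ((z, k, d) # w) \<longleftrightarrow> z \<in> prim k d \<and> pword w"
  "pword (v @ w) \<longleftrightarrow> pword v \<and> pword w"
  by (simp_all add: pword_def ball_Un)

lemma pword_degree: "pword w \<Longrightarrow> eval_word w \<in> H (degr w)"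
  by (induction w) (auto simp: prim_def one_in_H0 intro: mult_graded)

lemma pword_level: "pword w \<Longrightarrow> eval_word w \<in> aug (level w)"
proof (induction w)
  case Nil
  then show ?case using hword_in_aug[of "[]" 0] by simp
next
  case (Cons a w)
  then show ?case by (cases a) (auto simp: prim_def intro: aug_mult)
qed

lemma pword_length: "pword w \<Longrightarrow> length w \<le> degr w"
  by (induction w) (auto simp: prim_def)

definition slot :: "nat \<Rightarrow> nat \<Rightarrow> 'a \<Rightarrow> 'a list" where
  "slot l i y = map (\<lambda>j. if j = i then y else 1) [0..<l]"

lemma slot_eq: "i < l \<Longrightarrow> slot l i y = replicate i 1 @ y # replicate (l - 1 - i) 1"
  by (intro nth_equalityI) (auto simp: slot_def nth_append nth_Cons')

lemma slot_in_taug: "y \<in> aug k \<Longrightarrow> i < l \<Longrightarrow> tensor (slot l i y) \<in> taug l k"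
  using aug_tensor_slot[of y k i "l - 1 - i"] by (simp add: slot_eq)

lemma linear_coproduct_first: "linear (split_first l)"
  by (rule linear_tensor_maps) (auto simp: linear_coproduct linear_tensor1 in_set_replicate)

lemma coproduct_first_tensor:
  "length zs = l \<Longrightarrow> split_first l (tensor (z # zs)) = \<Delta> z \<otimes>\<^sub>T tensor zs"
proof -
  assume l: "length zs = l"
  have "foldr (\<otimes>\<^sub>T) (map2 (\<lambda>f x. f x) (replicate l tensor1) zs) (tensor []) = tensor zs"
    using l by (induction zs arbitrary: l) (auto simp: tensor1_def)
  then show ?thesis
    using l by (subst tensor_maps_tensor) (auto simp: linear_coproduct linear_tensor1)
qed

lemma iterated_coproduct_Suc_Suc:
  "cop (Suc (Suc l)) x
    = split_first l (cop (Suc l) x)"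
  by simp

lemma linear_iterated_coproduct: "linear (cop l)"
proof (cases l)
  case 0
  then show ?thesis
    by (auto intro!: linearI simp: linear_add[OF linear_counit] linear_scale[OF linear_counit] scaleR_add_left)
next
  case (Suc k)
  have "linear (cop (Suc k))"
  proof (induction k)
    case 0
    have "cop (Suc 0) = tensor1" by (intro ext) simp
    then show ?case by (simp add: linear_tensor1)
  next
    case (Suc k)
    have "cop (Suc (Suc k))
      = split_first k \<circ> cop (Suc k)"
      by (intro ext) simp
    then show ?case using linear_compose[OF Suc linear_coproduct_first] by metis
  qed
  then show ?thesis by (simp only: Suc)
qed

lemma iterated_coproduct_one: "cop l 1 = tensor (replicate l 1)"
proof (cases l)
  case 0
  then show ?thesis by (simp add: counit_one)
next
  case (Suc k)
  have "cop (Suc k) 1 = tensor (replicate (Suc k) 1)"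
  proof (induction k)
    case (Suc k)
    then show ?case
      by (simp only: iterated_coproduct_Suc_Suc) (simp add: coproduct_first_tensor coproduct_one)
  qed (simp add: tensor1_def)
  then show ?thesis by (simp only: Suc)
qed

lemma coproduct_in_span: "\<Delta> x \<in> span {tensor xs | xs. length xs = 2}"
proof -
  have *: "\<Delta> y \<in> span {tensor xs | xs. length xs = 2}" if "y \<in> H n" for y n
    using coproduct_graded[OF that] by (rule rev_subsetD) (rule span_mono, force)
  then have "(\<Sum>n | hcomp n x \<noteq> 0. \<Delta> (hcomp n x))
      \<in> span {tensor xs | xs. length xs = 2}"
    by (intro span_sum) (rule *, rule component_in)
  then show ?thesis
    by (subst sum_components[of x, symmetric]) (simp only: linear_sum[OF linear_coproduct])
qed

lemma iterated_coproduct_in_span: "cop l x \<in> span {tensor xs | xs. length xs = l}"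
proof (cases l)
  case 0
  then show ?thesis by (auto intro!: span_scale intro: span_base)
next
  case (Suc k)
  have "cop (Suc k) x \<in> span {tensor xs | xs. length xs = Suc k}"
  proof (induction k)
    case 0
    show ?case by (intro span_base CollectI exI[of _ "[x]"]) (simp add: tensor1_def)
  next
    case (Suc k)
    show ?case
      unfolding iterated_coproduct_Suc_Suc
    proof (rule linear_image_subset_span[OF linear_coproduct_first _ Suc], safe)
      fix xs :: "'a list" assume "length xs = Suc k"
      then obtain z zs where xs: "xs = z # zs" "length zs = k" by (auto simp: length_Suc_conv)
      have "\<Delta> z \<otimes>\<^sub>T tensor zs \<in> span {tensor xs | xs. length xs = Suc (Suc k)}"
      proof (rule linear_image_subset_span[OF bilinear_left[OF bilinear_tensor_append] _ coproduct_in_span], safe)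
        fix ys :: "'a list" assume "length ys = 2"
        then show "tensor ys \<otimes>\<^sub>T tensor zs \<in> span {tensor xs | xs. length xs = Suc (Suc k)}"
          using xs by (intro span_base CollectI exI[of _ "ys @ zs"]) simp
      qed
      then show "split_first k (tensor xs) \<in> span {tensor xs | xs. length xs = Suc (Suc k)}"
        using xs by (simp add: coproduct_first_tensor)
    qed
  qed
  then show ?thesis by (simp only: Suc)
qed

lemma coproduct_first_times:
  assumes "s \<in> span {tensor xs | xs. length xs = Suc l}" "t \<in> span {tensor xs | xs. length xs = Suc l}"
  shows "split_first l (tensor_times s t)
    = tensor_times (split_first l s) (split_first l t)"
proof -
  let ?L = "split_first l"
  note L = linear_coproduct_first
  note b = bilinear_tensor_times
  have pure: "?L (tensor_times (tensor xs) (tensor ys)) = tensor_times (?L (tensor xs)) (?L (tensor ys))"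
    if len: "length xs = Suc l" "length ys = Suc l" for xs ys
  proof -
    obtain u us v vs where xs: "xs = u # us" "length us = l" "ys = v # vs" "length vs = l"
      using len by (auto simp: length_Suc_conv)
    then show ?thesis
      by (simp add: coproduct_first_tensor coproduct_mult tensor_times_append[OF coproduct_in_span coproduct_in_span])
  qed
  have 1: "?L (tensor_times s (tensor ys)) = tensor_times (?L s) (?L (tensor ys))" if "length ys = Suc l" for ys
    by (rule linear_eq_on_span[OF linear_compose2[OF L bilinear_left[OF b]] linear_compose2[OF bilinear_left[OF b] L] _ assms(1)])
      (use that pure in auto)
  show ?thesis
    by (rule linear_eq_on_span[OF linear_compose2[OF L bilinear_right[OF b]] linear_compose2[OF bilinear_right[OF b] L] _ assms(2)])
      (use 1 in auto)
qed

lemma iterated_coproduct_mult: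
  "cop l (x * y) = tensor_times (cop l x) (cop l y)"
proof (cases l)
  case 0
  then show ?thesis
    by (simp add: counit_mult bilinear_lmul[OF bilinear_tensor_times] bilinear_rmul[OF bilinear_tensor_times])
next
  case (Suc k)
  have "cop (Suc k) (x * y)
    = tensor_times (cop (Suc k) x) (cop (Suc k) y)"
  proof (induction k)
    case (Suc k)
    show ?case
      by (simp only: iterated_coproduct_Suc_Suc Suc coproduct_first_times[OF iterated_coproduct_in_span iterated_coproduct_in_span])
  qed (simp add: tensor1_def)
  then show ?thesis by (simp only: Suc)
qed

lemma coproduct_first_taug:
  assumes "t \<in> taug (Suc l) K"
  shows "split_first l t \<in> taug (Suc (Suc l)) K"
  unfolding taug_def
proof (rule linear_image_subset_span[OF linear_coproduct_first _ assms[unfolded taug_def]], clarify)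
  fix ws assume ws: "length ws = Suc l" "\<forall>w\<in>set ws. hword w" "K \<le> length (concat ws)"
  then obtain v vs where v: "ws = v # vs" "length vs = l" by (auto simp: length_Suc_conv)
  have "\<Delta> (eval_word v) \<otimes>\<^sub>T tensor (map eval_word vs) \<in> taug (2 + l) (length v + length (concat vs))"
    using ws v by (intro taug_append coproduct_hword hwords_in_taug) auto
  then have "\<Delta> (eval_word v) \<otimes>\<^sub>T tensor (map eval_word vs) \<in> taug (Suc (Suc l)) K"
    using ws v taug_antimono[of K "length v + length (concat vs)" "Suc (Suc l)"] by auto
  then show "split_first l (tensor (map eval_word ws)) \<in>
    span {tensor (map eval_word ws) | ws. length ws = Suc (Suc l) \<and> (\<forall>w\<in>set ws. hword w) \<and> K \<le> length (concat ws)}"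
    using v by (simp add: coproduct_first_tensor taug_def)
qed

text \<open>Applying \<open>\<Delta>\<close> to the first slot splits the term with \<open>y\<close>
  in slot 0 into those with \<open>y\<close> in slots 0 and 1, up to \<open>red y\<close>, and moves
  the others one slot to the right, because \<open>\<Delta> 1\<close> is
  \<open>1 \<otimes> 1\<close>. For \<open>l = 0\<close> the sum is empty and the counit vanishes in
  positive degree.\<close>

lemma iterated_coproduct_prim:
  assumes "y \<in> prim k d"
  shows "cop l y - (\<Sum>i<l. tensor (slot l i y)) \<in> taug l (Suc k)"
proof (cases l)
  case 0
  then show ?thesis using assms counit_graded[of y d] subspace_0[OF subspace_taug] by (simp add: prim_def)
next
  case (Suc n)
  have "cop (Suc n) y - (\<Sum>i<Suc n. tensor (slot (Suc n) i y)) \<in> taug (Suc n) (Suc k)"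
  proof (induction n)
    case 0
    show ?case using subspace_0[OF subspace_taug] by (simp add: slot_def tensor1_def)
  next
    case (Suc n)
    let ?L = "split_first n"
    note L = linear_coproduct_first[of n]
    have s0: "?L (tensor (slot (Suc n) 0 y)) = \<Delta> y \<otimes>\<^sub>T tensor (replicate n 1)"
      by (simp add: slot_eq coproduct_first_tensor)
    have sS: "?L (tensor (slot (Suc n) (Suc i) y)) = tensor (slot (Suc (Suc n)) (Suc (Suc i)) y)" if "i < n" for i
      using that by (simp add: slot_eq coproduct_first_tensor coproduct_one)
    have sS': "(\<Sum>i<n. ?L (tensor (slot (Suc n) (Suc i) y)))
      = (\<Sum>i<n. tensor (slot (Suc (Suc n)) (Suc (Suc i)) y))"
      by (rule sum.cong) (simp_all only: lessThan_iff sS)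
    let ?r = "red y"
    have r: "?r \<in> taug 2 (Suc k)" using assms by (simp add: prim_def)
    have "?r \<otimes>\<^sub>T tensor (replicate n 1) \<in> taug (2 + n) (Suc k + 0)"
      by (rule taug_append[OF r tensor_ones_in_taug])
    moreover have "?r \<otimes>\<^sub>T tensor (replicate n 1) = \<Delta> y \<otimes>\<^sub>T tensor (replicate n 1)
      - tensor (slot (Suc (Suc n)) 0 y) - tensor (slot (Suc (Suc n)) 1 y)"
      by (simp add: bilinear_lsub[OF bilinear_tensor_append] slot_eq)
    ultimately have r': "\<Delta> y \<otimes>\<^sub>T tensor (replicate n 1)
      - tensor (slot (Suc (Suc n)) 0 y) - tensor (slot (Suc (Suc n)) 1 y) \<in> taug (Suc (Suc n)) (Suc k)" by simp
    have "?L (cop (Suc n) y - (\<Sum>i<Suc n. tensor (slot (Suc n) i y)))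
      = cop (Suc (Suc n)) y - (\<Delta> y \<otimes>\<^sub>T tensor (replicate n 1)
        + (\<Sum>i<n. tensor (slot (Suc (Suc n)) (Suc (Suc i)) y)))"
      by (simp only: linear_diff[OF L] linear_add[OF L] linear_sum[OF L] sum.lessThan_Suc_shift s0 sS' iterated_coproduct_Suc_Suc)
    also have "\<dots> = cop (Suc (Suc n)) y - (\<Sum>i<Suc (Suc n). tensor (slot (Suc (Suc n)) i y))
      - (\<Delta> y \<otimes>\<^sub>T tensor (replicate n 1)
      - tensor (slot (Suc (Suc n)) 0 y) - tensor (slot (Suc (Suc n)) 1 y))"
      by (simp only: sum.lessThan_Suc_shift One_nat_def) simp
    finally have e: "cop (Suc (Suc n)) y - (\<Sum>i<Suc (Suc n). tensor (slot (Suc (Suc n)) i y))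
      = ?L (cop (Suc n) y - (\<Sum>i<Suc n. tensor (slot (Suc n) i y)))
      + (\<Delta> y \<otimes>\<^sub>T tensor (replicate n 1)
      - tensor (slot (Suc (Suc n)) 0 y) - tensor (slot (Suc (Suc n)) 1 y))"
      by (simp only: diff_add_cancel)
    show ?case
      unfolding e by (intro subspace_add[OF subspace_taug] r' coproduct_first_taug Suc.IH)
  qed
  then show ?thesis by (simp only: Suc)
qed

text \<open>Multiplying out the leading parts of the letters picks one slot for each letter, that
  is, a labelling. The bound on the whole coproduct is carried along because the error of a new
  letter gets multiplied by it.\<close>

lemma iterated_coproduct_pword:
  assumes "pword w"
  shows "cop l (eval_word w) \<in> taug l (level w)" (is ?A)
    and "cop l (eval_word w)
      - (\<Sum>cs\<in>labellings l (length w). tensor (map (\<lambda>i. eval_word (block i cs w)) [0..<l]))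
      \<in> taug l (Suc (level w))" (is ?B)
proof -
  have "?A \<and> ?B" using assms
  proof (induction w)
    case Nil
    have "(\<Sum>cs\<in>labellings l (length []). tensor (map (\<lambda>i. eval_word (block i cs ([] :: ('a \<times> nat \<times> nat) list))) [0..<l]))
      = tensor (replicate l 1)"
      by (simp add: map_replicate_trivial)
    then show ?case using tensor_ones_in_taug[of l] subspace_0[OF subspace_taug]
      by (simp add: iterated_coproduct_one)
  next
    case (Cons yk w)
    obtain y k d where yk: "yk = (y, k, d)" by (cases yk)
    have y: "y \<in> prim k d" and w: "pword w" using Cons.prems by (auto simp: yk)
    let ?D = "cop l"
    let ?m = "length w"
    let ?bl = "\<lambda>cs w. map (\<lambda>i. eval_word (block i cs w)) [0..<l]"
    define A where "A = (\<Sum>i<l. tensor (slot l i y))"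
    define B where "B = (\<Sum>cs\<in>labellings l ?m. tensor (?bl cs w))"
    define a where "a = ?D y - A"
    define b where "b = ?D (eval_word w) - B"
    have a: "a \<in> taug l (Suc k)" using iterated_coproduct_prim[OF y, of l] by (simp add: a_def A_def)
    have A: "A \<in> taug l k"
      unfolding A_def using y by (intro subspace_sum[OF subspace_taug] slot_in_taug) (auto simp: prim_def)
    have Dw: "?D (eval_word w) \<in> taug l (level w)" and b: "b \<in> taug l (Suc (level w))"
      using Cons.IH[OF w] by (auto simp: b_def B_def)
    have Dy: "?D y \<in> taug l k"
    proof -
      have "a + A \<in> taug l k"
        using a A taug_antimono[of k "Suc k" l] by (intro subspace_add[OF subspace_taug]) auto
      then show ?thesis by (simp add: a_def)
    qed
    have lv: "level (yk # w) = k + level w" and ev: "eval_word (yk # w) = y * eval_word w" by (simp_all add: yk)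
    have 1: "?D (eval_word (yk # w)) \<in> taug l (level (yk # w))"
      unfolding lv ev iterated_coproduct_mult by (rule taug_times[OF Dy Dw])
    have blk: "map2 (*) (slot l i y) (?bl cs w) = ?bl (i # cs) (yk # w)" for i cs
      by (intro nth_equalityI) (auto simp: slot_def yk)
    have AB: "tensor_times A B
      = (\<Sum>cs\<in>labellings l (length (yk # w)). tensor (?bl cs (yk # w)))"
    proof -
      have "tensor_times A B = (\<Sum>i<l. \<Sum>cs\<in>labellings l ?m. tensor_times (tensor (slot l i y)) (tensor (?bl cs w)))"
        unfolding A_def B_def
        by (simp only: bilinear_sum[OF bilinear_tensor_times] sum.cartesian_product)
      also have "\<dots> = (\<Sum>i<l. \<Sum>cs\<in>labellings l ?m. tensor (?bl (i # cs) (yk # w)))"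
        by (intro sum.cong refl) (simp only: tensor_times_tensor blk, simp add: slot_def)
      also have "\<dots> = (\<Sum>cs\<in>labellings l (length (yk # w)). tensor (?bl cs (yk # w)))"
        by (simp only: list.size add_0_right sum_labellings_Suc add_Suc_right)
      finally show ?thesis .
    qed
    have "?D (eval_word (yk # w)) - tensor_times A B = tensor_times a (?D (eval_word w)) + tensor_times A b"
    proof -
      have "?D (eval_word (yk # w)) = tensor_times (a + A) (?D (eval_word w))"
        unfolding ev iterated_coproduct_mult by (simp add: a_def)
      also have "\<dots> = tensor_times a (?D (eval_word w)) + tensor_times A (b + B)"
        unfolding bilinear_ladd[OF bilinear_tensor_times] by (simp add: b_def)
      also have "\<dots> = tensor_times a (?D (eval_word w)) + tensor_times A b + tensor_times A B"
        unfolding bilinear_radd[OF bilinear_tensor_times] by simp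
      finally show ?thesis by simp
    qed
    also have "\<dots> \<in> taug l (Suc (k + level w))"
      using taug_times[OF a Dw] taug_times[OF A b] by (intro subspace_add[OF subspace_taug]) simp_all
    finally show ?case using 1 unfolding AB lv by blast
  qed
  then show ?A ?B by blast+
qed

section \<open>Commuting primitive elements\<close>

definition shorter :: "nat \<Rightarrow> nat \<Rightarrow> nat \<Rightarrow> 'a set" where
  "shorter k m n = span {eval_word w | w. pword w \<and> level w = k \<and> length w < m \<and> degr w = n}"

lemma subspace_shorter: "subspace (shorter k m n)"
  by (simp add: shorter_def)

lemma pword_shorter: "pword w \<Longrightarrow> length w < m \<Longrightarrow> eval_word w \<in> shorter (level w) m (degr w)"
  unfolding shorter_def by (rule span_base) blast

lemma shorter_mult:
  assumes "pword u" "x \<in> shorter k m n"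
  shows "eval_word u * x \<in> shorter (level u + k) (length u + m) (degr u + n)"
    and "x * eval_word u \<in> shorter (level u + k) (length u + m) (degr u + n)"
proof -
  show "eval_word u * x \<in> shorter (level u + k) (length u + m) (degr u + n)"
    unfolding shorter_def
  proof (rule linear_image_subset_span[OF bilinear_right[OF bilinear_times] _ assms(2)[unfolded shorter_def]], safe)
    fix w assume "pword w" "length w < m"
    then show "eval_word u * eval_word w \<in> span {eval_word w' | w'. pword w' \<and>
      level w' = level u + level w \<and> length w' < length u + m \<and> degr w' = degr u + degr w}"
      using assms(1) by (intro span_base CollectI exI[of _ "u @ w"]) auto
  qed
  show "x * eval_word u \<in> shorter (level u + k) (length u + m) (degr u + n)"
    unfolding shorter_def
  proof (rule linear_image_subset_span[OF bilinear_left[OF bilinear_times] _ assms(2)[unfolded shorter_def]], safe)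
    fix w assume "pword w" "length w < m"
    then show "eval_word w * eval_word u \<in> span {eval_word w' | w'. pword w' \<and>
      level w' = level u + level w \<and> length w' < length u + m \<and> degr w' = degr u + degr w}"
      using assms(1) by (intro span_base CollectI exI[of _ "w @ u"]) auto
  qed
qed

text \<open>A commutator of two letters is again a primitive letter, of the summed level and degree.
  Each exchange therefore costs a word of the same level with one letter less.\<close>

lemma pword_move:
  assumes "z \<in> prim k d" "pword w"
  shows "z * eval_word w - eval_word w * z \<in> shorter (k + level w) (Suc (length w)) (d + degr w)"
  using assms(2)
proof (induction w)
  case Nil
  then show ?case using subspace_0[OF subspace_shorter] by simp
next
  case (Cons a w)
  obtain y j e where a: "a = (y, j, e)" by (cases a)
  have y: "y \<in> prim j e" and w: "pword w" using Cons.prems by (auto simp: a)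
  have "pword [(z * y - y * z, k + j, d + e)]" using prim_commutator[OF assms(1) y] by simp
  from pword_shorter[OF this, of 2]
  have "z * y - y * z \<in> shorter (k + j) 2 (d + e)" by simp
  from shorter_mult(2)[OF w this]
  have 1: "(z * y - y * z) * eval_word w \<in> shorter (k + level (a # w)) (Suc (length (a # w))) (d + degr (a # w))"
    by (simp add: a ac_simps)
  have "pword [(y, j, e)]" using y by simp
  from shorter_mult(1)[OF this Cons.IH[OF w]]
  have 2: "y * (z * eval_word w - eval_word w * z)
    \<in> shorter (k + level (a # w)) (Suc (length (a # w))) (d + degr (a # w))"
    by (simp add: a ac_simps)
  have "z * eval_word (a # w) - eval_word (a # w) * z
    = (z * y - y * z) * eval_word w + y * (z * eval_word w - eval_word w * z)"
    by (simp add: a algebra_simps)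
  then show ?case using subspace_add[OF subspace_shorter 1 2] by simp
qed

text \<open>The first letter of \<open>v\<close> is located in \<open>w\<close> and moved to the
  front at the cost of shorter words; the remaining letters are handled by induction.\<close>

lemma pword_permute:
  assumes "pword v" "mset v = mset w"
  shows "eval_word v - eval_word w \<in> shorter (level v) (length v) (degr v)"
  using assms
proof (induction v arbitrary: w)
  case Nil
  then show ?case using subspace_0[OF subspace_shorter] by simp
next
  case (Cons a v)
  obtain z k d where a: "a = (z, k, d)" by (cases a)
  have z: "z \<in> prim k d" and v: "pword v" using Cons.prems by (auto simp: a)
  have "a \<in> set w" using Cons.prems(2) by (metis list.set_intros(1) mset_eq_setD)
  then obtain us ws where w: "w = us @ a # ws" by (auto simp: in_set_conv_decomp)
  have m: "mset v = mset (us @ ws)" using Cons.prems(2) by (simp add: w)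
  have p: "pword us" "pword ws" using v mset_eq_setD[OF m] by (auto simp: pword_def)
  have len: "length v = length us + length ws" using mset_eq_length[OF m] by simp
  have lv: "level v = level us + level ws" and dg: "degr v = degr us + degr ws"
    using arg_cong[OF m, of "\<lambda>M. sum_mset (image_mset (\<lambda>p. fst (snd p)) M)"]
      arg_cong[OF m, of "\<lambda>M. sum_mset (image_mset (\<lambda>p. snd (snd p)) M)"]
    by (simp_all add: sum_mset_sum_list flip: mset_map)
  have "pword [a]" using z by (simp add: a)
  from shorter_mult(1)[OF this Cons.IH[OF v m]]
  have 1: "z * (eval_word v - eval_word (us @ ws)) \<in> shorter (level (a # v)) (length (a # v)) (degr (a # v))"
    by (simp add: a)
  have 2: "(z * eval_word us - eval_word us * z) * eval_word ws \<in> shorter (level (a # v)) (length (a # v)) (degr (a # v))"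
    using shorter_mult(2)[OF p(2) pword_move[OF z p(1)]] by (simp add: a len lv dg ac_simps)
  have "eval_word (a # v) - eval_word w
    = z * (eval_word v - eval_word (us @ ws)) + (z * eval_word us - eval_word us * z) * eval_word ws"
    by (simp add: a w algebra_simps)
  then show ?case using subspace_add[OF subspace_shorter 1 2] by simp
qed

end

section \<open>Generators adapted to the filtration and the involution\<close>

lemma basis_of_complement:
  fixes U W :: "'a::real_vector set"
  assumes U: "subspace U" and W: "subspace W" and UW: "U \<subseteq> W"
  shows "\<exists>X\<subseteq>W. W \<subseteq> span (X \<union> U) \<and> (\<forall>x\<in>X. x \<notin> span (U \<union> (X - {x})))"
proof -
  obtain B where B: "B \<subseteq> U" "independent B" "U \<subseteq> span B"
    using maximal_independent_subset[of U] by metis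
  have "B \<subseteq> W" using B(1) UW by (rule subset_trans)
  then obtain C where C: "B \<subseteq> C" "C \<subseteq> W" "independent C" "W \<subseteq> span C"
    using maximal_independent_subset_extend[of B W] B(2) by metis
  have "C \<subseteq> (C - B) \<union> U" using B(1) by blast
  then have "W \<subseteq> span ((C - B) \<union> U)" using C(4) span_mono subset_trans by metis
  moreover have "x \<notin> span (U \<union> (C - B - {x}))" if x: "x \<in> C - B" for x
  proof
    assume a: "x \<in> span (U \<union> (C - B - {x}))"
    have "B \<subseteq> C - {x}" using C(1) x by blast
    then have "U \<subseteq> span (C - {x})" using B(3) span_mono subset_trans by metis
    moreover have "C - B - {x} \<subseteq> span (C - {x})" by (auto intro: span_base)
    ultimately have "span (U \<union> (C - B - {x})) \<subseteq> span (C - {x})"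
      by (intro span_minimal subspace_span) simp
    then show False using C(3) x a by (auto simp: dependent_def)
  qed
  moreover have "C - B \<subseteq> W" using C(2) by blast
  ultimately show ?thesis by (intro exI[of _ "C - B"] conjI ballI)
qed

text \<open>An involution splits both spaces into eigenspaces for 1 and -1, and a complement is
  chosen in each. Independence of the union modulo \<open>U\<close> follows by projecting to one
  eigenspace, which kills the basis vectors chosen in the other.\<close>

lemma eigenbasis_of_complement:
  fixes U W :: "'a::real_vector set" and t :: "'a \<Rightarrow> 'a"
  assumes U: "subspace U" and W: "subspace W" and UW: "U \<subseteq> W"
    and t: "linear t" "\<And>x. t (t x) = x" "t ` U \<subseteq> U" "t ` W \<subseteq> W"
  shows "\<exists>X\<subseteq>W. W \<subseteq> span (X \<union> U) \<and> (\<forall>x\<in>X. (t x = x \<or> t x = - x) \<and> x \<notin> span (U \<union> (X - {x})))"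
proof -
  interpret linear t by fact
  \<comment> \<open>For \<open>s\<close> equal to 1 or -1, \<open>P s\<close> cuts out the
    eigenspace and \<open>p s\<close> is the projection onto it.\<close>
  define P where "P s V = {v\<in>V. t v = s *\<^sub>R v}" for s :: real and V
  define p where "p s v = (1/2) *\<^sub>R (v + s *\<^sub>R t v)" for s :: real and v
  have sP: "subspace (P s V)" if "subspace V" for s V
    using that by (auto simp: P_def subspace_def add scale zero scaleR_add_right)
  have lp: "linear (p s)" for s
    unfolding p_def by (intro linear_compose_scale_right linear_compose_add linear_ident t(1))
  have pP: "p s ` V \<subseteq> P s V" if "subspace V" "t ` V \<subseteq> V" "s * s = 1" for s V
  proof
    fix y assume "y \<in> p s ` V"
    then obtain v where v: "v \<in> V" "y = p s v" by blast
    have "t (p s v) = s *\<^sub>R p s v"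
      using that(3) by (simp add: p_def add scale t(2) scaleR_add_right)
    moreover have "p s v \<in> V"
      using v that unfolding p_def by (intro subspace_scale subspace_add) auto
    ultimately show "y \<in> P s V" using v by (simp add: P_def)
  qed
  have "\<exists>X\<subseteq>P s W. P s W \<subseteq> span (X \<union> P s U) \<and> (\<forall>x\<in>X. x \<notin> span (P s U \<union> (X - {x})))" for s
    using UW by (intro basis_of_complement sP U W) (auto simp: P_def)
  then obtain X where X: "\<And>s. X s \<subseteq> P s W" "\<And>s. P s W \<subseteq> span (X s \<union> P s U)"
    "\<And>s. \<forall>x\<in>X s. x \<notin> span (P s U \<union> (X s - {x}))" by metis
  let ?X = "X 1 \<union> X (-1)"
  have "W \<subseteq> span (?X \<union> U)"
  proof
    fix w assume w: "w \<in> W"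
    have "p s w \<in> span (?X \<union> U)" if "s = 1 \<or> s = -1" for s
    proof -
      have "s * s = 1" using that by auto
      then have "p s w \<in> P s W" using pP[OF W t(4), of s] w by blast
      moreover have "span (X s \<union> P s U) \<subseteq> span (?X \<union> U)"
        using that by (intro span_mono) (auto simp: P_def)
      ultimately show ?thesis using X(2) by blast
    qed
    from span_add[OF this[of 1] this[of "-1"]] have "p 1 w + p (-1) w \<in> span (?X \<union> U)" by simp
    moreover have "p 1 w + p (-1) w = (1/2) *\<^sub>R (w + w)"
      by (simp add: p_def scaleR_add_right scaleR_diff_right)
    ultimately show "w \<in> span (?X \<union> U)" by (simp only: scaleR_half_double)
  qed
  moreover have "x \<notin> span (U \<union> (?X - {x}))" if x: "x \<in> X s" and s: "s = 1 \<or> s = -1" for x s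
  proof
    assume a: "x \<in> span (U \<union> (?X - {x}))"
    have ss: "s * s = 1" using s by auto
    have px: "p s y = (if r = s then y else 0)" if "y \<in> X r" "r = 1 \<or> r = -1" for y r
    proof -
      have "t y = r *\<^sub>R y" using X(1)[of r] that by (auto simp: P_def)
      then show ?thesis using that(2) s by (auto simp: p_def simp flip: scaleR_2)
    qed
    have "p s x \<in> span (P s U \<union> (X s - {x}))"
    proof (rule linear_image_subset_span[OF lp _ a])
      fix y assume "y \<in> U \<union> (?X - {x})"
      then consider "y \<in> U" | r where "y \<in> X r" "r = 1 \<or> r = -1" "y \<noteq> x" by blast
      then show "p s y \<in> span (P s U \<union> (X s - {x}))"
      proof cases
        case 1
        then show ?thesis using pP[OF U t(3) ss] by (intro span_base) auto
      next
        case 2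
        then show ?thesis by (auto simp: px span_zero intro: span_base)
      qed
    qed
    then show False using X(3)[of s] x px[OF x s] by simp
  qed
  moreover have "t x = x \<or> t x = - x" "x \<in> W" if "x \<in> ?X" for x
    using that X(1)[of 1] X(1)[of "-1"] by (auto simp: P_def)
  ultimately show ?thesis by (intro exI[of _ ?X]) blast
qed

text \<open>A Hamel basis is used since \<open>S\<close> will contain a whole
  \<open>aug (Suc k)\<close>, which extends over all degrees.\<close>

lemma exists_separating_functional:
  fixes x :: "'a::real_vector"
  assumes "x \<notin> span S"
  shows "\<exists>f :: 'a \<Rightarrow> real. linear f \<and> f x = 1 \<and> (\<forall>y\<in>S. f y = 0)"
proof -
  obtain B where B: "B \<subseteq> S" "independent B" "S \<subseteq> span B"
    using maximal_independent_subset by metis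
  have "x \<notin> span B" using assms span_mono[OF B(1)] by blast
  then have "independent (insert x B)" using B(2) by (simp add: independent_insert)
  from linear_independent_extend[OF this, of "\<lambda>y. if y = x then 1 else 0"]
  obtain f :: "'a \<Rightarrow> real" where f: "linear f" "\<forall>y\<in>insert x B. f y = (if y = x then 1 else 0)" by blast
  have "x \<notin> B" using \<open>x \<notin> span B\<close> span_base by blast
  then have "f y = 0" if "y \<in> B" for y using f(2) that by auto
  then have "f y = 0" if "y \<in> span B" for y using linear_eq_0_on_span[OF f(1)] that by blast
  then show ?thesis using f B(3) by (intro exI[of _ f]) auto
qed

lemma multilinear_swap:
  "multilinear (\<lambda>xs :: 'a::real_vector list. if length xs = 2 then tensor (rev xs) else 0)"
proof (rule multilinear_if_length)
  show "multilinear (\<lambda>xs :: 'a list. tensor (rev xs))"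
    unfolding multilinear_def
  proof (intro conjI allI)
    fix xs ys :: "'a list" and a b :: 'a and c :: real
    show "tensor (rev (xs @ (a + b) # ys)) = tensor (rev (xs @ a # ys)) + tensor (rev (xs @ b # ys))"
      using multilinear_tensor[unfolded multilinear_def, THEN conjunct1, rule_format, of "rev ys" a b "rev xs"] by simp
    show "tensor (rev (xs @ (c *\<^sub>R a) # ys)) = c *\<^sub>R tensor (rev (xs @ a # ys))"
      using multilinear_tensor[unfolded multilinear_def, THEN conjunct2, rule_format, of "rev ys" c a "rev xs"] by simp
  qed
qed

lemma linear_tensor_swap: "linear tensor_swap"
  unfolding tensor_swap_def by (rule linear_tensor_lift[OF multilinear_swap])

lemma tensor_swap_tensor: "tensor_swap (tensor [x, y]) = tensor [y, x]"
  unfolding tensor_swap_def by (simp add: tensor_lift_tensor[OF multilinear_swap])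

section \<open>The involution and its action on the filtration\<close>

locale hopf_involution = graded_connected_hopf_algebra H \<Delta> \<epsilon>
  for H :: "nat \<Rightarrow> 'a::real_algebra_1 set" and \<Delta> \<epsilon> +
  fixes \<tau> :: "'a \<Rightarrow> 'a"
  assumes fin_dim: "finite_dimensional_set (H n)"
    and tau_linear: "linear \<tau>"
    and tau_graded: "\<tau> ` H n \<subseteq> H n"
    and tau_involution: "\<tau> \<circ> \<tau> = id"
    and tau_ambimorphism: "hopf_ambimorphism \<Delta> \<tau>"
begin

lemma tau_tau [simp]: "\<tau> (\<tau> x) = x"
  using fun_cong[OF tau_involution, of x] by simp

lemma tau_in_H: "x \<in> H n \<Longrightarrow> \<tau> x \<in> H n"
  using tau_graded by blast

lemma tau_mult: "(\<forall>w z. \<tau> (w * z) = \<tau> w * \<tau> z) \<or> (\<forall>w z. \<tau> (w * z) = \<tau> z * \<tau> w)"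
  using tau_ambimorphism by (simp add: hopf_ambimorphism_def)

lemma tau_one [simp]: "\<tau> 1 = 1"
  using tau_mult by (metis mult.left_neutral mult.right_neutral tau_tau)

text \<open>A common notation for algebra morphisms and antimorphisms. Reversal preserves the
  multiset of letters, and reordering letters only produces lower terms.\<close>

definition rev_if :: "'b list \<Rightarrow> 'b list" where
  "rev_if = (if \<forall>w z. \<tau> (w * z) = \<tau> w * \<tau> z then id else rev)"

lemma mset_rev_if [simp]: "mset (rev_if xs) = mset xs"
  by (simp add: rev_if_def)

lemma set_rev_if [simp]: "set (rev_if xs) = set xs"
  by (simp add: rev_if_def)

lemma length_rev_if [simp]: "length (rev_if xs) = length xs"
  by (simp add: rev_if_def)

lemma rev_if_map: "rev_if (map f xs) = map f (rev_if xs)"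
  by (simp add: rev_if_def rev_map)

lemma tau_prod_list: "\<tau> (prod_list xs) = prod_list (rev_if (map \<tau> xs))"
proof (cases "\<forall>w z. \<tau> (w * z) = \<tau> w * \<tau> z")
  case True
  then show ?thesis by (induction xs) (auto simp: rev_if_def)
next
  case False
  then have "\<forall>w z. \<tau> (w * z) = \<tau> z * \<tau> w" using tau_mult by blast
  then show ?thesis using False by (induction xs) (auto simp: rev_if_def)
qed

definition tau_word :: "('a \<times> nat) list \<Rightarrow> ('a \<times> nat) list" where
  "tau_word w = rev_if (map (apfst \<tau>) w)"

lemma tau_word:
  shows eval_tau_word: "\<tau> (eval_word w) = eval_word (tau_word w)"
    and hword_tau_word: "hword w \<Longrightarrow> hword (tau_word w)"
    and length_tau_word [simp]: "length (tau_word w) = length w"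
proof -
  show "\<tau> (eval_word w) = eval_word (tau_word w)" "length (tau_word w) = length w"
    by (simp_all add: tau_word_def tau_prod_list rev_if_map comp_def)
  show "hword (tau_word w)" if "hword w"
    using that tau_in_H by (force simp: tau_word_def hword_def)
qed

lemma tau_aug:
  assumes "x \<in> aug k"
  shows "\<tau> x \<in> aug k"
  unfolding aug_def
proof (rule linear_image_subset_span[OF tau_linear _ assms[unfolded aug_def]], safe)
  fix w assume "hword w" "k \<le> length w"
  then show "\<tau> (eval_word w) \<in> span {eval_word w | w. hword w \<and> k \<le> length w}"
    by (intro span_base CollectI exI[of _ "tau_word w"]) (simp add: tau_word)
qed

definition tau2 :: "'a tensor_alg \<Rightarrow> 'a tensor_alg" where
  "tau2 t = tensor_maps [tensor1 \<circ> \<tau>, tensor1 \<circ> \<tau>] t"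

lemma linear_tau2: "linear tau2"
  unfolding tau2_def using linear_compose[OF tau_linear linear_tensor1]
  by (auto intro!: linear_tensor_maps)

lemma tau2_tensor: "tau2 (tensor [x, y]) = tensor [\<tau> x, \<tau> y]"
  unfolding tau2_def using tensor_maps_endo[of "[\<tau>, \<tau>]" "[x, y]"] tau_linear by simp

lemma tau2_taug:
  assumes "t \<in> taug 2 k"
  shows "tau2 t \<in> taug 2 k"
  unfolding taug_def
proof (rule linear_image_subset_span[OF linear_tau2 _ assms[unfolded taug_def]], clarify)
  fix ws :: "('a \<times> nat) list list"
  assume ws: "length ws = 2" "\<forall>w\<in>set ws. hword w" "k \<le> length (concat ws)"
  then obtain u v where uv: "ws = [u, v]" by (auto simp: length_Suc_conv numeral_2_eq_2)
  show "tau2 (tensor (map eval_word ws)) \<in> span {tensor (map eval_word ws) | ws.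
     length ws = 2 \<and> (\<forall>w\<in>set ws. hword w) \<and> k \<le> length (concat ws)}"
    using ws uv by (intro span_base CollectI exI[of _ "[tau_word u, tau_word v]"])
      (simp add: tau2_tensor tau_word)
qed

lemma swap_taug:
  assumes "t \<in> taug 2 k"
  shows "tensor_swap t \<in> taug 2 k"
  unfolding taug_def
proof (rule linear_image_subset_span[OF linear_tensor_swap _ assms[unfolded taug_def]], clarify)
  fix ws :: "('a \<times> nat) list list"
  assume ws: "length ws = 2" "\<forall>w\<in>set ws. hword w" "k \<le> length (concat ws)"
  then obtain u v where uv: "ws = [u, v]" by (auto simp: length_Suc_conv numeral_2_eq_2)
  show "tensor_swap (tensor (map eval_word ws)) \<in> span {tensor (map eval_word ws) | ws.
     length ws = 2 \<and> (\<forall>w\<in>set ws. hword w) \<and> k \<le> length (concat ws)}"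
    using ws uv by (intro span_base CollectI exI[of _ "[v, u]"]) (simp add: tensor_swap_tensor)
qed

text \<open>Both \<open>x \<otimes> 1 + 1 \<otimes> x\<close> and the spaces \<open>taug 2\<close>
  are invariant under swapping the factors, so morphisms and antimorphisms of coalgebras behave
  alike.\<close>

lemma tau_prim: "x \<in> prim k d \<Longrightarrow> \<tau> x \<in> prim k d"
proof -
  assume x: "x \<in> prim k d"
  let ?r = "red x"
  have r: "?r \<in> taug 2 (Suc k)" using x by (simp add: prim_def)
  have "(\<forall>x. \<Delta> (\<tau> x) = tau2 (\<Delta> x)) \<or> (\<forall>x. \<Delta> (\<tau> x) = tau2 (tensor_swap (\<Delta> x)))"
    using tau_ambimorphism unfolding hopf_ambimorphism_def tau2_def by blast
  then have "red (\<tau> x) = tau2 ?r \<or>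
    red (\<tau> x) = tau2 (tensor_swap ?r)"
    by (auto simp: linear_diff[OF linear_tau2] linear_diff[OF linear_tensor_swap] tau2_tensor tensor_swap_tensor)
  then have "red (\<tau> x) \<in> taug 2 (Suc k)"
    using tau2_taug[OF r] tau2_taug[OF swap_taug[OF r]] by auto
  then show ?thesis using x by (simp add: prim_def tau_in_H tau_aug)
qed

text \<open>Eigenvectors forming a basis of a complement of the next power inside
  \<open>prim k d\<close>. The choice is made for each level and degree separately, so that every
  generator is homogeneous and has a definite level.\<close>

definition gens_of :: "nat \<Rightarrow> nat \<Rightarrow> 'a set" where
  "gens_of k d = (SOME X. X \<subseteq> prim k d \<and> prim k d \<subseteq> span (X \<union> (aug (Suc k) \<inter> H d)) \<and>
     (\<forall>x\<in>X. (\<tau> x = x \<or> \<tau> x = - x) \<and> x \<notin> span ((aug (Suc k) \<inter> H d) \<union> (X - {x}))))"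

lemma gens_of:
  assumes "0 < d"
  shows "gens_of k d \<subseteq> prim k d" "prim k d \<subseteq> span (gens_of k d \<union> (aug (Suc k) \<inter> H d))"
    "x \<in> gens_of k d \<Longrightarrow> \<tau> x = x \<or> \<tau> x = - x"
    "x \<in> gens_of k d \<Longrightarrow> x \<notin> span ((aug (Suc k) \<inter> H d) \<union> (gens_of k d - {x}))"
proof -
  have "\<exists>X. X \<subseteq> prim k d \<and> prim k d \<subseteq> span (X \<union> (aug (Suc k) \<inter> H d)) \<and>
     (\<forall>x\<in>X. (\<tau> x = x \<or> \<tau> x = - x) \<and> x \<notin> span ((aug (Suc k) \<inter> H d) \<union> (X - {x})))"
    using assms aug_subset_prim[of _ d k] tau_prim tau_in_H tau_aug
    by (intro eigenbasis_of_complement tau_linear tau_tau subspace_prim subspace_inter subspace_aug subspace_H) auto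
  from someI_ex[OF this] show "gens_of k d \<subseteq> prim k d" "prim k d \<subseteq> span (gens_of k d \<union> (aug (Suc k) \<inter> H d))"
    "x \<in> gens_of k d \<Longrightarrow> \<tau> x = x \<or> \<tau> x = - x"
    "x \<in> gens_of k d \<Longrightarrow> x \<notin> span ((aug (Suc k) \<inter> H d) \<union> (gens_of k d - {x}))"
    unfolding gens_of_def[symmetric] by blast+
qed

definition gens :: "'a set" where
  "gens = (\<Union>d\<in>{0<..}. \<Union>k. gens_of k d)"

definition lev :: "'a \<Rightarrow> nat" where
  "lev x = (LEAST k. x \<notin> aug (Suc k))"

definition deg :: "'a \<Rightarrow> nat" where
  "deg x = (THE d. x \<in> H d)"

definition sg :: "'a \<Rightarrow> real" where
  "sg x = (if \<tau> x = x then 1 else - 1)"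

text \<open>A generator lies outside \<open>aug (Suc k)\<close> and is nonzero, so its level and
  degree can be recovered from the element alone.\<close>

lemma gens_of_lev_deg:
  assumes "0 < d" "x \<in> gens_of k d"
  shows "lev x = k" "deg x = d"
proof -
  have x: "x \<in> prim k d" "x \<notin> span ((aug (Suc k) \<inter> H d) \<union> (gens_of k d - {x}))"
    using gens_of[OF assms(1)] assms(2) by blast+
  then have na: "x \<notin> aug (Suc k)" and a: "x \<in> aug k" and h: "x \<in> H d" and nz: "x \<noteq> 0"
    by (auto simp: prim_def span_base span_zero)
  show "lev x = k"
    unfolding lev_def
  proof (rule Least_equality)
    show "x \<notin> aug (Suc k)" by (rule na)
    fix j assume "x \<notin> aug (Suc j)"
    then show "k \<le> j" using a aug_antimono[of "Suc j" k] by (meson not_less_eq_eq subsetD)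
  qed
  show "deg x = d"
    unfolding deg_def using h homogeneous_unique nz by (intro the_equality) auto
qed

lemma gens_in: "x \<in> gens \<Longrightarrow> x \<in> gens_of (lev x) (deg x)"
  and gens_deg_pos: "x \<in> gens \<Longrightarrow> 0 < deg x"
  using gens_of_lev_deg unfolding gens_def by auto

lemma gens_prim: "x \<in> gens \<Longrightarrow> x \<in> prim (lev x) (deg x)"
  using gens_of(1)[OF gens_deg_pos] gens_in by blast

lemma gens_in_H: "x \<in> gens \<Longrightarrow> x \<in> H (deg x)"
  using gens_prim by (simp add: prim_def)

lemma gens_tau: "x \<in> gens \<Longrightarrow> \<tau> x = sg x *\<^sub>R x"
  using gens_of(3)[OF gens_deg_pos gens_in] by (auto simp: sg_def)

lemma sg_cases: "sg x = 1 \<or> sg x = - 1"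
  by (simp add: sg_def)

lemma gens_span:
  assumes "y \<in> prim k d"
  shows "y \<in> span ({x \<in> gens. lev x = k \<and> deg x = d} \<union> (aug (Suc k) \<inter> H d))"
proof -
  have d: "0 < d" using assms by (simp add: prim_def)
  then have "gens_of k d \<subseteq> {x \<in> gens. lev x = k \<and> deg x = d}"
    using gens_of_lev_deg by (auto simp: gens_def)
  then have "span (gens_of k d \<union> (aug (Suc k) \<inter> H d))
    \<subseteq> span ({x \<in> gens. lev x = k \<and> deg x = d} \<union> (aug (Suc k) \<inter> H d))"
    by (intro span_mono) blast
  then show ?thesis using gens_of(2)[OF d] assms by blast
qed

text \<open>Projecting to the degree of \<open>x\<close> kills 1 and the generators of other
  degrees, which reduces the claim to the choice made in \<open>gens_of\<close>.\<close>

lemma gens_indep: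
  assumes x: "x \<in> gens"
  shows "x \<notin> span (aug (Suc (lev x)) \<union> {1} \<union> {y \<in> gens. lev y = lev x \<and> y \<noteq> x})"
proof
  let ?k = "lev x" and ?d = "deg x"
  let ?U = "(aug (Suc ?k) \<inter> H ?d) \<union> (gens_of ?k ?d - {x})"
  assume a: "x \<in> span (aug (Suc ?k) \<union> {1} \<union> {y \<in> gens. lev y = ?k \<and> y \<noteq> x})"
  have "hcomp ?d x \<in> span ?U"
  proof (rule linear_image_subset_span[OF linear_homogeneous_component _ a])
    fix y assume "y \<in> aug (Suc ?k) \<union> {1} \<union> {y \<in> gens. lev y = ?k \<and> y \<noteq> x}"
    then consider "y \<in> aug (Suc ?k)" | "y = 1" | "y \<in> gens" "lev y = ?k" "y \<noteq> x" by blast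
    then show "hcomp ?d y \<in> span ?U"
    proof cases
      case 1
      then show ?thesis using aug_component_in by (intro span_base) blast
    next
      case 2
      then show ?thesis using gens_deg_pos[OF x] by (simp add: component_homogeneous[OF one_in_H0] span_zero)
    next
      case 3
      then show ?thesis
        using gens_in[OF 3(1)] by (auto simp: component_homogeneous[OF gens_in_H[OF 3(1)]] span_zero intro!: span_base)
    qed
  qed
  then have "x \<in> span ?U" by (simp add: component_homogeneous[OF gens_in_H[OF x]])
  then show False using gens_of(4)[OF gens_deg_pos[OF x] gens_in[OF x]] by blast
qed

text \<open>Generators of higher level are killed as elements of \<open>aug (Suc (lev x))\<close>.
  No value is prescribed at generators of lower level; a comparison of total levels takes care of
  them later.\<close>

lemma dual_functional:
  assumes "x \<in> gens"
  shows "\<exists>f :: 'a \<Rightarrow> real. linear f \<and> f 1 = 0 \<and> (\<forall>y\<in>aug (Suc (lev x)). f y = 0) \<and>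
    (\<forall>y\<in>gens. lev y = lev x \<longrightarrow> f y = (if y = x then 1 else 0))"
proof -
  obtain f :: "'a \<Rightarrow> real" where f: "linear f" "f x = 1"
    "\<forall>y\<in>aug (Suc (lev x)) \<union> {1} \<union> {y \<in> gens. lev y = lev x \<and> y \<noteq> x}. f y = 0"
    using exists_separating_functional[OF gens_indep[OF assms]] by blast
  show ?thesis by (rule exI[of _ f]) (use f in auto)
qed

section \<open>The monomial basis\<close>

text \<open>
  The order of the factors only matters for the comparison with \<open>\<beta>\<close>: it makes the degrees of the factors
  of either sign decrease, as the parts numbered by \<open>part\<close> do.
\<close>

definition list_of :: "'a multiset \<Rightarrow> 'a list" where
  "list_of M = rev (sort_key deg (SOME xs. mset xs = {#x \<in># M. sg x = 1#}))
     @ rev (sort_key deg (SOME xs. mset xs = {#x \<in># M. sg x \<noteq> 1#}))"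

lemma mset_list_of [simp]: "mset (list_of M) = M"
proof -
  have *: "mset (SOME xs. mset xs = N) = N" for N :: "'a multiset"
    by (rule someI_ex) (rule ex_mset)
  show ?thesis by (simp add: list_of_def *)
qed

lemma set_list_of [simp]: "set (list_of M) = set_mset M"
  by (metis mset_list_of set_mset_mset)

lemma length_list_of [simp]: "length (list_of M) = size M"
  by (metis mset_list_of size_mset)

definition monomial :: "'a multiset \<Rightarrow> 'a" where
  "monomial M = prod_list (list_of M)"

definition mon :: "nat \<Rightarrow> 'a multiset set" where
  "mon n = {M. set_mset M \<subseteq> gens \<and> sum_mset (image_mset deg M) = n}"

definition mlev :: "'a multiset \<Rightarrow> nat" where
  "mlev M = sum_mset (image_mset lev M)"

definition gword :: "'a list \<Rightarrow> ('a \<times> nat \<times> nat) list" where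
  "gword xs = map (\<lambda>x. (x, lev x, deg x)) xs"

lemma gword_simps [simp]: "gword [] = []" "gword (x # xs) = (x, lev x, deg x) # gword xs"
  "length (gword xs) = length xs" "mset (gword xs) = image_mset (\<lambda>x. (x, lev x, deg x)) (mset xs)"
  by (simp_all add: gword_def)

lemma eval_gword [simp]: "map fst (gword xs) = xs"
  by (simp add: gword_def comp_def)

lemma level_gword: "level (gword xs) = mlev (mset xs)"
  and degr_gword: "degr (gword xs) = sum_mset (image_mset deg (mset xs))"
  by (induction xs) (simp_all add: mlev_def)

lemma pword_gword: "set xs \<subseteq> gens \<Longrightarrow> pword (gword xs)"
  by (induction xs) (simp_all add: gens_prim)

lemma mon_size: "M \<in> mon n \<Longrightarrow> size M \<le> n"
  using pword_length[OF pword_gword[of "list_of M"]] by (simp add: mon_def degr_gword)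

lemma monomial_in_H: "M \<in> mon n \<Longrightarrow> monomial M \<in> H n"
  using pword_degree[OF pword_gword[of "list_of M"]]
  by (simp add: mon_def degr_gword monomial_def)

text \<open>Index sets of the triangular order: a larger level counts as lower, as it means lying
  deeper in the filtration, and at equal level a smaller size does.\<close>

definition lower :: "nat \<Rightarrow> nat \<Rightarrow> nat \<Rightarrow> 'a multiset set" where
  "lower k m n = {M \<in> mon n. k < mlev M \<or> mlev M = k \<and> size M < m}"

text \<open>Each letter is a combination of generators of its own level and degree modulo the next
  power; multiplied into the word, such an error raises the total level.\<close>

lemma pword_expand:
  assumes "pword w"
  shows "eval_word w \<in> span ({prod_list xs | xs. set xs \<subseteq> gens \<and> level (gword xs) = level w \<and>
      length xs = length w \<and> degr (gword xs) = degr w} \<union> (aug (Suc (level w)) \<inter> H (degr w)))"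
    (is "_ \<in> span (?G w \<union> ?R w)")
  using assms
proof (induction w)
  case Nil
  show ?case by (intro span_base UnI1 CollectI exI[of _ "[]"]) simp
next
  case (Cons a w)
  obtain y k d where a: "a = (y, k, d)" by (cases a)
  have y: "y \<in> prim k d" and w: "pword w" using Cons.prems by (auto simp: a)
  have wa: "eval_word w' \<in> aug (level w) \<inter> H (degr w)" if "pword w'" "level w' = level w" "degr w' = degr w" for w'
    using pword_level[OF that(1)] pword_degree[OF that(1)] that by simp
  have "y * eval_word w \<in> span (?G (a # w) \<union> ?R (a # w))"
  proof (rule bilinear_span[OF bilinear_times _ gens_span[OF y] Cons.IH[OF w]])
    fix x z assume x: "x \<in> {x \<in> gens. lev x = k \<and> deg x = d} \<union> (aug (Suc k) \<inter> H d)" and z: "z \<in> ?G w \<union> ?R w"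
    have z': "z \<in> aug (level w) \<inter> H (degr w)"
    proof (cases "z \<in> ?R w")
      case True
      then show ?thesis using aug_antimono[of "level w" "Suc (level w)"] by auto
    next
      case False
      then obtain xs where "z = prod_list xs" "set xs \<subseteq> gens" "level (gword xs) = level w" "degr (gword xs) = degr w"
        using z by blast
      then show ?thesis using wa[of "gword xs"] pword_gword by simp
    qed
    have x': "x \<in> aug k \<inter> H d"
      using x gens_prim aug_antimono[of k "Suc k"] by (auto simp: prim_def)
    consider "x \<in> aug (Suc k)" | "z \<in> aug (Suc (level w))"
      | xs where "x \<in> gens" "lev x = k" "deg x = d" "z = prod_list xs" "set xs \<subseteq> gens"
          "level (gword xs) = level w" "length xs = length w" "degr (gword xs) = degr w"
      using x z by blast
    then show "x * z \<in> span (?G (a # w) \<union> ?R (a # w))"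
    proof cases
      case 1
      then have "x * z \<in> ?R (a # w)"
        using aug_mult[of x "Suc k" z "level w"] mult_graded[of x d z "degr w"] x' z' by (simp add: a)
      then show ?thesis by (intro span_base) blast
    next
      case 2
      then have "x * z \<in> ?R (a # w)"
        using aug_mult[of x k z "Suc (level w)"] mult_graded[of x d z "degr w"] x' z' by (simp add: a)
      then show ?thesis by (intro span_base) blast
    next
      case 3
      then show ?thesis by (intro span_base UnI1 CollectI exI[of _ "x # xs"]) (simp add: a)
    qed
  qed
  then show ?case by (simp add: a)
qed

text \<open>Giving every letter level 1 makes the level of a word its length, so the powers
  \<open>aug\<close> fall under the rewriting of primitive words.\<close>

lemma hword_as_pword: "hword w \<Longrightarrow> pword (map (\<lambda>(z, d). (z, 1, d)) w)"
  using prim_1 by (induction w) auto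

lemma span_lower_mono: "k \<le> k' \<Longrightarrow> (k < k' \<or> m' \<le> m) \<Longrightarrow>
    span (monomial ` lower k' m' n) \<subseteq> span (monomial ` lower k m n)"
  by (rule span_mono) (auto simp: lower_def)

lemma span_subset_lower:
  assumes "\<And>w. w \<in> W \<Longrightarrow> pword w \<and> degr w = n \<and> (k < level w \<or> level w = k \<and> length w < m)"
    and "\<And>w. w \<in> W \<Longrightarrow> eval_word w \<in> span (monomial ` lower (level w) (Suc (length w)) n)"
  shows "span (eval_word ` W) \<subseteq> span (monomial ` lower k m n)"
proof (rule span_minimal[OF _ subspace_span], safe)
  fix w assume w: "w \<in> W"
  then have "span (monomial ` lower (level w) (Suc (length w)) n) \<subseteq> span (monomial ` lower k m n)"
    using assms(1)[OF w] by (intro span_lower_mono) auto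
  then show "eval_word w \<in> span (monomial ` lower k m n)" using assms(2)[OF w] by blast
qed

definition hpwords :: "nat \<Rightarrow> nat \<Rightarrow> ('a \<times> nat \<times> nat) list set" where
  "hpwords k n = {w. pword w \<and> k < level w \<and> degr w = n}"

definition spwords :: "nat \<Rightarrow> nat \<Rightarrow> nat \<Rightarrow> ('a \<times> nat \<times> nat) list set" where
  "spwords k m n = {w. pword w \<and> level w = k \<and> length w < m \<and> degr w = n}"

lemma aug_hpwords:
  assumes "x \<in> aug (Suc k)" "x \<in> H n"
  shows "x \<in> span (eval_word ` hpwords k n)"
proof -
  have "{eval_word v | v. hword v \<and> Suc k \<le> length v \<and> sum_list (map snd v) = n} \<subseteq> eval_word ` hpwords k n"
  proof safe
    fix v assume v: "hword v" "Suc k \<le> length v"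
    let ?v = "map (\<lambda>(z, d). (z, 1::nat, d)) v"
    have "level ?v = length v" "degr ?v = sum_list (map snd v)" "map fst ?v = map fst v"
      by (induction v) auto
    then show "eval_word v \<in> eval_word ` hpwords k (sum_list (map snd v))"
      using v hword_as_pword[OF v(1)] by (intro image_eqI[of _ _ ?v]) (simp_all only: hpwords_def mem_Collect_eq Suc_le_eq)
  qed
  then show ?thesis using aug_homogeneous[OF assms] span_mono by blast
qed

lemma shorter_spwords: "shorter k m n = span (eval_word ` spwords k m n)"
  unfolding shorter_def spwords_def by (rule arg_cong[of _ _ span]) auto

text \<open>Letters are replaced by generators at the cost of deeper terms, and the generators are
  put into the order of \<open>list_of\<close> at the cost of shorter words.\<close>

lemma pword_in_span:
  "pword w \<Longrightarrow> degr w = n \<Longrightarrow> eval_word w \<in> span (monomial ` lower (level w) (Suc (length w)) n)"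
\<comment> \<open>Either the level rises, which above \<open>n\<close> means that the element is 0,
  or it stays and the word shortens. With \<open>Suc n\<close> in place of \<open>n\<close>, a step
  from level \<open>n\<close> upwards decreases the measure too.\<close>
proof (induction "(Suc n - level w, length w)" arbitrary: w rule: wf_induct_rule[OF wf_lex_prod[OF wf_less_than wf_less_than]])
  case (1 w)
  let ?k = "level w" and ?m = "length w"
  let ?L = "span (monomial ` lower ?k (Suc ?m) n)"
  show ?case
  proof (cases "n < ?k")
    case True
    then have "eval_word w = 0"
      using aug_eq_0[OF pword_level[OF 1(2)]] pword_degree[OF 1(2)] 1(3) by simp
    then show ?thesis by (simp add: span_zero)
  next
    case False
    have IH: "eval_word v \<in> span (monomial ` lower (level v) (Suc (length v)) n)"
      if "pword v" "degr v = n" "?k < level v \<or> level v = ?k \<and> length v < ?m" for v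
      by (rule 1(1)) (use that False in auto)
    have aug: "span (eval_word ` hpwords ?k n) \<subseteq> ?L"
      by (rule span_subset_lower) (simp_all add: hpwords_def IH)
    have sh: "shorter ?k ?m n \<subseteq> ?L"
      unfolding shorter_spwords by (rule span_subset_lower, simp add: spwords_def, rule IH) (simp_all add: spwords_def)
    have "{prod_list xs | xs. set xs \<subseteq> gens \<and> level (gword xs) = ?k \<and>
        length xs = ?m \<and> degr (gword xs) = n} \<subseteq> ?L"
    proof safe
      fix xs assume xs: "set xs \<subseteq> gens" "level (gword xs) = ?k" "length xs = ?m" "n = degr (gword xs)"
      let ?M = "mset xs"
      have "?M \<in> lower ?k (Suc ?m) n"
        using xs by (auto simp: lower_def mon_def level_gword degr_gword)
      then have M: "monomial ?M \<in> ?L" by (intro span_base) blast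
      have "eval_word (gword xs) - eval_word (gword (list_of ?M)) \<in> shorter ?k ?m n"
        using pword_permute[OF pword_gword[OF xs(1)], of "gword (list_of ?M)"] xs by simp
      then have "prod_list xs - monomial ?M \<in> ?L" using sh by (auto simp: monomial_def)
      then have "prod_list xs - monomial ?M + monomial ?M \<in> ?L" using M by (rule span_add)
      then show "prod_list xs \<in> span (monomial ` lower ?k (Suc ?m) (degr (gword xs)))" using xs(4) by simp
    qed
    moreover have "aug (Suc ?k) \<inter> H n \<subseteq> ?L" using aug aug_hpwords by blast
    ultimately show ?thesis
      using pword_expand[OF 1(2)] 1(3) span_minimal[OF _ subspace_span] by (meson Un_least subsetD)
  qed
qed

lemma aug_in_span_lower: "x \<in> aug (Suc k) \<Longrightarrow> x \<in> H n \<Longrightarrow> x \<in> span (monomial ` lower k m n)"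
  by (rule subsetD[OF span_subset_lower aug_hpwords]) (auto simp: hpwords_def intro: pword_in_span)

lemma shorter_in_span_lower: "x \<in> shorter k m n \<Longrightarrow> x \<in> span (monomial ` lower k m n)"
  unfolding shorter_spwords
  by (rule subsetD[OF span_subset_lower]) (auto simp: spwords_def intro: pword_in_span)

lemma span_monomials: "span (monomial ` mon n) = H n"
proof
  show "span (monomial ` mon n) \<subseteq> H n"
    using monomial_in_H by (intro span_minimal subspace_H) auto
  show "H n \<subseteq> span (monomial ` mon n)"
  \<comment> \<open>Letters have positive degree, so degree 0 is spanned by the empty monomial, by
    connectedness.\<close>
  proof (cases "n = 0")
    case True
    have "{#} \<in> mon 0" by (simp add: mon_def)
    moreover have "monomial {#} = 1"
      using length_list_of[of "{#}"] by (simp add: monomial_def del: length_list_of)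
    ultimately have "1 \<in> monomial ` mon 0" by (metis imageI)
    then show ?thesis unfolding True connected by (intro span_mono) auto
  next
    case False
    show ?thesis
    proof
      fix x assume x: "x \<in> H n"
      then have "pword [(x, 1, n)]" using prim_1 False by simp
      from pword_in_span[OF this refl]
      have "x \<in> span (monomial ` lower 1 2 n)" by (simp add: numeral_2_eq_2)
      also have "\<dots> \<subseteq> span (monomial ` mon n)" by (rule span_mono) (auto simp: lower_def)
      finally show "x \<in> span (monomial ` mon n)" .
    qed
  qed
qed

end

lemma sum_list_map_upt: "sum_list (map f [0..<l]) = (\<Sum>i<l. f i)"
  by (simp add: sum_list_sum_nth atLeast0LessThan)

lemma prod_list_map_upt: "prod_list (map f [0..<l]) = (\<Prod>i<l. f i :: 'b::comm_monoid_mult)"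
  by (induction l) (simp_all add: mult.commute)

lemma prod_list_concat: "prod_list (concat xss) = prod_list (map prod_list xss :: 'b::monoid_mult list)"
  by (induction xss) simp_all

lemma prod_list_scaleR:
  "prod_list (map (\<lambda>i. c i *\<^sub>R u i) is) = prod_list (map c is) *\<^sub>R prod_list (map u is :: 'b::real_algebra_1 list)"
  by (induction "is") simp_all

context hopf_involution
begin

section \<open>Finiteness of the set of monomials of a given degree\<close>

lemma gens_nonzero: "x \<in> gens \<Longrightarrow> x \<noteq> 0"
  using gens_indep[of x] span_zero by blast

lemma lev_le_deg: "x \<in> gens \<Longrightarrow> lev x \<le> deg x"
  using aug_eq_0[of x "lev x" "deg x"] gens_prim[of x] gens_nonzero[of x]
  by (auto simp: prim_def not_less[symmetric])

lemma mlev_le: "M \<in> mon n \<Longrightarrow> mlev M \<le> n"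
proof -
  assume "M \<in> mon n"
  then have M: "set_mset M \<subseteq> gens" "n = sum_mset (image_mset deg M)" by (auto simp: mon_def)
  then show "mlev M \<le> n"
    unfolding mlev_def M(2) using lev_le_deg by (intro sum_mset_mono) auto
qed

lemma finite_gens_of: "0 < d \<Longrightarrow> finite (gens_of k d)"
proof -
  assume d: "0 < d"
  obtain B where B: "finite B" "H d \<subseteq> span B" using fin_dim[of d] by (auto simp: finite_dimensional_set_def)
  have "gens_of k d \<subseteq> span B" using gens_of(1)[OF d, of k] B(2) by (auto simp: prim_def)
  moreover have "independent (gens_of k d)"
  proof
    assume "dependent (gens_of k d)"
    then obtain x where x: "x \<in> gens_of k d" "x \<in> span (gens_of k d - {x})" by (auto simp: dependent_def)
    then show False
      using gens_of(4)[OF d x(1)] span_mono[of "gens_of k d - {x}" "aug (Suc k) \<inter> H d \<union> (gens_of k d - {x})"] by blast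
  qed
  ultimately show ?thesis using independent_span_bound[OF B(1)] by blast
qed

lemma finite_gens: "finite {x \<in> gens. deg x = d}"
proof (cases "d = 0")
  case True
  then have "{x \<in> gens. deg x = d} = {}" using gens_deg_pos by fastforce
  then show ?thesis by (simp only: finite.emptyI)
next
  case False
  have "{x \<in> gens. deg x = d} \<subseteq> (\<Union>k\<le>d. gens_of k d)"
    using gens_in lev_le_deg by blast
  moreover have "finite (\<Union>k\<le>d. gens_of k d)" using finite_gens_of False by simp
  ultimately show ?thesis by (rule finite_subset)
qed

lemma finite_gens_le: "finite {x \<in> gens. deg x \<le> n}"
proof -
  have "{x \<in> gens. deg x \<le> n} = (\<Union>d\<le>n. {x \<in> gens. deg x = d})" by auto
  then show ?thesis using finite_gens by simp
qed

lemma weighted_msets_gens: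
  "weighted_msets {x \<in> gens. deg x \<le> n} deg n = mon n"
proof -
  have "deg x \<le> n" if x: "x \<in># M" "sum_mset (image_mset deg M) = n" for M x
  proof -
    have "sum_mset (image_mset deg M) = deg x + sum_mset (image_mset deg (M - {#x#}))"
      using x by (metis image_mset_add_mset insert_DiffM sum_mset.add_mset)
    then show ?thesis using x by simp
  qed
  then show ?thesis by (auto simp: weighted_msets_def mon_def)
qed

lemma finite_mon: "finite (mon n)"
  unfolding weighted_msets_gens[symmetric]
  by (rule finite_weighted_msets[OF finite_gens_le]) (use gens_deg_pos in auto)

section \<open>Linear independence of the monomials\<close>

definition dualf :: "'a \<Rightarrow> 'a \<Rightarrow> real" where
  "dualf x = (SOME f. linear f \<and> f 1 = 0 \<and> (\<forall>y\<in>aug (Suc (lev x)). f y = 0) \<and>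
    (\<forall>y\<in>gens. lev y = lev x \<longrightarrow> f y = (if y = x then 1 else 0)))"

lemma dualf:
  assumes "x \<in> gens"
  shows "linear (dualf x)" "dualf x 1 = 0" "y \<in> aug (Suc (lev x)) \<Longrightarrow> dualf x y = 0"
    "y \<in> gens \<Longrightarrow> lev y = lev x \<Longrightarrow> dualf x y = (if y = x then 1 else 0)"
  using someI_ex[OF dual_functional[OF assms]] unfolding dualf_def[symmetric] by blast+

definition pairing :: "'a list \<Rightarrow> 'a tensor_alg \<Rightarrow> real" where
  "pairing xs = tensor_lift (\<lambda>zs. if length zs = length (map dualf xs)
     then foldr (*) (map2 (\<lambda>f x. f x) (map dualf xs) zs) 1 else 0)"

lemma bilinear_real_times: "bilinear ((*) :: real \<Rightarrow> real \<Rightarrow> real)"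
  by (auto simp: bilinear_def algebra_simps intro!: linearI)

lemma linear_pairing: "set xs \<subseteq> gens \<Longrightarrow> linear (pairing xs)"
  unfolding pairing_def
  by (rule linear_tensor_lift[OF multilinear_foldr[OF bilinear_real_times]]) (use dualf in auto)

lemma pairing_tensor:
  assumes "set xs \<subseteq> gens" "length zs = length xs"
  shows "pairing xs (tensor zs) = (\<Prod>i<length xs. dualf (xs ! i) (zs ! i))"
proof -
  have "map2 (\<lambda>f x. f x) (map dualf xs) zs = map (\<lambda>i. dualf (xs ! i) (zs ! i)) [0..<length xs]"
    using assms(2) by (intro nth_equalityI) auto
  moreover have "foldr (*) ys (1::real) = prod_list ys" for ys by (induction ys) auto
  ultimately show ?thesis
    unfolding pairing_def
    by (subst tensor_lift_tensor[OF multilinear_foldr[OF bilinear_real_times]])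
      (use dualf assms in \<open>auto simp: prod_list_map_upt\<close>)
qed

text \<open>If there are more letters than the levels add up to, some slot holds more letters than
  the level of its functional, which then vanishes there.\<close>

lemma pairing_taug:
  assumes xs: "set xs \<subseteq> gens" and t: "t \<in> taug (length xs) (Suc (sum_list (map lev xs)))"
  shows "pairing xs t = 0"
  using t unfolding taug_def
proof (rule linear_eq_0_on_span[OF linear_pairing[OF xs], rotated])
  fix t assume "t \<in> {tensor (map eval_word ws) | ws. length ws = length xs \<and> (\<forall>w\<in>set ws. hword w) \<and>
    Suc (sum_list (map lev xs)) \<le> length (concat ws)}"
  then obtain ws where ws: "t = tensor (map eval_word ws)" "length ws = length xs" "\<forall>w\<in>set ws. hword w"
    "Suc (sum_list (map lev xs)) \<le> length (concat ws)" by blast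
  have "\<exists>i<length xs. lev (xs ! i) < length (ws ! i)"
  proof (rule ccontr)
    assume "\<not> ?thesis"
    then have "(\<Sum>i<length xs. length (ws ! i)) \<le> (\<Sum>i<length xs. lev (xs ! i))"
      by (intro sum_mono) auto
    then show False using ws(2,4) by (simp add: length_concat sum_list_sum_nth atLeast0LessThan)
  qed
  then obtain i where i: "i < length xs" "lev (xs ! i) < length (ws ! i)" by blast
  have "eval_word (ws ! i) \<in> aug (Suc (lev (xs ! i)))"
    using i ws by (intro hword_in_aug) auto
  then have "dualf (xs ! i) (eval_word (ws ! i)) = 0"
    using dualf(3)[of "xs ! i"] xs i(1) nth_mem by blast
  then show "pairing xs t = 0"
    using i(1) ws(2) by (auto simp: ws(1) pairing_tensor[OF xs])
qed

text \<open>
  No block may be empty since the functionals vanish at \<open>1\<close>, so every block is a single generator; none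
  may have too large a level, so all the levels agree and duality applies.
\<close>

lemma pairing_term:
  assumes xs: "set xs \<subseteq> gens" and ys: "set ys \<subseteq> gens" and cs: "cs \<in> labellings (length xs) (length ys)"
    and lv: "sum_list (map lev ys) = sum_list (map lev xs)" and len: "length ys \<le> length xs"
    and nz: "(\<Prod>i<length xs. dualf (xs ! i) (prod_list (block i cs ys))) \<noteq> 0"
  shows "mset ys = mset xs" "(\<Prod>i<length xs. dualf (xs ! i) (prod_list (block i cs ys))) = 1"
proof -
  let ?l = "length xs" and ?b = "\<lambda>i. block i cs ys"
  have xg: "xs ! i \<in> gens" if "i < ?l" for i using xs that nth_mem by blast
  have nz': "dualf (xs ! i) (prod_list (?b i)) \<noteq> 0" if "i < ?l" for i
    using nz that by auto
  have ne: "?b i \<noteq> []" if "i < ?l" for i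
    using nz'[OF that] dualf(2)[OF xg[OF that]] by auto
  note mc = mset_concat_blocks[OF cs]
  have "(\<Sum>i<?l. length (?b i)) = length ys"
    using arg_cong[OF mc, of size] by (simp add: length_concat comp_def sum_list_map_upt)
  moreover have "(\<Sum>i<?l. 1) \<le> (\<Sum>i<?l. length (?b i))"
    using ne by (intro sum_mono) (simp add: Suc_le_eq)
  ultimately have "(\<Sum>i<?l. length (?b i)) = (\<Sum>i<?l. 1)" using len by simp
  then have "length (?b i) = 1" if "i < ?l" for i
    using sum_mono_inv[of "\<lambda>_. 1" "{..<?l}" "\<lambda>i. length (?b i)" i] ne that by (simp add: Suc_le_eq)
  then have "\<exists>y. ?b i = [y]" if "i < ?l" for i using that by (auto simp: length_Suc_conv)
  then obtain y where y: "\<And>i. i < ?l \<Longrightarrow> ?b i = [y i]" by metis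
  have conc: "concat (map ?b [0..<?l]) = map y [0..<?l]"
  proof -
    have "map ?b [0..<?l] = map (\<lambda>i. [y i]) [0..<?l]" using y by simp
    then show ?thesis by (simp only: concat_map_singleton)
  qed
  have ymem: "y i \<in> gens" if "i < ?l" for i
  proof -
    have "y i \<in> set (concat (map ?b [0..<?l]))" using that by (simp add: conc)
    then show ?thesis using mc ys by (metis mset_eq_setD subsetD)
  qed
  have le: "lev (y i) \<le> lev (xs ! i)" if "i < ?l" for i
  proof (rule ccontr)
    assume "\<not> ?thesis"
    then have "y i \<in> aug (Suc (lev (xs ! i)))"
      using gens_prim[OF ymem[OF that]] aug_antimono[of "Suc (lev (xs ! i))" "lev (y i)"] by (auto simp: prim_def)
    then show False using nz'[OF that] dualf(3)[OF xg[OF that]] y[OF that] by simp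
  qed
  have "sum_list (map lev (map y [0..<?l])) = sum_list (map lev ys)"
    using mc unfolding conc by (metis mset_map sum_mset_sum_list)
  then have "(\<Sum>i<?l. lev (y i)) = sum_list (map lev ys)"
    by (simp add: sum_list_map_upt comp_def)
  also have "\<dots> = (\<Sum>i<?l. lev (xs ! i))"
    unfolding lv by (simp add: sum_list_sum_nth atLeast0LessThan)
  finally have "lev (y i) = lev (xs ! i)" if "i < ?l" for i
    using sum_mono_inv[of "\<lambda>i. lev (y i)" "{..<?l}" "\<lambda>i. lev (xs ! i)" i] le that by simp
  then have d: "dualf (xs ! i) (y i) = (if y i = xs ! i then 1 else 0)" if "i < ?l" for i
    using dualf(4)[OF xg[OF that] ymem[OF that]] that by simp
  then have yx: "y i = xs ! i" if "i < ?l" for i using nz'[OF that] y[OF that] that by (auto split: if_splits)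
  have "map y [0..<?l] = xs" using yx by (intro nth_equalityI) auto
  then show "mset ys = mset xs" using mc conc by simp
  show "(\<Prod>i<?l. dualf (xs ! i) (prod_list (?b i))) = 1"
    using y d yx by (intro prod.neutral) auto
qed

lemma block_upt: "i < length xs \<Longrightarrow> block i [0..<length xs] xs = [xs ! i]"
proof -
  assume i: "i < length xs"
  have "zip [0..<length xs] xs = map (\<lambda>j. (j, xs ! j)) [0..<length xs]"
    by (intro nth_equalityI) auto
  then have "block i [0..<length xs] xs = map (\<lambda>j. xs ! j) (filter (\<lambda>j. j = i) [0..<length xs])"
    by (simp add: block_def filter_map comp_def)
  also have "filter (\<lambda>j. j = i) [0..<length xs] = [i]"
  proof -
    have "[0..<length xs] = [0..<i] @ i # [Suc i..<length xs]"
      using i upt_add_eq_append[of 0 i "length xs - i"] by (simp add: upt_conv_Cons)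
    then show ?thesis by (simp add: filter_empty_conv)
  qed
  finally show ?thesis by simp
qed

lemma sum_list_lev: "sum_list (map lev xs) = mlev (mset xs)"
  by (simp add: mlev_def sum_mset_sum_list flip: mset_map)

text \<open>Equality of the total levels puts the error of the leading-term formula exactly one step
  too deep for the pairing, so only the labellings remain.\<close>

lemma pairing_iterated_coproduct:
  assumes xs: "set xs \<subseteq> gens" and ys: "set ys \<subseteq> gens" and lv: "mlev (mset ys) = mlev (mset xs)"
  shows "pairing xs (cop (length xs) (prod_list ys))
    = (\<Sum>cs\<in>labellings (length xs) (length ys). \<Prod>i<length xs. dualf (xs ! i) (prod_list (block i cs ys)))"
proof -
  let ?l = "length xs"
  note lin = linear_pairing[OF xs]
  let ?B = "\<Sum>cs\<in>labellings ?l (length ys). tensor (map (\<lambda>i. prod_list (block i cs ys)) [0..<?l])"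
  have "cop ?l (prod_list ys) - ?B \<in> taug ?l (Suc (sum_list (map lev xs)))"
    using iterated_coproduct_pword(2)[OF pword_gword[OF ys], of ?l]
    by (simp add: level_gword lv sum_list_lev) (simp add: gword_def block_map comp_def)
  from pairing_taug[OF xs this]
  have "pairing xs (cop ?l (prod_list ys)) = pairing xs ?B"
    by (simp add: linear_diff[OF lin])
  also have "\<dots> = (\<Sum>cs\<in>labellings ?l (length ys). \<Prod>i<?l. dualf (xs ! i) (prod_list (block i cs ys)))"
    by (simp add: linear_sum[OF lin] pairing_tensor[OF xs])
  finally show ?thesis .
qed

text \<open>A relation is paired with the functionals dual to a monomial \<open>M0\<close> of least
  level in its support and, among those, of greatest length. Deeper monomials vanish by filtration;
  those of the same level are at most as long and vanish unless they equal
  \<open>M0\<close>.\<close>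

lemma monomials_independent:
  assumes c: "(\<Sum>M\<in>mon n. c M *\<^sub>R monomial M) = 0"
  shows "\<forall>M\<in>mon n. c M = 0"
proof (rule ccontr)
  assume "\<not> ?thesis"
  then have ex: "\<exists>M. M \<in> mon n \<and> c M \<noteq> 0" by blast
  \<comment> \<open>Sizes are at most \<open>n\<close>, so the factor \<open>Suc n\<close> makes
    this a lexicographic comparison: smaller level, then larger size.\<close>
  define rk where "rk M = mlev M * Suc n + (n - size M)" for M :: "'a multiset"
  obtain M0 where M0: "M0 \<in> mon n" "c M0 \<noteq> 0" "\<And>M. M \<in> mon n \<Longrightarrow> c M \<noteq> 0 \<Longrightarrow> rk M0 \<le> rk M"
    using ex_has_least_nat[of "\<lambda>M. M \<in> mon n \<and> c M \<noteq> 0" _ rk] ex by blast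
  let ?xs = "list_of M0"
  let ?P = "\<lambda>x. pairing ?xs (cop (length ?xs) x)"
  have xs: "set ?xs \<subseteq> gens" using M0(1) by (simp add: mon_def)
  have lin: "linear ?P"
    by (rule linear_compose2[OF linear_pairing[OF xs] linear_iterated_coproduct])
  have zero: "?P (monomial M) = 0" if M: "M \<in> mon n" "c M \<noteq> 0" "M \<noteq> M0" for M
  proof -
    let ?ys = "list_of M"
    have ys: "set ?ys \<subseteq> gens" using M(1) by (simp add: mon_def)
    have rk: "rk M0 \<le> rk M" by (rule M0(3)[OF M(1,2)])
    have sz: "size M \<le> n" "size M0 \<le> n" using mon_size M M0 by auto
    have "mlev M0 \<le> mlev M"
    proof (rule ccontr)
      assume "\<not> ?thesis"
      then have "Suc (mlev M) * Suc n \<le> mlev M0 * Suc n" by (intro mult_le_mono1) simp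
      then show False using rk sz by (simp add: rk_def)
    qed
    then consider "mlev M0 < mlev M" | "mlev M = mlev M0" "size M \<le> size M0"
      using rk sz by (fastforce simp: rk_def)
    then show ?thesis
    proof cases
      case 1
      have "cop (length ?xs) (monomial M) \<in> taug (length ?xs) (mlev M)"
        using iterated_coproduct_pword(1)[OF pword_gword[OF ys]] by (simp add: level_gword monomial_def)
      then have "cop (length ?xs) (monomial M) \<in> taug (length ?xs) (Suc (sum_list (map lev ?xs)))"
        using 1 taug_antimono[of "Suc (mlev M0)" "mlev M"] by (auto simp: sum_list_lev)
      then show ?thesis by (rule pairing_taug[OF xs])
    next
      case 2
      have "?P (monomial M) = (\<Sum>cs\<in>labellings (length ?xs) (length ?ys).
          \<Prod>i<length ?xs. dualf (?xs ! i) (prod_list (block i cs ?ys)))"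
        unfolding monomial_def by (rule pairing_iterated_coproduct[OF xs ys]) (simp add: 2)
      also have "\<dots> = 0"
      proof (rule sum.neutral, rule ballI, rule ccontr)
        fix cs assume cs: "cs \<in> labellings (length ?xs) (length ?ys)"
          "(\<Prod>i<length ?xs. dualf (?xs ! i) (prod_list (block i cs ?ys))) \<noteq> 0"
        have "mset ?ys = mset ?xs"
          by (rule pairing_term(1)[OF xs ys cs(1) _ _ cs(2)]) (simp_all add: sum_list_lev 2)
        then show False using M(3) by simp
      qed
      finally show ?thesis .
    qed
  qed
  have "?P (monomial M0) \<noteq> 0"
  proof -
    let ?t = "\<lambda>cs. \<Prod>i<length ?xs. dualf (?xs ! i) (prod_list (block i cs ?xs))"
    have e: "?P (monomial M0) = (\<Sum>cs\<in>labellings (length ?xs) (length ?xs). ?t cs)"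
      unfolding monomial_def by (rule pairing_iterated_coproduct[OF xs xs]) simp
    have t: "?t cs = 0 \<or> ?t cs = 1" if "cs \<in> labellings (length ?xs) (length ?xs)" for cs
      using pairing_term(2)[OF xs xs that] by blast
    have id: "[0..<length ?xs] \<in> labellings (length ?xs) (length ?xs)" by (auto simp: labellings_def)
    have xg: "?xs ! i \<in> gens" if "i < length ?xs" for i using xs that nth_mem by blast
    \<comment> \<open>The labelling that sends each letter to its own slot contributes 1. All other
      terms are 0 or 1, so the further matching labellings caused by repeated generators cannot
      cancel it.\<close>
    have "?t [0..<length ?xs] = 1"
    proof (rule prod.neutral, rule ballI)
      fix i assume "i \<in> {..<length ?xs}"
      then have i: "i < length ?xs" by simp
      show "dualf (?xs ! i) (prod_list (block i [0..<length ?xs] ?xs)) = 1"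
        unfolding block_upt[OF i] using dualf(4)[OF xg[OF i] xg[OF i]] by simp
    qed
    moreover have "?t [0..<length ?xs] \<le> (\<Sum>cs\<in>labellings (length ?xs) (length ?xs). ?t cs)"
    proof (rule member_le_sum[OF id _ finite_labellings])
      fix cs assume "cs \<in> labellings (length ?xs) (length ?xs) - {[0..<length ?xs]}"
      then have "?t cs = 0 \<or> ?t cs = 1" using t by blast
      then show "0 \<le> ?t cs" by (elim disjE) linarith+
    qed
    ultimately have "1 \<le> ?P (monomial M0)" unfolding e by simp
    then show ?thesis by simp
  qed
  moreover have "?P (\<Sum>M\<in>mon n. c M *\<^sub>R monomial M) = c M0 * ?P (monomial M0)"
  proof -
    have "?P (\<Sum>M\<in>mon n. c M *\<^sub>R monomial M) = (\<Sum>M\<in>mon n. c M * ?P (monomial M))"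
      unfolding linear_sum[OF lin] linear_scale[OF lin] by simp
    also have "\<dots> = (\<Sum>M\<in>{M0}. c M * ?P (monomial M))"
      using zero M0(1) by (intro sum.mono_neutral_right finite_mon) auto
    finally show ?thesis by simp
  qed
  ultimately show False using c M0(2) linear_0[OF lin] by auto
qed

section \<open>Descent operators are triangular\<close>

abbreviation dop :: "decorated_composition \<Rightarrow> 'a \<Rightarrow> 'a" where
  "dop \<equiv> descent_op H \<Delta> \<epsilon> \<tau>"

text \<open>The part of the operator after the iterated coproduct, separated so that it applies as a
  linear map to the leading part and to the error of the coproduct.\<close>

definition descent_map :: "decorated_composition \<Rightarrow> 'a tensor_alg \<Rightarrow> 'a" where
  "descent_map D t = tensor_multiply
     (tensor_maps (map (\<lambda>(e, d). if d = Plain then tensor1 else tensor1 \<circ> \<tau>) D)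
       (tensor_maps (map (\<lambda>e. tensor1 \<circ> hcomp e) (undecorate D)) t))"

lemma descent_op_eq: "dop D x = descent_map D (cop (length D) x)"
  by (simp add: descent_op_def descent_map_def coproduct_component_def undecorate_def)

definition decorate :: "decoration \<Rightarrow> 'a \<Rightarrow> 'a" where
  "decorate d = (if d = Plain then id else \<tau>)"

lemma linear_decorate: "linear (decorate d)"
  by (simp add: decorate_def tau_linear linear_id)

lemma linear_descent_map: "linear (descent_map D)"
proof -
  have 1: "linear (tensor_maps (map (\<lambda>(e, d). if d = Plain then tensor1 else tensor1 \<circ> \<tau>) D))"
    using linear_tensor1 linear_compose[OF tau_linear linear_tensor1]
    by (intro linear_tensor_maps) (auto split: if_splits)
  have 2: "linear (tensor_maps (map (\<lambda>e. tensor1 \<circ> hcomp e) (undecorate D)))"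
    using linear_compose[OF linear_homogeneous_component linear_tensor1]
    by (intro linear_tensor_maps) auto
  show ?thesis
    unfolding descent_map_def
    by (rule linear_compose2[OF linear_tensor_multiply linear_compose2[OF 1 2]])
qed

lemma descent_map_tensor:
  assumes "length zs = length D"
  shows "descent_map D (tensor zs)
    = prod_list (map (\<lambda>i. decorate (snd (D ! i)) (hcomp (fst (D ! i)) (zs ! i))) [0..<length D])"
proof -
  have 1: "map (\<lambda>e. tensor1 \<circ> hcomp e) (undecorate D)
    = map (\<lambda>f. tensor1 \<circ> f) (map (hcomp) (undecorate D))" by simp
  have 2: "map (\<lambda>(e, d). if d = Plain then tensor1 else tensor1 \<circ> \<tau>) D
    = map (\<lambda>f. tensor1 \<circ> f) (map (decorate \<circ> snd) D)"
    by (auto simp: decorate_def)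
  have l1: "\<And>f. f \<in> set (map (hcomp) (undecorate D)) \<Longrightarrow> linear f"
    using linear_homogeneous_component by auto
  have l2: "\<And>f. f \<in> set (map (decorate \<circ> snd) D) \<Longrightarrow> linear f"
    using linear_decorate by auto
  have l3: "tensor_maps (map (\<lambda>f. tensor1 \<circ> f) (map (decorate \<circ> snd) D)) (tensor vs)
    = tensor (map2 (\<lambda>f x. f x) (map (decorate \<circ> snd) D) vs)" if "length vs = length D" for vs
    by (rule tensor_maps_endo[OF l2]) (use that in simp_all)
  have len: "length zs = length (map (hcomp) (undecorate D))"
    using assms by (simp add: undecorate_def)
  have l4: "tensor_maps (map (\<lambda>f. tensor1 \<circ> f) (map (hcomp) (undecorate D))) (tensor zs)
    = tensor (map2 (\<lambda>f x. f x) (map (hcomp) (undecorate D)) zs)"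
    by (rule tensor_maps_endo[OF l1 len])
  have "descent_map D (tensor zs) = prod_list (map2 (\<lambda>f x. f x) (map (decorate \<circ> snd) D)
      (map2 (\<lambda>f x. f x) (map (hcomp) (undecorate D)) zs))"
    unfolding descent_map_def 1 2 l4
    by (subst l3) (use assms in \<open>simp_all add: undecorate_def\<close>)
  also have "map2 (\<lambda>f x. f x) (map (decorate \<circ> snd) D)
      (map2 (\<lambda>f x. f x) (map (hcomp) (undecorate D)) zs)
    = map (\<lambda>i. decorate (snd (D ! i)) (hcomp (fst (D ! i)) (zs ! i))) [0..<length D]"
    using assms by (intro nth_equalityI) (auto simp: undecorate_def)
  finally show ?thesis .
qed

lemma prod_list_in_aug: "(\<And>i. i < l \<Longrightarrow> z i \<in> aug (k i)) \<Longrightarrow> prod_list (map z [0..<l]) \<in> aug (\<Sum>i<l. k i)"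
proof (induction l)
  case 0
  then show ?case using hword_in_aug[of "[]" 0] by simp
next
  case (Suc l)
  then show ?case using aug_mult[of "prod_list (map z [0..<l])" "\<Sum>i<l. k i" "z l" "k l"] by simp
qed

lemma prod_list_in_H: "(\<And>i. i < l \<Longrightarrow> z i \<in> H (k i)) \<Longrightarrow> prod_list (map z [0..<l]) \<in> H (\<Sum>i<l. k i)"
proof (induction l)
  case 0
  then show ?case by (simp add: one_in_H0)
next
  case (Suc l)
  then show ?case using mult_graded[of "prod_list (map z [0..<l])" "\<Sum>i<l. k i" "z l" "k l"] by simp
qed

lemma decorate_aug: "x \<in> aug k \<Longrightarrow> decorate d x \<in> aug k"
  and decorate_H: "x \<in> H n \<Longrightarrow> decorate d x \<in> H n"
  by (auto simp: decorate_def tau_aug tau_in_H)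

text \<open>Homogeneous projections and \<open>\<tau>\<close> preserve each power of the
  augmentation ideal, and multiplication adds the exponents up.\<close>

lemma descent_map_taug:
  assumes "t \<in> taug (length D) k"
  shows "descent_map D t \<in> aug k"
proof -
  let ?S = "{tensor (map eval_word ws) | ws. length ws = length D \<and> (\<forall>w\<in>set ws. hword w) \<and>
    k \<le> length (concat ws)}"
  have "descent_map D s \<in> aug k" if "s \<in> ?S" for s
  proof -
    obtain ws where s: "s = tensor (map eval_word ws)"
      and ws: "length ws = length D" "\<forall>w\<in>set ws. hword w" "k \<le> length (concat ws)"
      using \<open>s \<in> ?S\<close> by blast
    have "descent_map D (tensor (map eval_word ws)) \<in> aug (\<Sum>i<length D. length (ws ! i))"
      unfolding descent_map_tensor[of "map eval_word ws" D, simplified, OF ws(1)]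
    proof (rule prod_list_in_aug)
      fix i assume i: "i < length D"
      then have "eval_word (ws ! i) \<in> aug (length (ws ! i))" using ws by (intro hword_in_aug) auto
      then show "decorate (snd (D ! i)) (hcomp (fst (D ! i)) (map eval_word ws ! i)) \<in> aug (length (ws ! i))"
        using i ws(1) aug_component_in by (intro decorate_aug) auto
    qed
    moreover have "(\<Sum>i<length D. length (ws ! i)) = length (concat ws)"
      using ws(1) by (simp add: length_concat sum_list_sum_nth atLeast0LessThan)
    ultimately show ?thesis
      using ws(3) aug_antimono s by auto
  qed
  then have "span ?S \<subseteq> descent_map D -` aug k"
    by (intro span_minimal linear_subspace_vimage[OF linear_descent_map subspace_aug]) blast
  then show ?thesis using assms unfolding taug_def by blast
qed

lemma descent_op_in_H: "dop D x \<in> H (sum_list (undecorate D))"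
proof -
  let ?n = "sum_list (undecorate D)"
  have "descent_map D s \<in> H ?n" if "s \<in> {tensor zs | zs. length zs = length D}" for s
  proof -
    obtain zs where s: "s = tensor zs" and zs: "length zs = length D"
      using \<open>s \<in> _\<close> by blast
    have "descent_map D (tensor zs) \<in> H (\<Sum>i<length D. fst (D ! i))"
      unfolding descent_map_tensor[OF zs] by (intro prod_list_in_H decorate_H component_in)
    then show ?thesis
      by (simp add: s undecorate_def sum_list_sum_nth atLeast0LessThan)
  qed
  then have "span {tensor zs | zs. length zs = length D} \<subseteq> descent_map D -` H ?n"
    by (intro span_minimal linear_subspace_vimage[OF linear_descent_map subspace_H]) blast
  then show ?thesis
    using iterated_coproduct_in_span[of "length D" x] by (auto simp: descent_op_eq)
qed

lemma linear_descent_op: "linear (dop D)"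
  unfolding descent_op_eq by (rule linear_compose2[OF linear_descent_map linear_iterated_coproduct])

text \<open>The scalar with which the term of a labelling survives the homogeneous projections and
  the action of \<open>\<tau>\<close> on the decorated slots.\<close>

definition coef :: "decorated_composition \<Rightarrow> nat list \<Rightarrow> 'a list \<Rightarrow> real" where
  "coef D cs xs = (\<Prod>i<length D. if sum_list (map deg (block i cs xs)) = fst (D ! i)
     then if snd (D ! i) = Plain then 1 else prod_list (map sg (block i cs xs)) else 0)"

lemma tau_gens_word:
  assumes "set xs \<subseteq> gens"
  shows "\<tau> (prod_list xs) = prod_list (map sg xs) *\<^sub>R prod_list (rev_if xs)"
proof -
  have "map \<tau> (rev_if xs) = map (\<lambda>x. sg x *\<^sub>R x) (rev_if xs)" using assms gens_tau by auto
  then have "\<tau> (prod_list xs) = prod_list (map (\<lambda>x. sg x *\<^sub>R x) (rev_if xs))"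
    by (simp only: tau_prod_list rev_if_map)
  also have "\<dots> = prod_list (map sg (rev_if xs)) *\<^sub>R prod_list (rev_if xs)"
    by (simp add: prod_list_scaleR)
  also have "prod_list (map sg (rev_if xs)) = prod_list (map sg xs)"
    by (simp add: mset_map prod_mset_prod_list[symmetric])
  finally show ?thesis .
qed

text \<open>Reversing inside slots and concatenating the slots only permute letters, so a
  rearrangement of the original word comes out.\<close>

lemma descent_map_blocks:
  assumes xs: "set xs \<subseteq> gens" and cs: "cs \<in> labellings (length D) (length xs)"
  shows "\<exists>ys. mset ys = mset xs \<and>
    descent_map D (tensor (map (\<lambda>i. prod_list (block i cs xs)) [0..<length D])) = coef D cs xs *\<^sub>R prod_list ys"
proof -
  let ?b = "\<lambda>i. block i cs xs"
  let ?r = "\<lambda>i. if snd (D ! i) = Plain then ?b i else rev_if (?b i)"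
  let ?c = "\<lambda>i. if sum_list (map deg (?b i)) = fst (D ! i)
     then if snd (D ! i) = Plain then 1 else prod_list (map sg (?b i)) else 0"
  have bx: "set (?b i) \<subseteq> gens" for i
    using xs by (auto simp: block_def dest: set_zip_rightD)
  have bH: "prod_list (?b i) \<in> H (sum_list (map deg (?b i)))" for i
    using pword_degree[OF pword_gword[OF bx]] by (simp add: gword_def comp_def)
  have g: "decorate (snd (D ! i)) (hcomp (fst (D ! i)) (prod_list (?b i))) = ?c i *\<^sub>R prod_list (?r i)" for i
    unfolding component_homogeneous[OF bH]
    by (auto simp: decorate_def tau_gens_word[OF bx] linear_0[OF tau_linear])
  have "descent_map D (tensor (map (\<lambda>i. prod_list (?b i)) [0..<length D]))
    = prod_list (map (\<lambda>i. ?c i *\<^sub>R prod_list (?r i)) [0..<length D])"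
    by (subst descent_map_tensor) (auto simp: g intro!: arg_cong[of _ _ prod_list])
  also have "\<dots> = coef D cs xs *\<^sub>R prod_list (concat (map ?r [0..<length D]))"
    by (simp only: prod_list_scaleR prod_list_map_upt coef_def)
      (simp add: prod_list_concat comp_def)
  finally have 1: "descent_map D (tensor (map (\<lambda>i. prod_list (?b i)) [0..<length D]))
    = coef D cs xs *\<^sub>R prod_list (concat (map ?r [0..<length D]))" .
  have "map mset (map ?r [0..<length D]) = map mset (map ?b [0..<length D])" by simp
  then have "mset (concat (map ?r [0..<length D])) = mset (concat (map ?b [0..<length D]))"
    by (simp only: mset_concat)
  then show ?thesis using 1 mset_concat_blocks[OF cs] by (intro exI[of _ "concat (map ?r [0..<length D])"]) simp
qed

definition diag :: "decorated_composition \<Rightarrow> 'a multiset \<Rightarrow> real" where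
  "diag D M = (\<Sum>cs\<in>labellings (length D) (size M). coef D cs (list_of M))"

lemma permuted_in_span_lower:
  assumes M: "M \<in> mon n" and ys: "mset ys = M"
  shows "prod_list ys - monomial M \<in> span (monomial ` lower (mlev M) (size M) n)"
proof -
  have g: "set ys \<subseteq> gens" using M ys by (auto simp: mon_def)
  have "eval_word (gword ys) - eval_word (gword (list_of M))
    \<in> shorter (level (gword ys)) (length (gword ys)) (degr (gword ys))"
    using ys by (intro pword_permute pword_gword g) simp
  then have "prod_list ys - monomial M \<in> shorter (mlev M) (size M) n"
    using M ys by (simp add: level_gword degr_gword mon_def monomial_def) (metis size_mset)
  then show ?thesis by (rule shorter_in_span_lower)
qed

text \<open>Two kinds of error arise: the remainder of the iterated coproduct, which is sent into
  the next power, and the rearrangement of the letters, which is lower by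
  \<open>permuted_in_span_lower\<close>.\<close>

lemma descent_op_triangular:
  assumes M: "M \<in> mon n" and D: "weak_composition n (undecorate D)"
  shows "dop D (monomial M) - diag D M *\<^sub>R monomial M
    \<in> span (monomial ` lower (mlev M) (size M) n)" (is "_ \<in> ?L")
proof -
  let ?l = "length D" and ?xs = "list_of M"
  let ?\<Delta> = "cop ?l (monomial M)"
  let ?t = "\<lambda>cs. tensor (map (\<lambda>i. prod_list (block i cs ?xs)) [0..<?l])"
  let ?B = "\<Sum>cs\<in>labellings ?l (size M). ?t cs"
  note lin = linear_descent_map[of D]
  have xs: "set ?xs \<subseteq> gens" using M by (simp add: mon_def)
  have B: "descent_map D (?t cs) - coef D cs ?xs *\<^sub>R monomial M \<in> ?L"
    and BH: "descent_map D (?t cs) \<in> H n"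
    if cs: "cs \<in> labellings ?l (size M)" for cs
  proof -
    have "cs \<in> labellings ?l (length ?xs)" using cs by simp
    from descent_map_blocks[OF xs this]
    obtain ys where ys: "mset ys = M" "descent_map D (?t cs) = coef D cs ?xs *\<^sub>R prod_list ys" by auto
    have "coef D cs ?xs *\<^sub>R (prod_list ys - monomial M) \<in> ?L"
      by (intro span_scale permuted_in_span_lower M ys)
    then show "descent_map D (?t cs) - coef D cs ?xs *\<^sub>R monomial M \<in> ?L"
      by (simp add: ys(2) scaleR_diff_right)
    have "set ys \<subseteq> gens" using ys(1) M by (auto simp: mon_def)
    from pword_degree[OF pword_gword[OF this]] have "prod_list ys \<in> H n"
      using ys(1) M by (simp add: degr_gword mon_def)
    then show "descent_map D (?t cs) \<in> H n"
      unfolding ys(2) by (rule subspace_scale[OF subspace_H])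
  qed
  have "?\<Delta> - ?B \<in> taug ?l (Suc (mlev M))"
    using iterated_coproduct_pword(2)[OF pword_gword[OF xs], of ?l]
    by (simp add: level_gword) (simp add: gword_def block_map comp_def monomial_def)
  then have 1: "descent_map D (?\<Delta> - ?B) \<in> aug (Suc (mlev M))" by (rule descent_map_taug)
  have "descent_map D (?\<Delta> - ?B) = dop D (monomial M) - (\<Sum>cs\<in>labellings ?l (size M). descent_map D (?t cs))"
    by (simp add: linear_diff[OF lin] linear_sum[OF lin] descent_op_eq)
  \<comment> \<open>The next power is expanded in lower monomials one degree at a time, so the
    difference has to be homogeneous.\<close>
  moreover have "\<dots> \<in> H n"
    using descent_op_in_H[of D] D BH
    by (intro subspace_diff[OF subspace_H] subspace_sum[OF subspace_H]) (auto simp: weak_composition_def)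
  ultimately have "dop D (monomial M) - (\<Sum>cs\<in>labellings ?l (size M). descent_map D (?t cs)) \<in> ?L"
    using 1 by (intro aug_in_span_lower) simp_all
  moreover have "(\<Sum>cs\<in>labellings ?l (size M). descent_map D (?t cs) - coef D cs ?xs *\<^sub>R monomial M) \<in> ?L"
    by (intro span_sum B)
  ultimately have "(dop D (monomial M) - (\<Sum>cs\<in>labellings ?l (size M). descent_map D (?t cs)))
    + (\<Sum>cs\<in>labellings ?l (size M). descent_map D (?t cs) - coef D cs ?xs *\<^sub>R monomial M) \<in> ?L"
    by (rule span_add)
  then show ?thesis by (simp add: sum_subtractf diag_def scaleR_sum_left)
qed

text \<open>This yields the trace of \<open>\<tau>\<close> on \<open>H n\<close>, hence the second
  dimension series.\<close>

lemma tau_triangular: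
  assumes M: "M \<in> mon n"
  shows "\<tau> (monomial M) - prod_mset (image_mset sg M) *\<^sub>R monomial M
    \<in> span (monomial ` lower (mlev M) (size M) n)"
proof -
  let ?xs = "list_of M"
  have xs: "set ?xs \<subseteq> gens" using M by (simp add: mon_def)
  have p: "prod_list (map sg ?xs) = prod_mset (image_mset sg M)"
    by (metis mset_list_of mset_map prod_mset_prod_list)
  have "prod_mset (image_mset sg M) *\<^sub>R (prod_list (rev_if ?xs) - monomial M)
    \<in> span (monomial ` lower (mlev M) (size M) n)"
    by (intro span_scale permuted_in_span_lower M) simp
  then show ?thesis
    unfolding monomial_def tau_gens_word[OF xs] p by (simp add: scaleR_diff_right)
qed

text \<open>Turns the triangular order into a natural number: the level enters reversed, and
  \<open>Suc n\<close> exceeds every size that occurs in degree \<open>n\<close>.\<close>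

definition key :: "nat \<Rightarrow> 'a multiset \<Rightarrow> nat" where
  "key n M = (n - mlev M) * Suc n + size M"

lemma lower_key:
  assumes "M \<in> mon n"
  shows "lower (mlev M) (size M) n \<subseteq> {N \<in> mon n. key n N < key n M}"
proof
  fix N assume "N \<in> lower (mlev M) (size M) n"
  then have N: "N \<in> mon n" "mlev M < mlev N \<or> mlev N = mlev M \<and> size N < size M" by (auto simp: lower_def)
  have "key n N < key n M" if "mlev M < mlev N"
  proof -
    have "Suc (n - mlev N) * Suc n \<le> (n - mlev M) * Suc n"
      using mlev_le[OF N(1)] that by (intro mult_le_mono1) simp
    then show ?thesis using mon_size[OF N(1)] by (simp add: key_def)
  qed
  then show "N \<in> {N \<in> mon n. key n N < key n M}" using N by (auto simp: key_def)
qed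

lemma triangular_spectrum:
  assumes "linear f"
    and "\<And>M. M \<in> mon n \<Longrightarrow> f (monomial M) - d M *\<^sub>R monomial M \<in> span (monomial ` lower (mlev M) (size M) n)"
  shows "has_char_poly (H n) f (\<Prod>M\<in>mon n. [:- d M, 1:])" "eigenvalues (H n) f = d ` mon n"
proof -
  have tri: "f (monomial M) - d M *\<^sub>R monomial M \<in> span (monomial ` {N \<in> mon n. key n N < key n M})"
    if "M \<in> mon n" for M
    using assms(2)[OF that] span_mono[OF image_mono[OF lower_key[OF that], of monomial]] by blast
  note t = eigenvalues_triangular[OF finite_mon monomials_independent span_monomials assms(1) tri]
  show "has_char_poly (H n) f (\<Prod>M\<in>mon n. [:- d M, 1:])" "eigenvalues (H n) f = d ` mon n"
    by (rule t; assumption)+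
qed

end

section \<open>Labellings and set-compositions\<close>

lemma block_eq_nth:
  assumes "length cs = length ys"
  shows "block i cs ys = map (\<lambda>j. ys ! j) (filter (\<lambda>j. cs ! j = i) [0..<length ys])"
proof -
  have "zip cs ys = map (\<lambda>j. (cs ! j, ys ! j)) [0..<length ys]"
    using assms by (intro nth_equalityI) auto
  then show ?thesis by (simp add: block_def filter_map comp_def)
qed

lemma sum_list_block:
  assumes "length cs = length ys"
  shows "sum_list (map f (block i cs ys)) = (\<Sum>j | j < length ys \<and> cs ! j = i. f (ys ! j))"
proof -
  have "sum_list (map f (block i cs ys)) = sum_list (map (\<lambda>j. f (ys ! j)) (filter (\<lambda>j. cs ! j = i) [0..<length ys]))"
    by (simp add: block_eq_nth[OF assms] comp_def)
  also have "\<dots> = (\<Sum>j\<in>set (filter (\<lambda>j. cs ! j = i) [0..<length ys]). f (ys ! j))"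
    by (rule sum_list_distinct_conv_sum_set) simp
  finally show ?thesis by (simp add: conj_commute)
qed

lemma prod_list_block:
  assumes "length cs = length ys"
  shows "prod_list (map f (block i cs ys)) = (\<Prod>j | j < length ys \<and> cs ! j = i. f (ys ! j) :: 'c::comm_monoid_mult)"
proof -
  have "prod_list (map f (block i cs ys)) = prod_list (map (\<lambda>j. f (ys ! j)) (filter (\<lambda>j. cs ! j = i) [0..<length ys]))"
    by (simp add: block_eq_nth[OF assms] comp_def)
  also have "\<dots> = (\<Prod>j\<in>set (filter (\<lambda>j. cs ! j = i) [0..<length ys]). f (ys ! j))"
    by (rule prod.distinct_set_conv_list[symmetric]) simp
  finally show ?thesis by (simp add: conj_commute)
qed

lemma labellings_nth: "cs \<in> labellings l m \<Longrightarrow> j < m \<Longrightarrow> cs ! j < l"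
  unfolding labellings_def using nth_mem by blast

definition set_compositions :: "nat \<Rightarrow> 'b set \<Rightarrow> 'b set list set" where
  "set_compositions l A = {B. length B = l \<and> \<Union>(set B) = A \<and>
     (\<forall>i<length B. \<forall>k<length B. i \<noteq> k \<longrightarrow> B ! i \<inter> B ! k = {})}"

definition label_sets :: "(nat \<Rightarrow> 'b) \<Rightarrow> nat \<Rightarrow> nat list \<Rightarrow> 'b set list" where
  "label_sets el l cs = map (\<lambda>i. el ` {j. j < length cs \<and> cs ! j = i}) [0..<l]"

text \<open>A labelling is a map to the slots, and the set-composition is its list of fibres, empty
  ones included.\<close>

lemma bij_label_sets:
  assumes inj: "inj_on el {..<m}" and A: "el ` {..<m} = A"
  shows "bij_betw (label_sets el l) (labellings l m) (set_compositions l A)"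
proof (rule bij_betwI')
  fix cs ds assume cs: "cs \<in> labellings l m" and ds: "ds \<in> labellings l m"
  have len: "length cs = m" "length ds = m" using cs ds by (auto simp: labellings_def)
  show "label_sets el l cs = label_sets el l ds \<longleftrightarrow> cs = ds"
  proof
    assume e: "label_sets el l cs = label_sets el l ds"
    show "cs = ds"
    proof (rule nth_equalityI)
      fix j assume "j < length cs"
      then have j: "j < m" by (simp add: len)
      then have i: "cs ! j < l" using labellings_nth[OF cs] by simp
      have "el j \<in> label_sets el l cs ! (cs ! j)" using i j by (simp add: label_sets_def len)
      then have "el j \<in> label_sets el l ds ! (cs ! j)" by (simp only: e)
      then have "el j \<in> el ` {k. k < m \<and> ds ! k = cs ! j}" using i by (simp add: label_sets_def len)
      then show "cs ! j = ds ! j" using inj_onD[OF inj, of j] j by auto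
    qed (simp add: len)
  qed simp
next
  fix cs assume cs: "cs \<in> labellings l m"
  then have len: "length cs = m" by (simp add: labellings_def)
  have "(\<Union>i<l. el ` {j. j < m \<and> cs ! j = i}) = A"
    using labellings_nth[OF cs] by (auto simp: A[symmetric])
  moreover have "el ` {j. j < m \<and> cs ! j = i} \<inter> el ` {j. j < m \<and> cs ! j = k} = {}" if "i \<noteq> k" for i k
    using that inj_onD[OF inj] by fastforce
  ultimately show "label_sets el l cs \<in> set_compositions l A"
    by (simp add: set_compositions_def label_sets_def len atLeast0LessThan)
next
  fix B assume B: "B \<in> set_compositions l A"
  then have len: "length B = l" and un: "\<Union>(set B) = A"
    and dj: "\<And>i k. i < l \<Longrightarrow> k < l \<Longrightarrow> i \<noteq> k \<Longrightarrow> B ! i \<inter> B ! k = {}"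
    by (auto simp: set_compositions_def)
  have "\<exists>i<l. el j \<in> B ! i" if "j < m" for j
  proof -
    have "el j \<in> \<Union>(set B)" unfolding un using that A by auto
    then show ?thesis using len by (auto simp: in_set_conv_nth)
  qed
  then obtain f where f: "\<And>j. j < m \<Longrightarrow> f j < l \<and> el j \<in> B ! f j" by metis
  have uniq: "el j \<in> B ! i \<longleftrightarrow> f j = i" if "j < m" "i < l" for i j
    using f[OF that(1)] dj[of "f j" i] that(2) by auto
  have "el ` {j. j < m \<and> f j = i} = B ! i" if i: "i < l" for i
  proof -
    have "B ! i \<subseteq> el ` {..<m}" unfolding A using un i len nth_mem[of i B] by blast
    then show ?thesis using uniq[OF _ i] by blast
  qed
  then have "B = label_sets el l (map f [0..<m])"
    by (intro nth_equalityI) (auto simp: label_sets_def len cong: conj_cong)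
  moreover have "map f [0..<m] \<in> labellings l m" using f by (auto simp: labellings_def)
  ultimately show "\<exists>cs\<in>labellings l m. B = label_sets el l cs" by blast
qed

lemma part_sum:
  assumes "rev (sorted_list_of_multiset L) = as"
  shows "(\<Sum>j\<in>Suc ` J. part L j) = (\<Sum>j\<in>J. as ! j)"
  using assms by (simp add: sum.reindex part_def)

text \<open>Rewrites the signed count of set-compositions as a sum over labellings of a single list,
  unbarred parts first, so that it can be compared with \<open>diag\<close> term by term.\<close>

lemma beta_eq_labellings:
  assumes as: "as = rev (sorted_list_of_multiset L)" and bs: "bs = rev (sorted_list_of_multiset L')"
  shows "beta D L L' = (\<Sum>cs\<in>labellings (length D) (length as + length bs).
    if \<forall>i<length D. (\<Sum>j | j < length as + length bs \<and> cs ! j = i. (as @ bs) ! j) = fst (D ! i)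
    then (- 1) ^ card {j. j < length bs \<and> snd (D ! (cs ! (length as + j))) \<noteq> Plain} else 0)"
proof -
  let ?p = "length as" and ?q = "length bs" and ?l = "length D"
  let ?ok = "\<lambda>cs. \<forall>i<?l. (\<Sum>j | j < ?p + ?q \<and> cs ! j = i. (as @ bs) ! j) = fst (D ! i)"
  let ?A = "Inl ` {1..?p} \<union> Inr ` {1..?q} :: (nat + nat) set"
  let ?t = "\<lambda>B. if \<forall>i<?l. (\<Sum>j | Inl j \<in> B ! i. part L j) + (\<Sum>j | Inr j \<in> B ! i. part L' j) = fst (D ! i)
      then (- 1 :: real) ^ decorated_bars D B else 0"
  have size: "size L = ?p" "size L' = ?q"
    by (simp_all add: as bs) (metis mset_sorted_list_of_multiset size_mset)+
  \<comment> \<open>List positions start at 0 while \<open>part\<close> numbers from 1; positions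
    from \<open>?p\<close> on stand for the barred elements.\<close>
  define el where "el j = (if j < ?p then Inl (Suc j) else Inr (Suc (j - ?p)))" for j
  have bij: "bij_betw (label_sets el ?l) (labellings ?l (?p + ?q)) (set_compositions ?l ?A)"
  proof (rule bij_label_sets)
    show "inj_on el {..<?p + ?q}" by (auto simp: inj_on_def el_def split: if_splits)
    show "el ` {..<?p + ?q} = ?A"
    proof (intro equalityI subsetI)
      fix x assume "x \<in> ?A"
      then consider j where "x = Inl j" "1 \<le> j" "j \<le> ?p" | j where "x = Inr j" "1 \<le> j" "j \<le> ?q" by auto
      then show "x \<in> el ` {..<?p + ?q}"
      proof cases
        case (1 j)
        then show ?thesis by (intro image_eqI[of _ _ "j - 1"]) (auto simp: el_def)
      next
        case (2 j)
        then show ?thesis by (intro image_eqI[of _ _ "?p + (j - 1)"]) (auto simp: el_def)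
      qed
    qed (auto simp: el_def split: if_splits)
  qed
  have Inl: "{j. Inl j \<in> el ` {j. j < ?p + ?q \<and> cs ! j = i}} = Suc ` {j. j < ?p \<and> cs ! j = i}" for cs i
    by (auto simp: el_def image_iff split: if_splits intro: trans_less_add1)
  have Inr: "{j. Inr j \<in> el ` {j. j < ?p + ?q \<and> cs ! j = i}} = Suc ` {j. j < ?q \<and> cs ! (?p + j) = i}" for cs i
  proof (intro equalityI subsetI)
    fix x assume "x \<in> Suc ` {j. j < ?q \<and> cs ! (?p + j) = i}"
    then obtain j where j: "x = Suc j" "j < ?q" "cs ! (?p + j) = i" by blast
    then have "Inr x = el (?p + j)" by (simp add: el_def)
    then show "x \<in> {j. Inr j \<in> el ` {j. j < ?p + ?q \<and> cs ! j = i}}" using j by auto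
  next
    fix x assume "x \<in> {j. Inr j \<in> el ` {j. j < ?p + ?q \<and> cs ! j = i}}"
    then obtain k where "Inr x = el k" "k < ?p + ?q" "cs ! k = i" by blast
    then show "x \<in> Suc ` {j. j < ?q \<and> cs ! (?p + j) = i}"
      by (intro image_eqI[of _ _ "k - ?p"]) (auto simp: el_def split: if_splits)
  qed
  have ls: "label_sets el ?l cs ! i = el ` {j. j < ?p + ?q \<and> cs ! j = i}"
    if "cs \<in> labellings ?l (?p + ?q)" "i < ?l" for cs i
    using that by (simp add: label_sets_def labellings_def)
  have sums: "(\<Sum>j | Inl j \<in> el ` {j. j < ?p + ?q \<and> cs ! j = i}. part L j)
      + (\<Sum>j | Inr j \<in> el ` {j. j < ?p + ?q \<and> cs ! j = i}. part L' j)
    = (\<Sum>j | j < ?p + ?q \<and> cs ! j = i. (as @ bs) ! j)" for cs i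
  proof -
    have split: "{j. j < ?p + ?q \<and> cs ! j = i} = {j. j < ?p \<and> cs ! j = i} \<union> (\<lambda>j. ?p + j) ` {j. j < ?q \<and> cs ! (?p + j) = i}"
      by (auto simp: image_iff) (metis add_diff_inverse_nat nat_add_left_cancel_less)
    have "(\<Sum>j | j < ?p + ?q \<and> cs ! j = i. (as @ bs) ! j)
      = (\<Sum>j | j < ?p \<and> cs ! j = i. (as @ bs) ! j) + (\<Sum>j\<in>(\<lambda>j. ?p + j) ` {j. j < ?q \<and> cs ! (?p + j) = i}. (as @ bs) ! j)"
      unfolding split by (rule sum.union_disjoint) auto
    also have "(\<Sum>j | j < ?p \<and> cs ! j = i. (as @ bs) ! j) = (\<Sum>j | j < ?p \<and> cs ! j = i. as ! j)"
      by (rule sum.cong) (auto simp: nth_append)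
    also have "(\<Sum>j\<in>(\<lambda>j. ?p + j) ` {j. j < ?q \<and> cs ! (?p + j) = i}. (as @ bs) ! j)
      = (\<Sum>j | j < ?q \<and> cs ! (?p + j) = i. bs ! j)"
      by (subst sum.reindex) (auto simp: nth_append)
    finally show ?thesis
      unfolding Inl Inr part_sum[OF as[symmetric]] part_sum[OF bs[symmetric]] by simp
  qed
  have bars: "decorated_bars D (label_sets el ?l cs) = card {j. j < ?q \<and> snd (D ! (cs ! (?p + j))) \<noteq> Plain}"
    if cs: "cs \<in> labellings ?l (?p + ?q)" for cs
  proof -
    have "{j. \<exists>i<?l. snd (D ! i) \<noteq> Plain \<and> Inr j \<in> label_sets el ?l cs ! i}
      = (\<Union>i\<in>{i. i < ?l \<and> snd (D ! i) \<noteq> Plain}. {j. Inr j \<in> el ` {j. j < ?p + ?q \<and> cs ! j = i}})"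
      by (auto simp: ls[OF cs])
    also have "\<dots> = Suc ` {j. j < ?q \<and> snd (D ! (cs ! (?p + j))) \<noteq> Plain}"
      unfolding Inr image_UN[symmetric] using labellings_nth[OF cs] by (intro arg_cong[of _ _ "image Suc"]) auto
    finally show ?thesis by (simp add: decorated_bars_def card_image)
  qed
  have "compatible_set_compositions L L' (undecorate D) = {B \<in> set_compositions ?l ?A.
      \<forall>i<?l. (\<Sum>j | Inl j \<in> B ! i. part L j) + (\<Sum>j | Inr j \<in> B ! i. part L' j) = fst (D ! i)}"
    by (auto simp: compatible_set_compositions_def set_compositions_def undecorate_def size)
  moreover have fin: "finite (set_compositions ?l ?A)"
    using bij_betw_finite[OF bij] finite_labellings by blast
  ultimately have "beta D L L' = (\<Sum>B\<in>set_compositions ?l ?A. ?t B)"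
    unfolding beta_def by (simp only: sum.inter_filter)
  also have "\<dots> = (\<Sum>cs\<in>labellings ?l (?p + ?q). ?t (label_sets el ?l cs))"
    by (rule sum.reindex_bij_betw[OF bij, symmetric])
  also have "\<dots> = (\<Sum>cs\<in>labellings ?l (?p + ?q). if ?ok cs
      then (- 1) ^ card {j. j < ?q \<and> snd (D ! (cs ! (?p + j))) \<noteq> Plain} else 0)"
    by (rule sum.cong[OF refl]) (simp only: bars, simp add: ls sums)
  finally show ?thesis .
qed

context hopf_involution
begin

section \<open>Diagonal entries as values of beta\<close>

definition plus_degs :: "'a multiset \<Rightarrow> nat multiset" where
  "plus_degs M = image_mset deg {#x \<in># M. sg x = 1#}"

definition minus_degs :: "'a multiset \<Rightarrow> nat multiset" where
  "minus_degs M = image_mset deg {#x \<in># M. sg x \<noteq> 1#}"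

lemma list_of_split:
  obtains as bs where "list_of M = as @ bs" "map deg as = rev (sorted_list_of_multiset (plus_degs M))"
    "map deg bs = rev (sorted_list_of_multiset (minus_degs M))"
    "\<And>x. x \<in> set as \<Longrightarrow> sg x = 1" "\<And>x. x \<in> set bs \<Longrightarrow> sg x = - 1"
proof -
  have ms: "mset (SOME xs. mset xs = N) = N" for N :: "'a multiset"
    by (rule someI_ex) (rule ex_mset)
  define S where "S N = sort_key deg (SOME xs. mset xs = N)" for N
  have mS: "mset (S N) = N" for N by (simp add: S_def ms)
  have deg: "map deg (S N) = sorted_list_of_multiset (image_mset deg N)" for N
  proof -
    have "sort (map deg (S N)) = map deg (S N)" by (rule sorted_sort_id) (simp add: S_def)
    moreover have "sorted_list_of_multiset (mset (map deg (S N))) = sort (map deg (S N))"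
      by (rule sorted_list_of_multiset_mset)
    ultimately show ?thesis by (simp add: mS)
  qed
  show ?thesis
  proof (rule that)
    show "list_of M = rev (S {#x \<in># M. sg x = 1#}) @ rev (S {#x \<in># M. sg x \<noteq> 1#})"
      by (simp add: list_of_def S_def)
    show "map deg (rev (S {#x \<in># M. sg x = 1#})) = rev (sorted_list_of_multiset (plus_degs M))"
      by (simp add: rev_map[symmetric] deg plus_degs_def)
    show "map deg (rev (S {#x \<in># M. sg x \<noteq> 1#})) = rev (sorted_list_of_multiset (minus_degs M))"
      by (simp add: rev_map[symmetric] deg minus_degs_def)
    show "sg x = 1" if "x \<in> set (rev (S {#x \<in># M. sg x = 1#}))" for x
      using that mS[of "{#x \<in># M. sg x = 1#}"] by (simp flip: set_mset_mset)
    show "sg x = - 1" if "x \<in> set (rev (S {#x \<in># M. sg x \<noteq> 1#}))" for x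
      using that mS[of "{#x \<in># M. sg x \<noteq> 1#}"] sg_cases[of x] by (simp flip: set_mset_mset)
  qed
qed

text \<open>The degree conditions of \<open>coef\<close> are the compatibility conditions on a
  set-composition, and the signs collected in decorated slots amount to one factor -1 for each
  generator of sign -1 placed there.\<close>

lemma diag_eq_beta: "diag D M = beta D (plus_degs M) (minus_degs M)"
proof -
  obtain as bs where xs: "list_of M = as @ bs"
    and as: "map deg as = rev (sorted_list_of_multiset (plus_degs M))"
    and bs: "map deg bs = rev (sorted_list_of_multiset (minus_degs M))"
    and sg: "\<And>x. x \<in> set as \<Longrightarrow> sg x = 1" "\<And>x. x \<in> set bs \<Longrightarrow> sg x = - 1"
    using list_of_split[of M] by metis
  let ?l = "length D" and ?p = "length as" and ?q = "length bs"
  have len: "size M = ?p + ?q" using length_list_of[of M] by (simp add: xs del: length_list_of)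
  have "coef D cs (list_of M) = (if \<forall>i<?l. (\<Sum>j | j < ?p + ?q \<and> cs ! j = i. (map deg as @ map deg bs) ! j) = fst (D ! i)
    then (- 1) ^ card {j. j < ?q \<and> snd (D ! (cs ! (?p + j))) \<noteq> Plain} else 0)"
    if cs: "cs \<in> labellings ?l (?p + ?q)" for cs
  proof -
    have lcs: "length cs = length (list_of M)" using cs by (simp add: labellings_def len)
    have lt: "cs ! j < ?l" if "j < ?p + ?q" for j
      using cs that by (rule labellings_nth)
    have s1: "sum_list (map deg (block i cs (list_of M))) = (\<Sum>j | j < ?p + ?q \<and> cs ! j = i. (map deg as @ map deg bs) ! j)" for i
      unfolding sum_list_block[OF lcs] by (rule sum.cong) (auto simp: len xs simp flip: map_append)
    have s2: "prod_list (map sg (block i cs (list_of M))) = (- 1) ^ card {j. j < ?q \<and> cs ! (?p + j) = i}" for i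
    proof -
      have sgn: "sg (list_of M ! j) = (if j < ?p then 1 else - 1)" if "j < ?p + ?q" for j
        using that sg nth_mem[of j as] nth_mem[of "j - ?p" bs] by (auto simp: xs nth_append)
      have "prod_list (map sg (block i cs (list_of M))) = (\<Prod>j | j < ?p + ?q \<and> cs ! j = i. if j < ?p then 1 else - 1)"
        unfolding prod_list_block[OF lcs] by (rule prod.cong) (auto simp: len sgn)
      also have "\<dots> = (\<Prod>j\<in>(\<lambda>j. ?p + j) ` {j. j < ?q \<and> cs ! (?p + j) = i}. if j < ?p then 1 else - 1)"
      proof (rule prod.mono_neutral_right)
        show "\<forall>j\<in>{j. j < ?p + ?q \<and> cs ! j = i} - (\<lambda>j. ?p + j) ` {j. j < ?q \<and> cs ! (?p + j) = i}.
          (if j < ?p then 1 else - 1 :: real) = 1"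
        proof
          fix j assume j: "j \<in> {j. j < ?p + ?q \<and> cs ! j = i} - (\<lambda>j. ?p + j) ` {j. j < ?q \<and> cs ! (?p + j) = i}"
          have "j < ?p"
          proof (rule ccontr)
            assume "\<not> j < ?p"
            then have "j = ?p + (j - ?p)" "j - ?p < ?q" using j by auto
            then show False using j by (metis (mono_tags, lifting) DiffE imageI mem_Collect_eq)
          qed
          then show "(if j < ?p then 1 else - 1 :: real) = 1" by simp
        qed
      qed auto
      also have "\<dots> = (- 1) ^ card {j. j < ?q \<and> cs ! (?p + j) = i}"
        by (subst prod.reindex) auto
      finally show ?thesis .
    qed
    show ?thesis
    proof (cases "\<forall>i<?l. (\<Sum>j | j < ?p + ?q \<and> cs ! j = i. (map deg as @ map deg bs) ! j) = fst (D ! i)")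
      case False
      then show ?thesis by (auto simp: coef_def s1)
    next
      case True
      then have "coef D cs (list_of M) = (\<Prod>i<?l. if snd (D ! i) = Plain then 1 else (- 1) ^ card {j. j < ?q \<and> cs ! (?p + j) = i})"
        unfolding coef_def s1 s2 by (intro prod.cong) auto
      also have "\<dots> = (\<Prod>i<?l. (- 1) ^ (if snd (D ! i) = Plain then 0 else card {j. j < ?q \<and> cs ! (?p + j) = i}))"
        by (intro prod.cong) auto
      also have "\<dots> = (- 1) ^ (\<Sum>i<?l. if snd (D ! i) = Plain then 0 else card {j. j < ?q \<and> cs ! (?p + j) = i})"
        by (rule power_sum[symmetric])
      also have "(\<Sum>i<?l. if snd (D ! i) = Plain then 0 else card {j. j < ?q \<and> cs ! (?p + j) = i})
        = (\<Sum>i\<in>{i. i < ?l \<and> snd (D ! i) \<noteq> Plain}. card {j. j < ?q \<and> cs ! (?p + j) = i})"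
        by (rule sum.mono_neutral_cong_right) auto
      \<comment> \<open>A letter lies in exactly one slot, so the counts over the decorated slots
        add up to one cardinality.\<close>
      also have "\<dots> = card (\<Union>i\<in>{i. i < ?l \<and> snd (D ! i) \<noteq> Plain}. {j. j < ?q \<and> cs ! (?p + j) = i})"
        by (rule card_UN_disjoint[symmetric]) auto
      also have "(\<Union>i\<in>{i. i < ?l \<and> snd (D ! i) \<noteq> Plain}. {j. j < ?q \<and> cs ! (?p + j) = i})
        = {j. j < ?q \<and> snd (D ! (cs ! (?p + j))) \<noteq> Plain}"
        using lt by auto
      finally show ?thesis by (subst if_P[OF True])
    qed
  qed
  then show ?thesis
    unfolding diag_def beta_eq_labellings[OF as bs] len
    by (intro sum.cong) auto
qed

end

section \<open>Dimensions\<close>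

text \<open>For a sign \<open>d i\<close> the difference \<open>2 - d i\<close> is 1 or 3, and
  \<open>- 2 - d i\<close> is -3 or -1. Evaluating at 2 and at -2 thus counts the two signs as
  exponents of 3.\<close>

lemma prod_sign_eq_power:
  fixes d :: "'i \<Rightarrow> real"
  assumes "finite S" "\<And>i. i \<in> S \<Longrightarrow> d i = 1 \<or> d i = - 1"
  shows "(\<Prod>i\<in>S. 2 - d i) = 3 ^ card {i\<in>S. d i = - 1}"
    and "\<bar>\<Prod>i\<in>S. - 2 - d i\<bar> = 3 ^ card {i\<in>S. d i = 1}"
    and "(\<Sum>i\<in>S. d i) = real (card {i\<in>S. d i = 1}) - real (card {i\<in>S. d i = - 1})"
proof -
  have "2 - d i = (if d i = - 1 then 3 else 1)" "\<bar>- 2 - d i\<bar> = (if d i = 1 then 3 else 1)" if "i \<in> S" for i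
    using assms(2)[OF that] by auto
  note d = this
  have "(\<Prod>i\<in>S. 2 - d i) = (\<Prod>i\<in>S. if d i = - 1 then 3 else 1)"
    by (rule prod.cong) (simp_all only: d)
  then show "(\<Prod>i\<in>S. 2 - d i) = 3 ^ card {i\<in>S. d i = - 1}"
    using assms(1) by (simp add: prod.If_cases Int_def)
  have "\<bar>\<Prod>i\<in>S. - 2 - d i\<bar> = (\<Prod>i\<in>S. if d i = 1 then 3 else 1)"
    unfolding abs_prod by (rule prod.cong) (simp_all only: d)
  then show "\<bar>\<Prod>i\<in>S. - 2 - d i\<bar> = 3 ^ card {i\<in>S. d i = 1}"
    using assms(1) by (simp add: prod.If_cases Int_def)
  have "(\<Sum>i\<in>S. d i) = (\<Sum>i\<in>S. (if d i = 1 then 1 else 0) - (if d i = - 1 then 1 else 0))"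
    by (rule sum.cong) (use assms(2) in auto)
  then show "(\<Sum>i\<in>S. d i) = real (card {i\<in>S. d i = 1}) - real (card {i\<in>S. d i = - 1})"
    using assms(1) by (simp add: sum_subtractf sum.If_cases Int_def)
qed

text \<open>In effect the independence of the trace from the basis, extracted from two values of the
  characteristic polynomial.\<close>

lemma signs_from_char_poly:
  fixes d :: "'i \<Rightarrow> real" and e :: "'j \<Rightarrow> real"
  assumes "finite S" "\<And>i. i \<in> S \<Longrightarrow> d i = 1 \<or> d i = - 1"
    and "finite T" "\<And>i. i \<in> T \<Longrightarrow> e i = 1 \<or> e i = - 1"
    and eq: "(\<Prod>i\<in>S. [:- d i, 1:]) = (\<Prod>i\<in>T. [:- e i, 1:])"
  shows "(\<Sum>i\<in>S. d i) = (\<Sum>i\<in>T. e i)"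
proof -
  have eq': "(\<Prod>i\<in>S. x - d i) = (\<Prod>i\<in>T. x - e i)" for x
    using arg_cong[OF eq, of "\<lambda>p. poly p x"] by (simp add: poly_prod)
  have "(3::real) ^ card {i\<in>S. d i = - 1} = 3 ^ card {i\<in>T. e i = - 1}"
    using prod_sign_eq_power(1)[OF assms(1), of d] prod_sign_eq_power(1)[OF assms(3), of e] assms(2,4) eq'[of 2] by simp
  moreover have "(3::real) ^ card {i\<in>S. d i = 1} = 3 ^ card {i\<in>T. e i = 1}"
    using prod_sign_eq_power(2)[OF assms(1), of d] prod_sign_eq_power(2)[OF assms(3), of e] assms(2,4) eq'[of "- 2"] by simp
  moreover have "(\<Sum>i\<in>S. d i) = real (card {i\<in>S. d i = 1}) - real (card {i\<in>S. d i = - 1})"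
    by (rule prod_sign_eq_power(3)) (use assms in auto)
  moreover have "(\<Sum>i\<in>T. e i) = real (card {i\<in>T. e i = 1}) - real (card {i\<in>T. e i = - 1})"
    by (rule prod_sign_eq_power(3)) (use assms in auto)
  ultimately show ?thesis by simp
qed

section \<open>Uniqueness of the exponents in the dimension series\<close>

lemma fps_nth_mult_prodinf:
  assumes "\<And>i. one_below (Suc i) (f i)" "\<And>i. one_below (Suc i) (g i)" "n \<le> N"
  shows "fps_nth (prodinf f * prodinf g) n = fps_nth ((\<Prod>i<N. f i) * (\<Prod>i<N. g i)) n"
  unfolding fps_mult_nth using assms
  by (intro sum.cong refl) (simp add: fps_nth_prodinf[where N = N])

lemma one_minus_X: "1 - fps_X ^ k = 1 - fps_const (1::real) * fps_X ^ k"
  and one_plus_X: "1 + fps_X ^ k = 1 - fps_const (- 1 :: real) * fps_X ^ k"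
  by (simp_all flip: fps_const_neg)

lemma one_below_minus: "one_below (Suc i) (inverse ((1 - fps_X ^ Suc i) ^ m))"
  and one_below_plus: "one_below (Suc i) (inverse ((1 + fps_X ^ Suc i) ^ m))"
  and nth_minus: "fps_nth (inverse ((1 - fps_X ^ Suc i) ^ m)) (Suc i) = real m"
  and nth_plus: "fps_nth (inverse ((1 + fps_X ^ Suc i) ^ m)) (Suc i) = - real m"
  unfolding one_minus_X one_plus_X
  using one_below_factor[of "Suc i" 1 m] one_below_factor[of "Suc i" "- 1" m] by simp_all

lemma fps_nth_prod_0: "(\<And>i. one_below (Suc i) (f i)) \<Longrightarrow> fps_nth (\<Prod>i<k. f i) 0 = 1"
  by (induction k) (auto simp: one_below_def)

text \<open>Once the smaller exponents agree, the coefficient of degree \<open>i\<close> in the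
  first series determines \<open>b i + b' i\<close>, and that in the second determines
  \<open>b i - b' i\<close>, since the inverse of \<open>1 + x^i\<close> starts with
  \<open>1 - x^i\<close>.\<close>

lemma dimension_data_unique:
  assumes "dimension_data H \<tau> b b'" "dimension_data H \<tau> c c'" "0 < i"
  shows "b i = c i \<and> b' i = c' i"
  using assms(3)
proof (induction i rule: less_induct)
  case (less i)
  then obtain k where i: "i = Suc k" by (metis gr0_conv_Suc)
  define F where "F b b' i = (inverse ((1 - fps_X ^ Suc i) ^ (b (Suc i) + b' (Suc i))) :: real fps)" for b b' :: "nat \<Rightarrow> nat" and i
  define G where "G b i = (inverse ((1 - fps_X ^ Suc i) ^ b (Suc i)) :: real fps)" for b :: "nat \<Rightarrow> nat" and i
  define K where "K b i = (inverse ((1 + fps_X ^ Suc i) ^ b (Suc i)) :: real fps)" for b :: "nat \<Rightarrow> nat" and i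
  have ob: "one_below (Suc i) (F b b' i)" "one_below (Suc i) (G b i)" "one_below (Suc i) (K b i)" for b b' i
    unfolding F_def G_def K_def by (rule one_below_minus one_below_plus)+
  have nth: "fps_nth (F b b' k) (Suc k) = real (b (Suc k) + b' (Suc k))" "fps_nth (G b k) (Suc k) = real (b (Suc k))"
    "fps_nth (K b' k) (Suc k) = - real (b' (Suc k))" for b b'
    unfolding F_def G_def K_def by (rule nth_minus nth_plus)+
  have eq: "prodinf (F b b') = prodinf (F c c')" "prodinf (G b) * prodinf (K b') = prodinf (G c) * prodinf (K c')"
    using assms(1,2) unfolding dimension_data_def F_def G_def K_def by metis+
  have IH: "b (Suc j) = c (Suc j)" "b' (Suc j) = c' (Suc j)" if "j < k" for j
    using less.IH[of "Suc j"] that by (auto simp: i)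
  have same: "(\<Prod>i<k. F b b' i) = (\<Prod>i<k. F c c' i)" "(\<Prod>i<k. G b i) = (\<Prod>i<k. G c i)"
    "(\<Prod>i<k. K b' i) = (\<Prod>i<k. K c' i)"
    by (auto simp: F_def G_def K_def IH intro!: prod.cong)
  have F: "fps_nth (prodinf (F b b')) (Suc k) = fps_nth (\<Prod>i<k. F b b' i) (Suc k) + real (b (Suc k) + b' (Suc k))" for b b'
  proof -
    have "fps_nth (prodinf (F b b')) (Suc k) = fps_nth ((\<Prod>i<k. F b b' i) * F b b' k) (Suc k)"
      using fps_nth_prodinf[OF ob(1), of "Suc k" "Suc k"] by simp
    also have "\<dots> = fps_nth (\<Prod>i<k. F b b' i) (Suc k) + fps_nth (F b b' k) (Suc k)"
      by (rule one_below_mult_nth_eq[OF ob(1) fps_nth_prod_0[OF ob(1)]]) simp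
    finally show ?thesis by (simp only: nth)
  qed
  have GK: "fps_nth (prodinf (G b) * prodinf (K b')) (Suc k)
    = fps_nth ((\<Prod>i<k. G b i) * (\<Prod>i<k. K b' i)) (Suc k) + (real (b (Suc k)) - real (b' (Suc k)))" for b b'
  proof -
    have "fps_nth (prodinf (G b) * prodinf (K b')) (Suc k)
      = fps_nth (((\<Prod>i<k. G b i) * G b k) * ((\<Prod>i<k. K b' i) * K b' k)) (Suc k)"
      using fps_nth_mult_prodinf[OF ob(2) ob(3), of "Suc k" "Suc k"] by simp
    also have "\<dots> = fps_nth (((\<Prod>i<k. G b i) * (\<Prod>i<k. K b' i)) * (G b k * K b' k)) (Suc k)"
      by (simp only: ac_simps)
    also have "\<dots> = fps_nth ((\<Prod>i<k. G b i) * (\<Prod>i<k. K b' i)) (Suc k) + fps_nth (G b k * K b' k) (Suc k)"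
      by (rule one_below_mult_nth_eq[OF one_below_mult[OF ob(2) ob(3)]])
        (simp_all add: fps_nth_prod_0[OF ob(2)] fps_nth_prod_0[OF ob(3)])
    also have "fps_nth (G b k * K b' k) (Suc k) = fps_nth (G b k) (Suc k) + fps_nth (K b' k) (Suc k)"
      by (rule one_below_mult_nth_eq[OF ob(3)]) (use ob(2) in \<open>auto simp: one_below_def\<close>)
    finally show ?thesis by (simp add: nth)
  qed
  have "real (b (Suc k) + b' (Suc k)) = real (c (Suc k) + c' (Suc k))"
    using F[of b b'] F[of c c'] unfolding eq(1) same(1) by linarith
  moreover have "real (b (Suc k)) - real (b' (Suc k)) = real (c (Suc k)) - real (c' (Suc k))"
    using GK[of b b'] GK[of c c'] unfolding eq(2) same(2,3) by linarith
  ultimately show ?case unfolding i by linarith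
qed

lemma mult_coeff_cong:
  assumes "\<And>i. 0 < i \<Longrightarrow> b i = c i \<and> b' i = c' i"
  shows "mult_coeff b b' = mult_coeff c c'"
  using assms by (simp add: mult_coeff_def multiplicity_series_def)

lemma finite_double_partitions: "finite (double_partitions n)"
proof -
  let ?F = "{A. set_mset A \<subseteq> {..n} \<and> size A \<le> n}"
  have b: "set_mset l \<subseteq> {..n} \<and> size l \<le> n" if "0 \<notin># l" "sum_mset l \<le> n" for l :: "nat multiset" and n
    using that
  proof (induction l arbitrary: n)
    case (add x l)
    then have "0 < x" "x \<le> n" "sum_mset l \<le> n - x" "0 \<notin># l" by auto
    from add.IH[OF this(4,3)] this(1,2) show ?case by auto
  qed simp
  have "double_partitions n \<subseteq> ?F \<times> ?F"
  proof
    fix p assume "p \<in> double_partitions n"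
    then obtain l l' where p: "p = (l, l')" "0 \<notin># l" "0 \<notin># l'" "sum_mset l + sum_mset l' = n"
      by (auto simp: double_partitions_def)
    then show "p \<in> ?F \<times> ?F" using b[of l n] b[of l' n] by simp
  qed
  moreover have "finite (?F \<times> ?F)" by (intro finite_cartesian_product finite_bounded_multisets) simp_all
  ultimately show ?thesis by (rule finite_subset)
qed

context hopf_involution
begin

section \<open>Multiplicities as numbers of monomials\<close>

abbreviation gens_plus :: "'a set" where "gens_plus \<equiv> {x \<in> gens. sg x = 1}"
abbreviation gens_minus :: "'a set" where "gens_minus \<equiv> {x \<in> gens. sg x \<noteq> 1}"

definition bplus :: "nat \<Rightarrow> nat" where
  "bplus i = card {x \<in> gens_plus. deg x = i}"

definition bminus :: "nat \<Rightarrow> nat" where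
  "bminus i = card {x \<in> gens_minus. deg x = i}"

lemma finite_gens_sub: "finite {x \<in> {x \<in> gens. P x}. deg x \<le> n}" "finite {x \<in> {x \<in> gens. P x}. deg x = n}"
  by (rule finite_subset[OF _ finite_gens_le[of n]]; auto)+

text \<open>Unbarred and barred variables are disjoint, so only one way of splitting the monomial
  contributes.\<close>

lemma sum_over_disjoint_images:
  fixes F :: "(nat + nat) multiset \<Rightarrow> int" and l l' :: "nat multiset"
  assumes F: "\<And>A. F A \<noteq> 0 \<Longrightarrow> \<exists>B. A = image_mset Inl B" and G: "\<And>A. G A \<noteq> 0 \<Longrightarrow> \<exists>B. A = image_mset Inr B"
  shows "(\<Sum>(A, B) | A + B = image_mset Inl l + image_mset Inr l'. F A * G B) = F (image_mset Inl l) * G (image_mset Inr l')"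
proof -
  have "(\<Sum>(A, B) | A + B = image_mset Inl l + image_mset Inr l'. F A * G B)
    = (\<Sum>(A, B)\<in>{(image_mset Inl l, image_mset Inr l')}. F A * G B)"
  proof (rule sum.mono_neutral_right)
    show "finite {(A, B). A + B = image_mset Inl l + image_mset Inr l'}" by (rule finite_mset_splittings)
    show "\<forall>p\<in>{(A, B). A + B = image_mset Inl l + image_mset Inr l'} - {(image_mset Inl l, image_mset Inr l')}.
      (case p of (A, B) \<Rightarrow> F A * G B) = 0"
    proof (clarify, rule ccontr)
      fix A B assume AB: "A + B = image_mset Inl l + image_mset Inr l'"
        and ne: "(A, B) \<notin> {}" "\<not> (A = image_mset Inl l \<and> B = image_mset Inr l')"
        and "F A * G B \<noteq> 0"
      then obtain C C' where C: "A = image_mset Inl C" "B = image_mset Inr C'" using F G by fastforce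
      have f: "filter_mset isl (image_mset Inl N + image_mset Inr N') = image_mset Inl N"
        "filter_mset (\<lambda>x. \<not> isl x) (image_mset Inl N + image_mset Inr N') = image_mset Inr N'" for N N' :: "nat multiset"
        by (simp_all add: filter_mset_image_mset comp_def)
      have "filter_mset isl (A + B) = A" "filter_mset (\<lambda>x. \<not> isl x) (A + B) = B"
        unfolding C f by (rule refl)+
      moreover have "filter_mset isl (A + B) = image_mset Inl l" "filter_mset (\<lambda>x. \<not> isl x) (A + B) = image_mset Inr l'"
        unfolding AB f by (rule refl)+
      ultimately show False using ne by simp
    qed
  qed auto
  then show ?thesis by simp
qed

text \<open>A multiset of generators splits uniquely by sign, and each of the two infinite products
  counts one of the halves by its degrees.\<close>

lemma mult_coeff_count:
  "mult_coeff bplus bminus (l, l') = card {M. set_mset M \<subseteq> gens \<and> plus_degs M = l \<and> minus_degs M = l'}"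
proof -
  have p: "mfps_coeff (mfps_prodinf (\<lambda>i. mfps_inverse (1 - mfps_var (Inl (Suc i))) ^ bplus (Suc i))) M
    = int (card (coloured_msets gens_plus (Inl \<circ> deg) M))" for M :: "(nat + nat) multiset"
    unfolding bplus_def
    by (rule mfps_coeff_prodinf[OF finite_gens_sub(1)]) (auto intro: gens_deg_pos)
  have m: "mfps_coeff (mfps_prodinf (\<lambda>i. mfps_inverse (1 - mfps_var (Inr (Suc i))) ^ bminus (Suc i))) M
    = int (card (coloured_msets gens_minus (Inr \<circ> deg) M))" for M :: "(nat + nat) multiset"
    unfolding bminus_def
    by (rule mfps_coeff_prodinf[OF finite_gens_sub(1)]) (auto intro: gens_deg_pos)
  have nonempty: "\<exists>x. x \<in> S" if "int (card S) \<noteq> 0" for S :: "'a multiset set"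
    using that by (metis card.empty of_nat_0 ex_in_conv)
  have "mfps_coeff (multiplicity_series bplus bminus) (image_mset Inl l + image_mset Inr l')
    = (\<Sum>(A, B) | A + B = image_mset Inl l + image_mset Inr l'.
        int (card (coloured_msets gens_plus (Inl \<circ> deg) A)) * int (card (coloured_msets gens_minus (Inr \<circ> deg) B)))"
    unfolding multiplicity_series_def times_mfps.rep_eq p m ..
  also have "\<dots> = int (card (coloured_msets gens_plus (Inl \<circ> deg) (image_mset Inl l :: (nat + nat) multiset)))
      * int (card (coloured_msets gens_minus (Inr \<circ> deg) (image_mset Inr l' :: (nat + nat) multiset)))"
  proof (rule sum_over_disjoint_images[where
        F = "\<lambda>A. int (card (coloured_msets gens_plus (Inl \<circ> deg) A))" and
        G = "\<lambda>B. int (card (coloured_msets gens_minus (Inr \<circ> deg) B))"])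
    fix A assume "int (card (coloured_msets gens_plus (Inl \<circ> deg) A)) \<noteq> 0"
    from nonempty[OF this] show "\<exists>B. A = image_mset Inl B"
      by (auto simp: coloured_msets_def simp flip: multiset.map_comp)
  next
    fix A assume "int (card (coloured_msets gens_minus (Inr \<circ> deg) A)) \<noteq> 0"
    from nonempty[OF this] show "\<exists>B. A = image_mset Inr B"
      by (auto simp: coloured_msets_def simp flip: multiset.map_comp)
  qed
  also have "coloured_msets gens_plus (Inl \<circ> deg) (image_mset Inl l) = coloured_msets gens_plus deg l"
    by (auto simp: coloured_msets_def inj_eq[OF multiset.inj_map[OF inj_Inl]] simp flip: multiset.map_comp)
  also have "coloured_msets gens_minus (Inr \<circ> deg) (image_mset Inr l') = coloured_msets gens_minus deg l'"
    by (auto simp: coloured_msets_def inj_eq[OF multiset.inj_map[OF inj_Inr]] simp flip: multiset.map_comp)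
  finally have "mult_coeff bplus bminus (l, l')
    = card (coloured_msets gens_plus deg l \<times> coloured_msets gens_minus deg l')"
    by (simp add: mult_coeff_def card_cartesian_product flip: of_nat_mult)
  also have "\<dots> = card {M. set_mset M \<subseteq> gens \<and> plus_degs M = l \<and> minus_degs M = l'}"
  proof (rule bij_betw_same_card[of "\<lambda>(A, B). A + B"], rule bij_betw_byWitness[where f' = "\<lambda>M. ({#x \<in># M. sg x = 1#}, {#x \<in># M. sg x \<noteq> 1#})"])
    have f: "{#x \<in># A. sg x = 1#} = A" "{#x \<in># A. sg x \<noteq> 1#} = {#}" if "set_mset A \<subseteq> gens_plus" for A
      using that by (auto simp: filter_mset_eq_conv)
    have g: "{#x \<in># A. sg x = 1#} = {#}" "{#x \<in># A. sg x \<noteq> 1#} = A" if "set_mset A \<subseteq> gens_minus" for A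
      using that by (auto simp: filter_mset_eq_conv)
    show "\<forall>a\<in>coloured_msets gens_plus deg l \<times> coloured_msets gens_minus deg l'.
       (\<lambda>M. ({#x \<in># M. sg x = 1#}, {#x \<in># M. sg x \<noteq> 1#})) ((\<lambda>(A, B). A + B) a) = a"
      by (auto simp: coloured_msets_def f g)
    show "\<forall>a'\<in>{M. set_mset M \<subseteq> gens \<and> plus_degs M = l \<and> minus_degs M = l'}.
       (\<lambda>(A, B). A + B) ({#x \<in># a'. sg x = 1#}, {#x \<in># a'. sg x \<noteq> 1#}) = a'"
      by (auto simp flip: multiset_partition)
    show "(\<lambda>(A, B). A + B) ` (coloured_msets gens_plus deg l \<times> coloured_msets gens_minus deg l')
      \<subseteq> {M. set_mset M \<subseteq> gens \<and> plus_degs M = l \<and> minus_degs M = l'}"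
      by (auto simp: coloured_msets_def plus_degs_def minus_degs_def f g)
    show "(\<lambda>M. ({#x \<in># M. sg x = 1#}, {#x \<in># M. sg x \<noteq> 1#})) `
       {M. set_mset M \<subseteq> gens \<and> plus_degs M = l \<and> minus_degs M = l'}
      \<subseteq> coloured_msets gens_plus deg l \<times> coloured_msets gens_minus deg l'"
      by (auto simp: coloured_msets_def plus_degs_def minus_degs_def)
  qed
  finally show ?thesis .
qed

lemma degs_double_partition:
  assumes "set_mset M \<subseteq> gens"
  shows "(plus_degs M, minus_degs M) \<in> double_partitions n \<longleftrightarrow> M \<in> mon n"
proof -
  have "sum_mset (image_mset deg M) = sum_mset (plus_degs M) + sum_mset (minus_degs M)"
    unfolding plus_degs_def minus_degs_def
    by (metis image_mset_union multiset_partition sum_mset.union)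
  moreover have "0 \<notin># plus_degs M" "0 \<notin># minus_degs M"
    using assms gens_deg_pos by (fastforce simp: plus_degs_def minus_degs_def)+
  ultimately show ?thesis using assms by (simp add: mon_def double_partitions_def)
qed

lemma mult_coeff_mon:
  assumes "(l, l') \<in> double_partitions n"
  shows "mult_coeff bplus bminus (l, l') = card {M \<in> mon n. (plus_degs M, minus_degs M) = (l, l')}"
proof -
  have "{M. set_mset M \<subseteq> gens \<and> plus_degs M = l \<and> minus_degs M = l'}
    = {M \<in> mon n. (plus_degs M, minus_degs M) = (l, l')}"
    using assms degs_double_partition by (auto simp: mon_def)
  then show ?thesis by (simp only: mult_coeff_count)
qed

section \<open>The trace of the involution and the dimension series\<close>

definition msign :: "'a multiset \<Rightarrow> real" where
  "msign M = prod_mset (image_mset sg M)"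

lemma msign_cases: "msign M = 1 \<or> msign M = - 1"
  unfolding msign_def
proof (induction M)
  case (add x M)
  then show ?case using sg_cases[of x] by auto
qed simp

lemma dim_H: "dim (H n) = card (mon n)"
proof -
  have "inj_on monomial (mon n)" "independent (monomial ` mon n)"
    by (rule independent_family; fact finite_mon monomials_independent)+
  then show ?thesis
    using dim_span_eq_card_independent[of "monomial ` mon n"] by (simp add: span_monomials card_image)
qed

text \<open>Both sides are the trace of \<open>\<tau>\<close> on \<open>H n\<close>, once in an
  eigenbasis and once on the diagonal of its triangular matrix in the monomial basis. Equality of
  the characteristic polynomials transfers the count of signs.\<close>

lemma dim_eigenspaces:
  "real (dim (eigenspace (H n) \<tau> 1)) - real (dim (eigenspace (H n) \<tau> (- 1))) = (\<Sum>M\<in>mon n. msign M)"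
proof -
  \<comment> \<open>The complement construction with \<open>U = {0}\<close> provides an
    eigenbasis.\<close>
  obtain B where B: "B \<subseteq> H n" "H n \<subseteq> span (B \<union> {0})" "\<And>x. x \<in> B \<Longrightarrow> \<tau> x = x \<or> \<tau> x = - x"
    "\<And>x. x \<in> B \<Longrightarrow> x \<notin> span ({0} \<union> (B - {x}))"
    using eigenbasis_of_complement[of "{0}" "H n" \<tau>] tau_linear tau_graded[of n] linear_0[OF tau_linear]
      subspace_0[OF subspace_H] subspace_H[of n] by (auto simp: subspace_single_0)
  have sB: "span B = H n"
    using B(1,2) span_minimal[OF B(1) subspace_H] by (auto simp: span_insert_0)
  have iB: "independent B"
    using B(4) by (auto simp: dependent_def span_insert_0)
  obtain T where "finite T" "H n \<subseteq> span T" using fin_dim[of n] by (auto simp: finite_dimensional_set_def)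
  then have fB: "finite B" using independent_span_bound[OF _ iB] B(1) by blast
  define d where "d x = (if \<tau> x = x then 1 else - 1 :: real)" for x
  have d: "\<tau> x = d x *\<^sub>R x" if "x \<in> B" for x using B(3)[OF that] by (auto simp: d_def)
  have "has_char_poly (H n) \<tau> (\<Prod>x\<in>B. [:- d x, 1:])"
  \<comment> \<open>With a constant key no index is smaller than another, so triangular means
    diagonal.\<close>
  proof (rule eigenvalues_triangular(1)[where key = "\<lambda>_. 0" and val = "\<lambda>x. x", OF fB _ _ tau_linear])
    show "\<forall>x\<in>B. c x = 0" if "(\<Sum>x\<in>B. c x *\<^sub>R x) = 0" for c
      using independentD[OF iB fB order_refl that] by blast
    show "span ((\<lambda>x. x) ` B) = H n" by (simp add: sB)
    show "\<tau> x - d x *\<^sub>R x \<in> span ((\<lambda>x. x) ` {y \<in> B. (0::nat) < 0})" if "x \<in> B" for x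
      using d[OF that] by (simp add: span_zero)
  qed
  moreover have "has_char_poly (H n) \<tau> (\<Prod>M\<in>mon n. [:- msign M, 1:])"
    unfolding msign_def by (rule triangular_spectrum(1)[OF tau_linear tau_triangular])
  moreover obtain bs where "set bs = B" "distinct bs" using finite_distinct_list[OF fB] by blast
  then have "ordered_basis (H n) bs" by (simp add: ordered_basis_def iB sB)
  ultimately have "(\<Prod>x\<in>B. [:- d x, 1:]) = (\<Prod>M\<in>mon n. [:- msign M, 1:])"
    unfolding has_char_poly_def by metis
  then have "(\<Sum>x\<in>B. d x) = (\<Sum>M\<in>mon n. msign M)"
    by (intro signs_from_char_poly fB finite_mon msign_cases) (simp_all add: d_def)
  moreover have "dim (eigenspace (H n) \<tau> s) = card {x \<in> B. d x = s}" if s: "s = 1 \<or> s = - 1" for s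
  proof -
    \<comment> \<open>The projection onto the eigenspace for \<open>s\<close>: it fixes eigenvectors
      for \<open>s\<close> and kills those for \<open>- s\<close>.\<close>
    let ?p = "\<lambda>v. (1/2) *\<^sub>R (v + s *\<^sub>R \<tau> v)"
    have lp: "linear ?p"
      by (intro linear_compose_scale_right linear_compose_add linear_ident tau_linear)
    have "eigenspace (H n) \<tau> s = span {x \<in> B. d x = s}"
    proof (intro equalityI subsetI)
      fix v assume v: "v \<in> eigenspace (H n) \<tau> s"
      then have "v \<in> span B" and tv: "\<tau> v = s *\<^sub>R v" by (auto simp: eigenspace_def sB)
      have "?p v \<in> span {x \<in> B. d x = s}"
      proof (rule linear_image_subset_span[OF lp _ \<open>v \<in> span B\<close>])
        fix x assume x: "x \<in> B"
        then have "?p x = (if d x = s then x else 0)"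
          using s d[OF x] by (auto simp: d_def simp flip: scaleR_2 split: if_splits)
        then show "?p x \<in> span {x \<in> B. d x = s}"
          using x by (auto simp: span_zero intro: span_base)
      qed
      moreover have "?p v = v" using s by (auto simp: tv simp flip: scaleR_2)
      ultimately show "v \<in> span {x \<in> B. d x = s}" by simp
    next
      fix v assume v: "v \<in> span {x \<in> B. d x = s}"
      have "subspace (eigenspace (H n) \<tau> s)"
        using subspace_H[of n] tau_linear
        by (auto simp: eigenspace_def subspace_def linear_add linear_scale linear_0 scaleR_add_right)
      moreover have "{x \<in> B. d x = s} \<subseteq> eigenspace (H n) \<tau> s"
        using d B(1) by (auto simp: eigenspace_def)
      ultimately show "v \<in> eigenspace (H n) \<tau> s" using v span_minimal by blast
    qed
    moreover have "independent {x \<in> B. d x = s}" using iB by (rule independent_mono) auto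
    from dim_span_eq_card_independent[OF this]
    have "dim (span {x \<in> B. d x = s}) = card {x \<in> B. d x = s}" .
    ultimately show ?thesis by simp
  qed
  ultimately show ?thesis
    using prod_sign_eq_power(3)[OF fB, of d] by (simp add: d_def)
qed

text \<open>A generator of degree \<open>i\<close> and weight \<open>s\<close> contributes the
  inverse of \<open>1 - s x^i\<close>. Weight 1 throughout counts the monomials; the signs of the
  generators as weights give the signed count, which is the trace of \<open>\<tau>\<close>.\<close>

lemma dimension_data_gens: "dimension_data H \<tau> bplus bminus"
proof -
  have card: "bplus i + bminus i = card {x \<in> gens. deg x = i}" for i
  proof -
    have "{x \<in> gens. deg x = i} = {x \<in> gens_plus. deg x = i} \<union> {x \<in> gens_minus. deg x = i}" by auto
    also have "card \<dots> = bplus i + bminus i"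
      unfolding bplus_def bminus_def by (rule card_Un_disjoint) (use finite_gens_sub in auto)
    finally show ?thesis ..
  qed
  let ?h = "\<lambda>s k. inverse (1 - fps_const s * fps_X ^ k) :: real fps"
  define F :: "nat \<Rightarrow> real fps" where "F i = inverse ((1 - fps_X ^ Suc i) ^ (bplus (Suc i) + bminus (Suc i)))" for i
  define P :: "nat \<Rightarrow> real fps" where "P i = inverse ((1 - fps_X ^ Suc i) ^ bplus (Suc i))" for i
  define M :: "nat \<Rightarrow> real fps" where "M i = inverse ((1 + fps_X ^ Suc i) ^ bminus (Suc i))" for i
  have ob: "one_below (Suc i) (F i)" "one_below (Suc i) (P i)" "one_below (Suc i) (M i)" for i
    unfolding F_def P_def M_def by (rule one_below_minus one_below_plus)+
  have w: "fps_nth (\<Prod>x\<in>{x \<in> gens. deg x \<le> n}. ?h (\<sigma> x) (deg x)) n = (\<Sum>A\<in>mon n. prod_mset (image_mset \<sigma> A))" for \<sigma> n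
    unfolding weighted_msets_gens[symmetric]
    by (rule fps_nth_prod_weighted_msets) (use finite_gens_le gens_deg_pos in auto)
  have e1: "fps_nth (prodinf F) n = real (dim (H n))" for n
  proof -
    have "(\<Prod>i<n. F i) = (\<Prod>i<n. ?h 1 (Suc i) ^ card {x \<in> gens. deg x = Suc i})"
      by (simp only: F_def card one_minus_X fps_inverse_power)
    also have "\<dots> = (\<Prod>x | x \<in> gens \<and> deg x \<le> n. ?h 1 (deg x))"
      by (rule prod_group_power) (use finite_gens_le gens_deg_pos in auto)
    finally show ?thesis
      using w[of "\<lambda>_. 1" n] by (simp add: fps_nth_prodinf[OF ob(1) order_refl] dim_H image_mset_const_eq)
  qed
  have e2: "fps_nth (prodinf P * prodinf M) n
    = real (dim (eigenspace (H n) \<tau> 1)) - real (dim (eigenspace (H n) \<tau> (- 1)))" for n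
  proof -
    let ?\<Pi> = "\<lambda>A. \<Prod>x | x \<in> A \<and> deg x \<le> n. ?h (sg x) (deg x)"
    have "(\<Prod>i<n. P i) = (\<Prod>i<n. ?h 1 (Suc i) ^ card {x \<in> gens_plus. deg x = Suc i})"
      by (simp only: P_def bplus_def one_minus_X fps_inverse_power)
    also have "\<dots> = (\<Prod>x | x \<in> gens_plus \<and> deg x \<le> n. ?h 1 (deg x))"
      by (rule prod_group_power[of gens_plus deg n "?h 1"]) (use finite_gens_sub gens_deg_pos in auto)
    also have "\<dots> = ?\<Pi> gens_plus" by (rule prod.cong) auto
    finally have p: "(\<Prod>i<n. P i) = ?\<Pi> gens_plus" .
    have "(\<Prod>i<n. M i) = (\<Prod>i<n. ?h (- 1) (Suc i) ^ card {x \<in> gens_minus. deg x = Suc i})"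
      by (simp only: M_def bminus_def one_plus_X fps_inverse_power)
    also have "\<dots> = (\<Prod>x | x \<in> gens_minus \<and> deg x \<le> n. ?h (- 1) (deg x))"
      by (rule prod_group_power[of gens_minus deg n "?h (- 1)"]) (use finite_gens_sub gens_deg_pos in auto)
    also have "\<dots> = ?\<Pi> gens_minus"
      by (rule prod.cong) (use sg_cases in \<open>force simp del: fps_const_neg\<close>)+
    finally have m: "(\<Prod>i<n. M i) = ?\<Pi> gens_minus" .
    have "fps_nth (prodinf P * prodinf M) n = fps_nth (?\<Pi> gens_plus * ?\<Pi> gens_minus) n"
      by (simp only: fps_nth_mult_prodinf[OF ob(2,3) order_refl] p m)
    also have "?\<Pi> gens_plus * ?\<Pi> gens_minus
      = (\<Prod>x\<in>{x. x \<in> gens_plus \<and> deg x \<le> n} \<union> {x. x \<in> gens_minus \<and> deg x \<le> n}. ?h (sg x) (deg x))"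
      by (rule prod.union_disjoint[symmetric]) (use finite_gens_sub in auto)
    also have "{x. x \<in> gens_plus \<and> deg x \<le> n} \<union> {x. x \<in> gens_minus \<and> deg x \<le> n} = {x \<in> gens. deg x \<le> n}" by auto
    finally show ?thesis by (simp only: w dim_eigenspaces msign_def)
  qed
  have "Abs_fps (\<lambda>n. real (dim (H n))) = prodinf F"
    "Abs_fps (\<lambda>n. real (dim (eigenspace (H n) \<tau> 1)) - real (dim (eigenspace (H n) \<tau> (- 1)))) = prodinf P * prodinf M"
    by (rule fps_ext, simp only: fps_nth_Abs_fps e1 e2)+
  then show ?thesis unfolding dimension_data_def F_def P_def M_def by blast
qed

text \<open>All the operators are triangular in one and the same ordered basis, so the diagonal of a
  combination is the combination of the diagonals. A double-partition contributes exactly if it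
  occurs as the degrees of some monomial, that is, if its multiplicity is nonzero.\<close>

lemma descent_combination_spectrum:
  fixes D :: "'i \<Rightarrow> decorated_composition" and a :: "'i \<Rightarrow> real"
  assumes D: "\<And>i. i \<in> I \<Longrightarrow> weak_composition n (undecorate (D i))"
    and b: "dimension_data H \<tau> b b'"
  defines "f \<equiv> \<lambda>x. \<Sum>i\<in>I. a i *\<^sub>R dop (D i) x"
    and "ev \<equiv> \<lambda>l l'. \<Sum>i\<in>I. a i * beta (D i) l l'"
  shows "eigenvalues (H n) f = {ev l l' | l l'. (l, l') \<in> double_partitions n \<and> mult_coeff b b' (l, l') \<noteq> 0}"
    and "has_char_poly (H n) f (\<Prod>(l, l')\<in>double_partitions n. [:- ev l l', 1:] ^ mult_coeff b b' (l, l'))"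
proof -
  have mc: "mult_coeff b b' = mult_coeff bplus bminus"
    by (rule mult_coeff_cong) (rule dimension_data_unique[OF b dimension_data_gens])
  define g where "g M = (plus_degs M, minus_degs M)" for M
  define d where "d M = case_prod ev (g M)" for M
  have lin: "linear f"
    unfolding f_def by (intro linear_compose_sum ballI linear_compose_scale_right linear_descent_op)
  have tri: "f (monomial M) - d M *\<^sub>R monomial M \<in> span (monomial ` lower (mlev M) (size M) n)" if M: "M \<in> mon n" for M
  proof -
    have "(\<Sum>i\<in>I. a i *\<^sub>R (dop (D i) (monomial M) - diag (D i) M *\<^sub>R monomial M))
      \<in> span (monomial ` lower (mlev M) (size M) n)"
      by (intro span_sum span_scale descent_op_triangular M D)
    moreover have "d M = (\<Sum>i\<in>I. a i * diag (D i) M)"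
      by (simp add: d_def g_def ev_def diag_eq_beta)
    ultimately show ?thesis
      by (simp add: f_def scaleR_diff_right sum_subtractf scaleR_sum_left)
  qed
  note sp = triangular_spectrum[OF lin tri]
  have gd: "g M \<in> double_partitions n" if "M \<in> mon n" for M
    using that degs_double_partition[of M n] by (simp add: g_def mon_def)
  have count: "mult_coeff b b' p = card {M \<in> mon n. g M = p}" if "p \<in> double_partitions n" for p
    using mult_coeff_mon[of "fst p" "snd p" n] that by (simp add: mc g_def)
  have "eigenvalues (H n) f = d ` mon n" using sp by blast
  also have "\<dots> = {ev l l' | l l'. (l, l') \<in> double_partitions n \<and> mult_coeff b b' (l, l') \<noteq> 0}"
  proof (intro equalityI subsetI)
    fix x assume "x \<in> d ` mon n"
    then obtain M where M: "M \<in> mon n" "x = d M" by blast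
    have "{N \<in> mon n. g N = g M} \<noteq> {}" using M by blast
    then have "mult_coeff b b' (g M) \<noteq> 0" using finite_mon count[OF gd[OF M(1)]] by simp
    then show "x \<in> {ev l l' | l l'. (l, l') \<in> double_partitions n \<and> mult_coeff b b' (l, l') \<noteq> 0}"
      using gd[OF M(1)] M(2) by (cases "g M") (auto simp: d_def)
  next
    fix x assume "x \<in> {ev l l' | l l'. (l, l') \<in> double_partitions n \<and> mult_coeff b b' (l, l') \<noteq> 0}"
    then obtain l l' where l: "x = ev l l'" "(l, l') \<in> double_partitions n" "mult_coeff b b' (l, l') \<noteq> 0" by blast
    then have "{M \<in> mon n. g M = (l, l')} \<noteq> {}" using count[OF l(2)] by force
    then obtain M where "M \<in> mon n" "g M = (l, l')" by blast
    then show "x \<in> d ` mon n" using l(1) by (intro image_eqI[of _ _ M]) (simp_all add: d_def)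
  qed
  finally show "eigenvalues (H n) f = {ev l l' | l l'. (l, l') \<in> double_partitions n \<and> mult_coeff b b' (l, l') \<noteq> 0}" .
  \<comment> \<open>Monomials with the same double-partition of degrees have the same diagonal
    entry; grouping them turns their number into the exponent.\<close>
  have "(\<Prod>M\<in>mon n. [:- d M, 1:]) = (\<Prod>p\<in>double_partitions n. \<Prod>M | M \<in> mon n \<and> g M = p. [:- d M, 1:])"
    by (rule prod.group[symmetric]) (use finite_mon finite_double_partitions gd in auto)
  also have "\<dots> = (\<Prod>(l, l')\<in>double_partitions n. [:- ev l l', 1:] ^ mult_coeff b b' (l, l'))"
  proof (rule prod.cong[OF refl], clarify)
    fix l l' assume "(l, l') \<in> double_partitions n"
    then show "(\<Prod>M | M \<in> mon n \<and> g M = (l, l'). [:- d M, 1:]) = [:- ev l l', 1:] ^ mult_coeff b b' (l, l')"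
      by (simp add: count d_def)
  qed
  finally show "has_char_poly (H n) f (\<Prod>(l, l')\<in>double_partitions n. [:- ev l l', 1:] ^ mult_coeff b b' (l, l'))"
    using sp by simp
qed

end

theorem theorem2p16:
  fixes H :: "nat \<Rightarrow> 'a::real_algebra_1 set"
    and \<Delta> :: "'a \<Rightarrow> 'a tensor_alg"
    and \<epsilon> :: "'a \<Rightarrow> real"
    and \<tau> :: "'a \<Rightarrow> 'a"
  assumes hopf: "graded_connected_hopf_algebra H \<Delta> \<epsilon>"
    and fin_dim: "\<And>n. finite_dimensional_set (H n)"
    and tau_linear: "linear \<tau>"
    and tau_graded: "\<And>n. \<tau> ` H n \<subseteq> H n"
    and tau_involution: "\<tau> \<circ> \<tau> = id"
    and tau_ambimorphism: "hopf_ambimorphism \<Delta> \<tau>"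
  shows "(\<exists>b b'. dimension_data H \<tau> b b') \<and>
    (\<forall>b b'. dimension_data H \<tau> b b' \<longrightarrow>
      (\<forall>n D. signed_weak_composition n D \<or> tilde_signed_weak_composition n D \<longrightarrow>
        eigenvalues (H n) (descent_op H \<Delta> \<epsilon> \<tau> D) =
          {beta D l l' | l l'. (l, l') \<in> double_partitions n \<and> mult_coeff b b' (l, l') \<noteq> 0} \<and>
        has_char_poly (H n) (descent_op H \<Delta> \<epsilon> \<tau> D)
          (\<Prod>(l, l')\<in>double_partitions n. [:- beta D l l', 1:] ^ mult_coeff b b' (l, l'))) \<and>
      (\<forall>n r (D :: nat \<Rightarrow> decorated_composition) (a :: nat \<Rightarrow> real).
        (\<forall>i\<in>{1..r}. signed_weak_composition n (D i)) \<or>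
        (\<forall>i\<in>{1..r}. tilde_signed_weak_composition n (D i)) \<longrightarrow>
        eigenvalues (H n) (\<lambda>x. \<Sum>i=1..r. a i *\<^sub>R descent_op H \<Delta> \<epsilon> \<tau> (D i) x) =
          {\<Sum>i=1..r. a i * beta (D i) l l' | l l'.
             (l, l') \<in> double_partitions n \<and> mult_coeff b b' (l, l') \<noteq> 0} \<and>
        has_char_poly (H n) (\<lambda>x. \<Sum>i=1..r. a i *\<^sub>R descent_op H \<Delta> \<epsilon> \<tau> (D i) x)
          (\<Prod>(l, l')\<in>double_partitions n.
             [:- (\<Sum>i=1..r. a i * beta (D i) l l'), 1:] ^ mult_coeff b b' (l, l'))))"
proof -
  interpret hopf_involution H \<Delta> \<epsilon> \<tau>
    by (intro hopf_involution.intro hopf_involution_axioms.intro hopf fin_dim tau_linear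
        tau_graded tau_involution tau_ambimorphism)
  show ?thesis
  proof (intro conjI allI impI)
    show "\<exists>b b'. dimension_data H \<tau> b b'" using dimension_data_gens by blast
  next
    fix b b' n D assume b: "dimension_data H \<tau> b b'"
      and D: "signed_weak_composition n D \<or> tilde_signed_weak_composition n D"
    then have "weak_composition n (undecorate D)"
      by (auto simp: signed_weak_composition_def tilde_signed_weak_composition_def)
    \<comment> \<open>A single operator is the combination with coefficient 1 over a one-point index
      set.\<close>
    from descent_combination_spectrum[of "{()}" n "\<lambda>_. D" b b' "\<lambda>_. 1", OF this b]
    show "eigenvalues (H n) (descent_op H \<Delta> \<epsilon> \<tau> D) =
          {beta D l l' | l l'. (l, l') \<in> double_partitions n \<and> mult_coeff b b' (l, l') \<noteq> 0}"
      and "has_char_poly (H n) (descent_op H \<Delta> \<epsilon> \<tau> D)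
          (\<Prod>(l, l')\<in>double_partitions n. [:- beta D l l', 1:] ^ mult_coeff b b' (l, l'))"
      by simp_all
  next
    fix b b' n r and D :: "nat \<Rightarrow> decorated_composition" and a :: "nat \<Rightarrow> real"
    assume b: "dimension_data H \<tau> b b'"
      and D: "(\<forall>i\<in>{1..r}. signed_weak_composition n (D i)) \<or> (\<forall>i\<in>{1..r}. tilde_signed_weak_composition n (D i))"
    have "weak_composition n (undecorate (D i))" if "i \<in> {1..r}" for i
      using D that by (auto simp: signed_weak_composition_def tilde_signed_weak_composition_def)
    note * = descent_combination_spectrum[of "{1..r}" n D b b' a, OF this b]
    show "eigenvalues (H n) (\<lambda>x. \<Sum>i=1..r. a i *\<^sub>R descent_op H \<Delta> \<epsilon> \<tau> (D i) x) =
          {\<Sum>i=1..r. a i * beta (D i) l l' | l l'.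
             (l, l') \<in> double_partitions n \<and> mult_coeff b b' (l, l') \<noteq> 0}"
      by (rule *(1))
    show "has_char_poly (H n) (\<lambda>x. \<Sum>i=1..r. a i *\<^sub>R descent_op H \<Delta> \<epsilon> \<tau> (D i) x)
          (\<Prod>(l, l')\<in>double_partitions n.
             [:- (\<Sum>i=1..r. a i * beta (D i) l l'), 1:] ^ mult_coeff b b' (l, l'))"
      by (rule *(2))
  qed
qed

end
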